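(* Let $T>0$ and let $u\in L^\infty(0,T;H^{1/2}(\mathbb{T}^3))\cap L^2(0,T;H^{3/2}(\mathbb{T}^3))$ be a weak solution of the Navier--Stokes equations on $[0,T)$ with initial data $u_0$. Let $w_0\in H^{1/2}(\mathbb{T}^3)$ satisfy $\mathbb{P}w_0=u_0$, and let $w$ be the corresponding $H^{1/2}$-solution, with initial data $w_0$, of the linear equation (with $u$ regarded as fixed) $$\partial_t w+(u\cdot\nabla)w+(\nabla u)^\top w-\Delta w=0 .$$ Then $\mathbb{P}w=u$; that is, $(u,w)$ satisfies the system $\partial_t w+(u\cdot\nabla)w+(\nabla u)^\top w-\Delta w=0$, $u=\mathbb{P}w$, in the weak sense.
   Context: Here $\mathbb{T}^3=\mathbb{R}^3/2\pi\mathbb{Z}^3$, all fields are $\mathbb{R}^3$-valued, and $\mathbb{P}$ is the Leray projection, i.e. the orthogonal projection of $L^2(\mathbb{T}^3)$ onto $L^2_\sigma$, the closed subspace of (weakly) divergence-free fields. $H^s(\mathbb{T}^3)$ is the usual Sobolev space, with norm $\big(\sum_{k\in\mathbb{Z}^3}(1+|k|^{2s})|\hat f_k|^2\big)^{1/2}$. Notation: $((\nabla u)^\top w)_i=\sum_j(\partial_i u_j)w_j$. Weak solution of Navier--Stokes (viscosity $1$) on $[0,T)$ with initial data $u_0\in L^2$: a (weakly) divergence-free $u\in L^\infty(0,T;L^2)\cap L^2(0,T;H^1)$ such that for all $\psi\in C_c^\infty([0,T)\times\mathbb{T}^3)$ with $\nabla\cdot\psi\equiv0$ and all $t\in[0,T)$,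 $$(u(t),\psi(t))_{L^2}+\int_0^t((u\cdot\nabla)u,\psi)_{L^2}+(\nabla u,\nabla\psi)_{L^2}\,ds=(u_0,\psi(0))_{L^2}+\int_0^t(u,\partial_t\psi)_{L^2}\,ds.$$ $H^{1/2}$-solution of the linear equation with initial data $w_0$, for given $u\in L^\infty(0,T;H^{1/2})\cap L^2(0,T;H^{3/2})$: a function $w\in L^\infty(0,T;H^{1/2})\cap L^2(0,T;H^{3/2})$ such that for all $\phi\in C_c^\infty([0,T)\times\mathbb{T}^3)$ (not necessarily divergence free) and all $t\in[0,T)$, $$(w(t),\phi(t))_{L^2}+\int_0^t((u\cdot\nabla)w+(\nabla u)^\top w,\phi)_{L^2}\,ds=(w_0,\phi(0))_{L^2}+\int_0^t(w,\partial_t\phi)_{L^2}\,ds-\int_0^t(\nabla w,\nabla\phi)_{L^2}\,ds.$$ For every such $u$ and every $w_0\in H^{1/2}$ there exists exactly one such $H^{1/2}$-solution $w$; this is presupposed by the phrase "the corresponding $H^{1/2}$-solution". *)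

theory Defs
  imports "HOL-Analysis.Analysis"
begin

text \<open>
  A function on \<open>\<real>\<^sup>3 / 2\<pi>\<int>\<^sup>3\<close> is a function on \<open>\<real>\<^sup>3\<close> that is \<open>2\<pi>\<close>-periodic in every coordinate;
  integrals over the torus are Lebesgue integrals over the half-open cell. Elements of
  Lebesgue and Sobolev spaces are represented by functions, not by classes of functions
  modulo null sets.
\<close>

type_synonym field = "real^3 \<Rightarrow> real^3"

definition periodic :: "(real^3 \<Rightarrow> 'b) \<Rightarrow> bool" where
  "periodic f \<longleftrightarrow> (\<forall>x i. f (x + axis i (2 * pi)) = f x)"

definition torus :: "(real^3) measure" where
  "torus = lebesgue_on {x. \<forall>i. 0 \<le> x $ i \<and> x $ i < 2 * pi}"

definition L2 :: "field set" where
  "L2 = {f. periodic f \<and> f \<in> borel_measurable torus \<and> integrable torus (\<lambda>x. (norm (f x))\<^sup>2)}"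

definition L2_inner :: "field \<Rightarrow> field \<Rightarrow> real" where
  "L2_inner f g = (\<integral>x. f x \<bullet> g x \<partial>torus)"

definition L2_norm :: "field \<Rightarrow> real" where
  "L2_norm f = sqrt (L2_inner f f)"

definition freq :: "int^3 \<Rightarrow> real^3" where
  "freq k = (\<chi> i. of_int (k $ i))"

definition fourier_coeff :: "field \<Rightarrow> int^3 \<Rightarrow> complex^3" where
  "fourier_coeff f k =
     (\<chi> i. (\<integral>x. of_real (f x $ i) * exp (- \<i> * of_real (freq k \<bullet> x)) \<partial>torus) / of_real ((2 * pi) ^ 3))"

text \<open>
  The weight is the intended one for \<open>s > 0\<close>; note that \<open>0 powr (2 * s) = 0\<close> also when \<open>s = 0\<close>.
  The space of order \<open>0\<close> is only used in the form \<^const>\<open>L2\<close>.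
\<close>

definition H_weight :: "real \<Rightarrow> field \<Rightarrow> int^3 \<Rightarrow> real" where
  "H_weight s f k = (1 + norm (freq k) powr (2 * s)) * (norm (fourier_coeff f k))\<^sup>2"

definition H :: "real \<Rightarrow> field set" where
  "H s = {f \<in> L2. H_weight s f summable_on UNIV}"

definition H_norm :: "real \<Rightarrow> field \<Rightarrow> real" where
  "H_norm s f = sqrt (\<Sum>\<^sub>\<infinity>k. H_weight s f k)"

text \<open>
  \<open>X\<close> is the underlying set and \<open>N\<close> the norm of the target space. The first definition is Bochner
  (strong) measurability: almost everywhere approximation by \<open>X\<close>-valued simple functions.
\<close>

definition strongly_measurable ::
    "real \<Rightarrow> field set \<Rightarrow> (field \<Rightarrow> real) \<Rightarrow> (real \<Rightarrow> field) \<Rightarrow> bool" where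
  "strongly_measurable T X N v \<longleftrightarrow>
     (AE t in lebesgue_on {0<..<T}. v t \<in> X) \<and>
     (\<exists>\<sigma> :: nat \<Rightarrow> real \<Rightarrow> field.
        (\<forall>n. simple_function (lebesgue_on {0<..<T}) (\<sigma> n) \<and> (\<forall>t\<in>{0<..<T}. \<sigma> n t \<in> X)) \<and>
        (AE t in lebesgue_on {0<..<T}. (\<lambda>n. N (\<lambda>x. \<sigma> n t x - v t x)) \<longlonglongrightarrow> 0))"

definition Linf_time :: "real \<Rightarrow> field set \<Rightarrow> (field \<Rightarrow> real) \<Rightarrow> (real \<Rightarrow> field) set" where
  "Linf_time T X N =
     {v. strongly_measurable T X N v \<and> (\<exists>C. AE t in lebesgue_on {0<..<T}. N (v t) \<le> C)}"

definition L2_time :: "real \<Rightarrow> field set \<Rightarrow> (field \<Rightarrow> real) \<Rightarrow> (real \<Rightarrow> field) set" where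
  "L2_time T X N =
     {v. strongly_measurable T X N v \<and> integrable (lebesgue_on {0<..<T}) (\<lambda>t. (N (v t))\<^sup>2)}"

fun Ck :: "nat \<Rightarrow> ('a::real_normed_vector \<Rightarrow> 'b::real_normed_vector) \<Rightarrow> bool" where
  "Ck 0 f \<longleftrightarrow> continuous_on UNIV f"
| "Ck (Suc n) f \<longleftrightarrow>
     (\<forall>x. f differentiable (at x)) \<and> (\<forall>v. Ck n (\<lambda>x. frechet_derivative f (at x) v))"

definition smooth :: "('a::real_normed_vector \<Rightarrow> 'b::real_normed_vector) \<Rightarrow> bool" where
  "smooth f \<longleftrightarrow> (\<forall>n. Ck n f)"

definition pd :: "3 \<Rightarrow> (real^3 \<Rightarrow> 'b::real_normed_vector) \<Rightarrow> real^3 \<Rightarrow> 'b" where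
  "pd i f x = frechet_derivative f (at x) (axis i 1)"

definition time_deriv :: "(real \<Rightarrow> field) \<Rightarrow> real \<Rightarrow> field" where
  "time_deriv \<phi> t x = vector_derivative (\<lambda>s. \<phi> s x) (at t)"

text \<open>
  Fields in \<open>C\<^sub>c\<^sup>\<infinity>([0,T) \<times> \<T>\<^sup>3)\<close> are smooth up to \<open>t = 0\<close>, need not vanish there, and vanish near \<open>t = T\<close>.
  They are represented by extensions that are smooth for all real times; only the values and
  derivatives at times in \<open>[0,T)\<close> are ever used, and in particular
  the divergence is only required to vanish there.
\<close>

definition test_field :: "real \<Rightarrow> (real \<Rightarrow> field) \<Rightarrow> bool" where
  "test_field T \<phi> \<longleftrightarrow>
     smooth (\<lambda>(t, x). \<phi> t x) \<and> (\<forall>t. periodic (\<phi> t)) \<and> (\<exists>T'<T. \<forall>t\<ge>T'. \<forall>x. \<phi> t x = 0)"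

definition div_free_test_field :: "real \<Rightarrow> (real \<Rightarrow> field) \<Rightarrow> bool" where
  "div_free_test_field T \<psi> \<longleftrightarrow>
     test_field T \<psi> \<and> (\<forall>t\<in>{0..<T}. \<forall>x. (\<Sum>i\<in>UNIV. pd i (\<psi> t) x $ i) = 0)"

definition has_weak_pd :: "3 \<Rightarrow> field \<Rightarrow> field \<Rightarrow> bool" where
  "has_weak_pd i f g \<longleftrightarrow> g \<in> L2 \<and>
     (\<forall>\<eta> :: real^3 \<Rightarrow> real. smooth \<eta> \<and> periodic \<eta> \<longrightarrow>
        (\<integral>x. pd i \<eta> x *\<^sub>R f x \<partial>torus) = - (\<integral>x. \<eta> x *\<^sub>R g x \<partial>torus))"

text \<open>A weak derivative is unique up to a null set; \<open>weak_pd\<close> picks a representative.\<close>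

definition weak_pd :: "3 \<Rightarrow> field \<Rightarrow> field" where
  "weak_pd i f = (SOME g. has_weak_pd i f g)"

definition L2_sigma :: "field set" where
  "L2_sigma = {f \<in> L2. \<forall>\<eta> :: real^3 \<Rightarrow> real. smooth \<eta> \<and> periodic \<eta> \<longrightarrow>
     (\<integral>x. f x \<bullet> (\<chi> i. pd i \<eta> x) \<partial>torus) = 0}"

text \<open>
  \<open>leray f g\<close> means \<open>\<P> f = g\<close> in \<open>L\<^sup>2\<close>. It is a relation because \<open>g\<close> is
  determined by \<open>f\<close> only up to a null set.
\<close>

definition leray :: "field \<Rightarrow> field \<Rightarrow> bool" where
  "leray f g \<longleftrightarrow> f \<in> L2 \<and> g \<in> L2_sigma \<and>
     (\<forall>h\<in>L2_sigma. L2_inner (\<lambda>x. f x - g x) h = 0)"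

definition convection :: "field \<Rightarrow> field \<Rightarrow> field" where
  "convection u w x = (\<Sum>j\<in>UNIV. (u x $ j) *\<^sub>R weak_pd j w x)"

definition grad_transpose :: "field \<Rightarrow> field \<Rightarrow> field" where
  "grad_transpose u w x = (\<chi> i. \<Sum>j\<in>UNIV. (weak_pd i u x $ j) * (w x $ j))"

definition grad_inner :: "field \<Rightarrow> field \<Rightarrow> real" where  \<comment> \<open>\<open>(\<nabla>v, \<nabla>\<phi>)\<close> for smooth \<open>\<phi>\<close>\<close>
  "grad_inner v \<phi> = (\<Sum>j\<in>UNIV. L2_inner (weak_pd j v) (pd j \<phi>))"

text \<open>
  The weak identities are required at every time in \<open>[0,T)\<close>, so a solution is an
  everywhere defined map from \<open>[0,T)\<close> to \<open>L\<^sup>2\<close>, and to \<open>L\<^sup>2\<^sub>\<sigma>\<close> in the Navier--Stokes case.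
\<close>

definition NS_weak_solution :: "real \<Rightarrow> field \<Rightarrow> (real \<Rightarrow> field) \<Rightarrow> bool" where
  "NS_weak_solution T u0 u \<longleftrightarrow>
     u0 \<in> L2 \<and>
     (\<forall>t\<in>{0..<T}. u t \<in> L2_sigma) \<and>
     u \<in> Linf_time T L2 L2_norm \<and>
     u \<in> L2_time T (H 1) (H_norm 1) \<and>
     (\<forall>\<psi>. div_free_test_field T \<psi> \<longrightarrow> (\<forall>t\<in>{0..<T}.
        L2_inner (u t) (\<psi> t)
          + (LINT s:{0..t}|lebesgue. L2_inner (convection (u s) (u s)) (\<psi> s) + grad_inner (u s) (\<psi> s))
        = L2_inner u0 (\<psi> 0) + (LINT s:{0..t}|lebesgue. L2_inner (u s) (time_deriv \<psi> s))))"

definition Hhalf_class :: "real \<Rightarrow> (real \<Rightarrow> field) set" where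
  "Hhalf_class T =
     Linf_time T (H (1/2)) (H_norm (1/2)) \<inter> L2_time T (H (3/2)) (H_norm (3/2))"

definition Hhalf_solution :: "real \<Rightarrow> (real \<Rightarrow> field) \<Rightarrow> field \<Rightarrow> (real \<Rightarrow> field) \<Rightarrow> bool" where
  "Hhalf_solution T u w0 w \<longleftrightarrow>
     (\<forall>t\<in>{0..<T}. w t \<in> L2) \<and>
     w \<in> Hhalf_class T \<and>
     (\<forall>\<phi>. test_field T \<phi> \<longrightarrow> (\<forall>t\<in>{0..<T}.
        L2_inner (w t) (\<phi> t)
          + (LINT s:{0..t}|lebesgue.
               L2_inner (\<lambda>x. convection (u s) (w s) x + grad_transpose (u s) (w s) x) (\<phi> s))
        = L2_inner w0 (\<phi> 0) + (LINT s:{0..t}|lebesgue. L2_inner (w s) (time_deriv \<phi> s))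
          - (LINT s:{0..t}|lebesgue. grad_inner (w s) (\<phi> s))))"

end

theory Submission
  imports Defs
begin

text \<open>
  Write \<open>w - u = v + \<nabla>q\<close> with \<open>v\<close> divergence free. Since
  \<open>(u \<cdot> \<nabla>)\<nabla>q + (\<nabla>u)\<^sup>T\<nabla>q = \<nabla>(u \<cdot> \<nabla>q)\<close> and \<open>(\<nabla>u)\<^sup>Tu = \<nabla>\<bar>u\<bar>\<^sup>2/2\<close> are gradients, they
  disappear when the difference of the two equations is tested with a divergence-free field, and
  \<open>v\<close> solves \<open>\<partial>\<^sub>t v + \<P>((u \<cdot> \<nabla>)v + (\<nabla>u)\<^sup>Tv) = \<Delta>v\<close> with zero initial value. Everything is done mode by mode on the
  Fourier side: each coefficient of \<open>v\<close> is an absolutely continuous function of time, which gives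
  an energy identity for every finite set of frequencies. The product estimate
  \<open>\<parallel>uv\<parallel>\<^sub>0 \<le> C \<parallel>u\<parallel>\<^sub>1 \<parallel>v\<parallel>\<^bsub>1/2\<^esub>\<close>, the interpolation inequalities \<open>\<parallel>u\<parallel>\<^sub>1\<^sup>2 \<le> \<parallel>u\<parallel>\<^bsub>1/2\<^esub> \<parallel>u\<parallel>\<^bsub>3/2\<^esub>\<close> and
  \<open>\<parallel>v\<parallel>\<^bsub>1/2\<^esub>\<^sup>2 \<le> \<parallel>v\<parallel>\<^sub>0 \<parallel>v\<parallel>\<^sub>1\<close>, and Young's inequality bound the
  nonlinear term by \<open>\<parallel>\<nabla>v\<parallel>\<^sub>0\<^sup>2 + (1 + K \<parallel>u\<parallel>\<^bsub>1/2\<^esub>\<^sup>2 \<parallel>u\<parallel>\<^bsub>3/2\<^esub>\<^sup>2) \<parallel>v\<parallel>\<^sub>0\<^sup>2\<close>, and Gronwall's inequality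
  gives \<open>v = 0\<close>.
\<close>

subsection \<open>Smooth functions and cutoffs\<close>

text \<open>The field \<open>v\<close> is not an admissible test function, and \<open>u\<close> has
  only the regularity of \<open>Hhalf_class\<close>; both facts shape the argument. Testing with
  single modes frozen in time up to \<open>t\<close> avoids the first: each coefficient satisfies an
  integral equation whose integrand is merely integrable, so its square is computed by Fubini's
  theorem rather than by differentiation. For the second, incompressibility and test directions
  orthogonal to the frequency move every derivative from \<open>u\<close> to \<open>v\<close>, which
  brings the nonlinear term within reach of the product estimate. The energy identity for finitely
  many frequencies does not close, because the nonlinear term couples each of them to all
  frequencies of \<open>v\<close>. The full dissipation then stands on the right with coefficient 1
  and the truncated one on the left with coefficient 2, and only the limit absorbs it. The Gronwall
  coefficient is integrable in time because \<open>u\<close> is bounded in \<open>H^(1/2)\<close>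
  and square integrable in \<open>H^(3/2)\<close>. Since the weak identities hold at every time, so
  does the conclusion.\<close>

lemma Ck_cont:
  assumes "Ck n f"
  shows "continuous_on UNIV f"
proof (cases n)
  case (Suc m)
  then have "f differentiable (at x)" for x
    using assms by simp
  then show ?thesis
    using continuous_at_imp_continuous_on differentiable_imp_continuous_within by blast
qed (use assms in simp)

lemma Ck_Suc_imp: "Ck (Suc n) f \<Longrightarrow> Ck n f"
proof (induction n arbitrary: f)
  case 0
  show ?case using Ck_cont[OF 0] by simp
next
  case (Suc n)
  show ?case unfolding Ck.simps(2)[of n] using Suc.prems Suc.IH
    unfolding Ck.simps(2)[of "Suc n"] by blast
qed

text \<open>By uniqueness of the derivative, any exhibited derivative may stand in for
  \<open>frechet_derivative\<close>, in terms of which \<open>Ck\<close> is phrased.\<close>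

lemma Ck_SucI:
  assumes "\<And>x. (f has_derivative f' x) (at x)" "\<And>v. Ck n (\<lambda>x. f' x v)"
  shows "Ck (Suc n) f"
  using assms frechet_derivative_at[OF assms(1)]
  by (auto simp: differentiable_def)

lemma Ck_const [simp]: "Ck n (\<lambda>x. c)"
proof (induction n arbitrary: c)
  case (Suc n)
  show ?case by (rule Ck_SucI[where f'="\<lambda>x v. 0"]) (auto simp: Suc)
qed auto

lemma Ck_bounded_linear_comp:
  assumes "bounded_linear L" "Ck n f"
  shows "Ck n (\<lambda>x. L (f x))"
  using assms(2)
proof (induction n arbitrary: f)
  case 0
  then show ?case using bounded_linear.continuous_on[OF assms(1)] by simp
next
  case (Suc n)
  then have d: "\<And>x. (f has_derivative frechet_derivative f (at x)) (at x)"
    by (simp add: frechet_derivative_works)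
  show ?case
    by (rule Ck_SucI[OF bounded_linear.has_derivative[OF assms(1) d]]) (use Suc in auto)
qed

lemma Ck_comp_bounded_linear:
  assumes "bounded_linear L" "Ck n f"
  shows "Ck n (\<lambda>x. f (L x))"
  using assms(2)
proof (induction n arbitrary: f)
  case 0
  then show ?case using assms(1) 
    by (auto intro!: continuous_on_compose2[of UNIV f] bounded_linear.continuous_on[OF assms(1)] continuous_intros)
next
  case (Suc n)
  then have d: "(f has_derivative frechet_derivative f (at (L x))) (at (L x))" for x
    by (simp add: frechet_derivative_works)
  have dL: "(L has_derivative L) (at x)" for x
    using assms(1) by (rule bounded_linear_imp_has_derivative)
  show ?case
    by (rule Ck_SucI[OF has_derivative_compose[OF dL d]]) (use Suc in auto)
qed

lemma Ck_add: "Ck n f \<Longrightarrow> Ck n g \<Longrightarrow> Ck n (\<lambda>x. f x + g x)"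
proof (induction n arbitrary: f g)
  case 0
  then show ?case by (auto intro!: continuous_intros)
next
  case (Suc n)
  then have d: "\<And>x. (f has_derivative frechet_derivative f (at x)) (at x)"
     "\<And>x. (g has_derivative frechet_derivative g (at x)) (at x)"
    by (simp_all add: frechet_derivative_works)
  show ?case
    by (rule Ck_SucI[OF has_derivative_add[OF d(1) d(2)]]) (use Suc in auto)
qed

lemma Ck_mult:
  fixes f g :: "'a::real_normed_vector \<Rightarrow> real"
  shows "Ck n f \<Longrightarrow> Ck n g \<Longrightarrow> Ck n (\<lambda>x. f x * g x)"
proof (induction n arbitrary: f g)
  case 0
  then show ?case by (auto intro!: continuous_intros)
next
  case (Suc n)
  then have d: "\<And>x. (f has_derivative frechet_derivative f (at x)) (at x)"
     "\<And>x. (g has_derivative frechet_derivative g (at x)) (at x)"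
    by (simp_all add: frechet_derivative_works)
  show ?case
    by (rule Ck_SucI[OF has_derivative_mult[OF d(1) d(2)]])
      (use Suc Ck_Suc_imp[of n f] Ck_Suc_imp[of n g] in \<open>auto intro!: Ck_add\<close>)
qed

lemma Ck_real_SucI:
  fixes f :: "real \<Rightarrow> real"
  assumes "\<And>x. (f has_real_derivative f' x) (at x)" "Ck n f'"
  shows "Ck (Suc n) f"
proof (rule Ck_SucI)
  show "(f has_derivative (\<lambda>v. f' x * v)) (at x)" for x
    using assms(1) by (simp add: has_field_derivative_def mult_commute_abs)
  show "Ck n (\<lambda>x. f' x * v)" for v
    by (rule Ck_mult) (use assms in auto)
qed

lemma Ck_inverse:
  fixes f :: "real \<Rightarrow> real"
  assumes "Ck n f" "\<And>x. f x \<noteq> 0"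
  shows "Ck n (\<lambda>x. inverse (f x))"
  using assms
proof (induction n arbitrary: f)
  case 0
  then show ?case by (auto intro!: continuous_intros)
next
  case (Suc n)
  define f' where "f' x = frechet_derivative f (at x) 1" for x
  have d: "(f has_real_derivative f' x) (at x)" for x
  proof -
    have df: "f differentiable at x" using Suc.prems by simp
    have "frechet_derivative f (at x) = (\<lambda>v. f' x * v)"
    proof
      show "frechet_derivative f (at x) v = f' x * v" for v
        using linear_cmul[OF linear_frechet_derivative[OF df], of v 1] by (simp add: f'_def)
    qed
    then show ?thesis using frechet_derivative_works[of f "at x"] df
      by (simp add: has_field_derivative_def)
  qed
  have i: "Ck n (\<lambda>x. inverse (f x))"
    using Suc.IH[of f] Ck_Suc_imp Suc.prems by blast
  show ?case
  proof (rule Ck_real_SucI)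
    \<comment> \<open>Written as a product of \<open>inverse f\<close>, \<open>f'\<close> and
      \<open>inverse f\<close>, the derivative is of class \<open>Ck n\<close> by the induction
      hypothesis and \<open>Ck_mult\<close>.\<close>
    show "((\<lambda>x. inverse (f x)) has_real_derivative (-1) * (inverse (f x) * f' x * inverse (f x))) (at x)" for x
      using DERIV_inverse_fun[OF d Suc.prems(2)[of x]] by (simp add: mult.assoc mult.left_commute)
    show "Ck n (\<lambda>x. (-1) * (inverse (f x) * f' x * inverse (f x)))"
      by (intro Ck_mult i Ck_const) (use Suc.prems in \<open>simp add: f'_def\<close>)
  qed
qed

text \<open>A quarter-period phase shift turns a cosine into its derivative, so the shifted cosines
  form one family closed under differentiation. The phase of \<open>trig\<close> serves the same
  purpose.\<close>

lemma Ck_cos: "Ck n (\<lambda>x::real. cos (x + \<theta>))"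
proof (induction n arbitrary: \<theta>)
  case 0
  then show ?case by (auto intro!: continuous_intros)
next
  case (Suc n)
  show ?case
  proof (rule Ck_real_SucI)
    have "- sin (x + \<theta>) = cos (x + (\<theta> + pi/2))" for x
      using cos_add[of "x + \<theta>" "pi/2"] by (simp add: add.assoc)
    moreover have "((\<lambda>x. cos (x + \<theta>)) has_real_derivative - sin (x + \<theta>)) (at x)" for x
      using DERIV_shift[THEN iffD1, OF DERIV_cos[of "x + \<theta>"]] .
    ultimately show "((\<lambda>x. cos (x + \<theta>)) has_real_derivative cos (x + (\<theta> + pi/2))) (at x)" for x
      by metis
  qed (rule Suc)
qed

text \<open>All derivatives of \<open>exp (- 1/x)\<close> remain in this class.\<close>

definition flat :: "real poly \<Rightarrow> real \<Rightarrow> real" where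
  "flat p x = (if x > 0 then poly p (inverse x) * exp (- inverse x) else 0)"

text \<open>Substituting \<open>1/x\<close> for \<open>x\<close> reduces the claim to the decay of a
  polynomial times \<open>exp (- x)\<close> at infinity.\<close>

lemma flat_tendsto: "(flat p \<longlongrightarrow> 0) (at_right 0)"
proof -
  have "((\<lambda>x. poly p x * exp (- x)) \<longlongrightarrow> 0) at_top"
  proof -
    have "((\<lambda>x. coeff p i * (x ^ i / exp x)) \<longlongrightarrow> coeff p i * 0) at_top" for i
      by (intro tendsto_intros tendsto_power_div_exp_0)
    then have "((\<lambda>x. \<Sum>i\<le>degree p. coeff p i * (x ^ i / exp x)) \<longlongrightarrow> (\<Sum>i\<le>degree p. coeff p i * 0)) at_top"
      by (intro tendsto_sum) auto
    then show ?thesis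
      by (simp add: poly_altdef exp_minus sum_distrib_right divide_inverse mult.assoc)
  qed
  then have "((\<lambda>x. poly p (inverse x) * exp (- inverse x)) \<longlongrightarrow> 0) (at_right 0)"
    using filterlim_compose[OF _ filterlim_inverse_at_top_right] by blast
  then show ?thesis
    by (rule tendsto_cong[THEN iffD1, rotated])
      (auto simp: eventually_at_filter flat_def)
qed

text \<open>For positive \<open>x\<close> the chain rule gives
  \<open>x^(-2) (p - p')(1/x) exp (-1/x)\<close>, hence the polynomial
  \<open>monom 1 2 * (p - pderiv p)\<close>. At the origin the difference quotient is
  \<open>flat (monom 1 1 * p)\<close> from the right and zero from the left, so
  \<open>flat_tendsto\<close> applies again.\<close>

lemma flat_deriv:
  "(flat p has_real_derivative flat (monom 1 2 * (p - pderiv p)) x) (at x)"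
proof -
  let ?q = "monom 1 2 * (p - pderiv p)"
  consider "x > 0" | "x < 0" | "x = 0" by linarith
  then show ?thesis
  proof cases
    case 1
    have "((\<lambda>x. poly p (inverse x) * exp (- inverse x)) has_real_derivative flat ?q x) (at x)"
    proof -
      have i: "(inverse has_real_derivative - (inverse x)\<^sup>2) (at x)"
        using DERIV_inverse[of x UNIV] 1 by (simp add: numeral_2_eq_2)
      have p: "((\<lambda>x. poly p (inverse x)) has_real_derivative poly (pderiv p) (inverse x) * (- (inverse x)\<^sup>2)) (at x)"
        by (rule DERIV_chain2[OF poly_DERIV i])
      have e: "((\<lambda>x. exp (- inverse x)) has_real_derivative exp (- inverse x) * (- (- (inverse x)\<^sup>2))) (at x)"
        by (rule DERIV_chain2[OF DERIV_exp DERIV_minus[OF i]])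
      show ?thesis using DERIV_mult[OF p e] 1
        by (simp add: flat_def poly_monom algebra_simps)
    qed
    moreover have "eventually (\<lambda>y. flat p y = poly p (inverse y) * exp (- inverse y)) (nhds x)"
      by (rule eventually_mono[OF eventually_nhds_in_open[of "{0<..}" x]]) (use 1 in \<open>auto simp: flat_def\<close>)
    ultimately show ?thesis using DERIV_cong_ev[OF refl _ refl] by metis
  next
    case 2
    have "eventually (\<lambda>y. flat p y = 0) (nhds x)"
      by (rule eventually_mono[OF eventually_nhds_in_open[of "{..<0}" x]]) (use 2 in \<open>auto simp: flat_def\<close>)
    then show ?thesis using DERIV_cong_ev[of x x "flat p" "\<lambda>_. 0" 0] 2 by (simp add: flat_def)
  next
    case 3
    have "((\<lambda>h. flat p h / h) \<longlongrightarrow> 0) (at_right 0)"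
      by (rule tendsto_cong[THEN iffD1, OF _ flat_tendsto[of "monom 1 1 * p"]])
        (auto simp: eventually_at_filter flat_def poly_monom field_simps)
    moreover have "((\<lambda>h. flat p h / h) \<longlongrightarrow> 0) (at_left 0)"
      by (rule tendsto_eventually) (auto simp: eventually_at_filter flat_def)
    ultimately have "((\<lambda>h. flat p h / h) \<longlongrightarrow> 0) (at 0)"
      by (simp add: filterlim_at_split)
    then show ?thesis using 3 by (simp add: DERIV_def flat_def)
  qed
qed

lemma Ck_flat: "Ck n (flat p)"
proof (induction n arbitrary: p)
  case 0
  show ?case using flat_deriv DERIV_isCont
    by (fastforce intro: continuous_at_imp_continuous_on)
next
  case (Suc n)
  show ?case by (rule Ck_real_SucI[OF flat_deriv Suc])
qed

lemma smooth_cutoff: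
  fixes a b :: real
  assumes "a < b"
  obtains \<kappa> :: "real \<Rightarrow> real" where "smooth \<kappa>" "\<And>x. x \<le> a \<Longrightarrow> \<kappa> x = 1" "\<And>x. x \<ge> b \<Longrightarrow> \<kappa> x = 0"
proof -
  define f where "f = flat 1"
  have fpos: "f x > 0" if "x > 0" for x using that by (simp add: f_def flat_def)
  have f0: "f x = 0" if "x \<le> 0" for x using that by (simp add: f_def flat_def)
  have fnn: "f x \<ge> 0" for x using fpos[of x] f0[of x] by (cases "x > 0") auto
  \<comment> \<open>An affine map is not linear: the translation is absorbed by an induction over
    the class \<open>flat\<close>, after which the factor \<open>s\<close> is a linear
    substitution.\<close>
  have shift: "Ck n (\<lambda>x. f (c + s * x))" for c s n
  proof -
    have "Ck n (\<lambda>x. f (c + x))" for c n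
    proof -
      have "Ck n (\<lambda>x. flat p (c + x))" for p
      proof (induction n arbitrary: p)
        case 0
        have "continuous_on UNIV (flat p)" using Ck_flat[of 0] by simp
        then show ?case by (auto intro!: continuous_on_compose2[of UNIV "flat p"] continuous_intros)
      next
        case (Suc n)
        show ?case
          by (rule Ck_real_SucI[OF _ Suc[of "monom 1 2 * (p - pderiv p)"]])
             (use DERIV_shift[THEN iffD1, OF flat_deriv, of _ c] in \<open>simp add: add.commute\<close>)
      qed
      then show ?thesis by (simp add: f_def)
    qed
    then show ?thesis
      by (rule Ck_comp_bounded_linear[OF bounded_linear_mult_right])
  qed
  \<comment> \<open>Quotient of two one-sided bumps. Because \<open>a < b\<close>, at every point at
    least one of \<open>b - x\<close> and \<open>x - a\<close> is positive, so the denominator never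
    vanishes.\<close>
  define \<kappa> where "\<kappa> x = f (b + (-1) * x) * inverse (f (b + (-1) * x) + f (-a + 1 * x))" for x
  have pos: "f (b + (-1) * x) + f (-a + 1 * x) > 0" for x
    using fpos[of "b - x"] fpos[of "x - a"] fnn[of "b - x"] fnn[of "x - a"] assms
    by (cases "x < b") (auto intro: add_pos_nonneg add_nonneg_pos)
  show ?thesis
  proof
    show "smooth \<kappa>" unfolding smooth_def \<kappa>_def
      by (intro allI Ck_mult Ck_inverse Ck_add shift less_imp_neq[OF pos, symmetric])
    show "\<kappa> x = 1" if "x \<le> a" for x
      using that assms f0[of "x - a"] fpos[of "b - x"] by (simp add: \<kappa>_def)
    show "\<kappa> x = 0" if "x \<ge> b" for x
      using that f0[of "b - x"] by (simp add: \<kappa>_def)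
  qed
qed

subsection \<open>Integration over the torus\<close>

abbreviation cell :: "(real^3) set" where
  "cell \<equiv> {x. \<forall>i. 0 \<le> x $ i \<and> x $ i < 2 * pi}"

lemma cell_borel [measurable]: "cell \<in> sets borel"
proof -
  have "cell = (\<Inter>i. {x. 0 \<le> x $ i} \<inter> {x. x $ i < 2 * pi})" by auto
  moreover have "{x::real^3. 0 \<le> x $ i} \<inter> {x. x $ i < 2 * pi} \<in> sets borel" for i
    by (intro sets.Int borel_closed borel_open closed_Collect_le open_Collect_less continuous_intros)
  ultimately show ?thesis by (simp add: sets.finite_INT)
qed

lemma cell_lebesgue [measurable]: "cell \<in> sets lebesgue"
  by (rule sets_completionI_sets, unfold sets_lborel, rule cell_borel)

lemma cell_subset: "cell \<subseteq> cbox 0 (\<chi> i. 2 * pi)"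
  by (auto simp: mem_box_cart less_imp_le)

text \<open>The half-open cell is squeezed between the open and the closed box, which have the same
  volume.\<close>

lemma cell_emeasure: "emeasure lborel cell = ennreal ((2 * pi) ^ 3)"
proof -
  have 1: "((\<chi> i. 2 * pi) - 0) \<bullet> b = 2 * pi" if "b \<in> Basis" for b :: "real^3"
    using that by (auto simp: Basis_vec_def inner_axis)
  have le: "b \<in> Basis \<Longrightarrow> 0 \<bullet> b \<le> (\<chi> i. 2 * pi) \<bullet> b" for b :: "real^3"
    using 1[of b] by simp
  have p: "(\<Prod>b\<in>Basis. ((\<chi> i. 2 * pi) - 0) \<bullet> (b::real^3)) = (2 * pi) ^ 3"
    using 1 by simp
  have "emeasure lborel (box (0::real^3) (\<chi> i. 2 * pi)) = ennreal ((2 * pi) ^ 3)"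
    using emeasure_lborel_box[OF le] p by simp
  moreover have "emeasure lborel (cbox (0::real^3) (\<chi> i. 2 * pi)) = ennreal ((2 * pi) ^ 3)"
    using emeasure_lborel_cbox[OF le] p by simp
  moreover have "emeasure lborel (box (0::real^3) (\<chi> i. 2 * pi)) \<le> emeasure lborel cell"
    by (rule emeasure_mono) (auto simp: mem_box_cart less_imp_le)
  moreover have "emeasure lborel cell \<le> emeasure lborel (cbox (0::real^3) (\<chi> i. 2 * pi))"
    by (rule emeasure_mono[OF cell_subset]) simp
  ultimately show ?thesis by (intro antisym) simp_all
qed

lemma space_torus [simp]: "space torus = cell"
  by (simp add: torus_def)

lemma torus_emeasure: "emeasure torus (space torus) = ennreal ((2 * pi) ^ 3)"
  using cell_emeasure cell_borel by (simp add: torus_def emeasure_restrict_space)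

interpretation torus: finite_measure torus
  by (rule finite_measureI) (use torus_emeasure in simp)

lemma torus_measure [simp]: "measure torus cell = (2 * pi) ^ 3"
  using torus_emeasure by (simp add: measure_def)

lemma borel_measurable_torusI: "f \<in> borel_measurable borel \<Longrightarrow> f \<in> borel_measurable torus"
  unfolding torus_def by (intro measurable_restrict_space1 measurable_completion) simp

lemma torus_integral_eq:
  fixes f :: "real^3 \<Rightarrow> 'b::euclidean_space"
  assumes "f \<in> borel_measurable borel"
  shows "(\<integral>x. f x \<partial>torus) = (\<integral>x. indicator cell x *\<^sub>R f x \<partial>lborel)"
  using assms cell_borel unfolding torus_def by (simp add: integral_restrict_space integral_completion)

lemma torus_integrable_continuous:
  fixes f :: "real^3 \<Rightarrow> 'b::euclidean_space"
  assumes "continuous_on UNIV f"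
  shows "integrable torus f"
proof -
  have m: "f \<in> borel_measurable torus"
    using assms by (intro borel_measurable_torusI borel_measurable_continuous_onI)
  have "compact (f ` cbox 0 (\<chi> i. 2 * pi))"
    by (rule compact_continuous_image[OF continuous_on_subset[OF assms subset_UNIV] compact_cbox])
  then have "bounded (f ` cbox 0 (\<chi> i. 2 * pi))" by (rule compact_imp_bounded)
  then obtain B where B: "\<And>x. x \<in> cbox 0 (\<chi> i. 2 * pi) \<Longrightarrow> norm (f x) \<le> B"
    unfolding bounded_iff by auto
  show ?thesis
  proof (rule torus.integrable_const_bound[where B=B])
    show "AE x in torus. norm (f x) \<le> B"
      by (rule AE_I2, rule B) (use cell_subset in \<open>simp add: subset_iff\<close>)
  qed (rule m)
qed

lemma lborel_integral_shift:
  fixes f :: "real^3 \<Rightarrow> real"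
  assumes "f \<in> borel_measurable borel"
  shows "(\<integral>x. f (c + x) \<partial>lborel) = (\<integral>x. f x \<partial>lborel)"
proof -
  have "(\<integral>x. f x \<partial>distr lborel borel ((+) c)) = (\<integral>x. f (c + x) \<partial>lborel)"
    using assms by (intro integral_distr) auto
  then show ?thesis by (simp add: lborel_distr_plus)
qed

text \<open>The shifted cell is cut along the hyperplane where coordinate \<open>i\<close> equals
  \<open>2 * pi\<close>, and the overhanging slab is moved back by one period. Shifts by at most one
  period leave a single slab to move.\<close>

lemma periodic_shift_integral:
  fixes F :: "real^3 \<Rightarrow> real"
  assumes c: "continuous_on UNIV F" and p: "periodic F" and h: "0 \<le> h" "h \<le> 2 * pi"
  shows "(\<integral>x. F (x + axis i h) \<partial>torus) = (\<integral>x. F x \<partial>torus)"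
proof -
  define R :: "(real^3) set" where "R = {x. \<forall>j. j \<noteq> i \<longrightarrow> 0 \<le> x $ j \<and> x $ j < 2 * pi}"
  define S where "S a b = R \<inter> {x. a \<le> x $ i \<and> x $ i < b}" for a b
  have Fm [measurable]: "F \<in> borel_measurable borel"
    using c by (rule borel_measurable_continuous_onI)
  have comp [measurable]: "(\<lambda>x::real^3. x $ j) \<in> borel_measurable borel" for j
    by (intro borel_measurable_continuous_onI continuous_intros)
  have Sm [measurable]: "S a b \<in> sets borel" for a b
    unfolding S_def R_def by measurable
  \<comment> \<open>All slabs that occur lie in one cube of side \<open>4 * pi\<close>, where the
    continuous \<open>F\<close> is bounded; this supplies integrability for every splitting
    below.\<close>
  have int: "integrable lborel (\<lambda>x. indicator S x * F x)" 
    if "S \<in> sets borel" "S \<subseteq> cbox 0 (\<chi> i. 4 * pi)" for S :: "(real^3) set"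
  proof -
    have "integrable lborel (\<lambda>x. indicator (cbox 0 (\<chi> i. 4 * pi)) x *\<^sub>R F x)"
      by (rule borel_integrable_compact) (auto intro: continuous_on_subset[OF c])
    then have "integrable lborel (\<lambda>x. indicator S x *\<^sub>R (indicator (cbox 0 (\<chi> i. 4 * pi)) x *\<^sub>R F x))"
      using that by (intro integrable_mult_indicator[of S]) auto
    moreover have "indicator S x *\<^sub>R (indicator (cbox 0 (\<chi> i. 4 * pi)) x *\<^sub>R F x) = indicator S x * F x" for x
      using that(2) by (auto simp: indicator_def)
    ultimately show ?thesis by (simp only:)
  qed
  have sub: "S a b \<subseteq> cbox 0 (\<chi> i. 4 * pi)" if "0 \<le> a" "b \<le> 4 * pi" for a b
  proof -
    have "0 \<le> x $ j \<and> x $ j \<le> 4 * pi" if x: "x \<in> R" "a \<le> x $ i" "x $ i < b" for x j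
    proof (cases "j = i")
      case True
      then show ?thesis using x \<open>0 \<le> a\<close> \<open>b \<le> 4 * pi\<close> by simp
    next
      case False
      then have "0 \<le> x $ j" "x $ j < 2 * pi" using x(1) by (simp_all add: R_def)
      then show ?thesis by simp
    qed
    then show ?thesis
      unfolding S_def subset_iff mem_box_cart by simp
  qed
  have SI: "integrable lborel (\<lambda>x. indicator (S a b) x * F x)" if "0 \<le> a" "b \<le> 4 * pi" for a b
    by (rule int[OF Sm sub[OF that]])
  have cellD: "cell = S 0 (2 * pi)"
    unfolding S_def R_def set_eq_iff by (simp, metis)
  have sh: "axis i a + x \<in> R \<longleftrightarrow> x \<in> R" "(axis i a + x) $ i = x $ i + a" for a x
    by (auto simp: R_def axis_def)
  have sh': "- axis i a + x \<in> R \<longleftrightarrow> x \<in> R" "(- axis i a + x) $ i = x $ i - a" for a x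
    by (auto simp: R_def axis_def)
  have c1: "indicator cell (- axis i h + x) * F x
      = indicator (S h (2 * pi)) x * F x + indicator (S (2 * pi) (2 * pi + h)) x * F x" for x
    unfolding cellD S_def indicator_def Int_iff mem_Collect_eq sh' using h by simp
  have c2: "indicator cell x * F x = indicator (S h (2 * pi)) x * F x + indicator (S 0 h) x * F x" for x
    unfolding cellD S_def indicator_def Int_iff mem_Collect_eq using h by (cases "x $ i < h") simp_all
  have Fp: "F (axis i (2 * pi) + x) = F x" for x
    using p by (simp add: periodic_def add.commute)
  have c3: "indicator (S (2 * pi) (2 * pi + h)) (axis i (2 * pi) + x) * F (axis i (2 * pi) + x)
      = indicator (S 0 h) x * F x" for x
    unfolding S_def indicator_def Int_iff mem_Collect_eq sh Fp by (simp add: add.commute)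
  have "(\<integral>x. F (x + axis i h) \<partial>torus) = (\<integral>x. indicator cell x * F (axis i h + x) \<partial>lborel)"
    by (subst torus_integral_eq) (auto simp: add.commute)
  also have "\<dots> = (\<integral>x. indicator cell (- axis i h + x) * F x \<partial>lborel)"
    using lborel_integral_shift[of "\<lambda>x. indicator cell (- axis i h + x) * F x" "axis i h"] by simp
  also have "\<dots> = (\<integral>x. indicator (S h (2 * pi)) x * F x \<partial>lborel) + (\<integral>x. indicator (S (2 * pi) (2 * pi + h)) x * F x \<partial>lborel)"
    unfolding c1 by (intro Bochner_Integration.integral_add SI) (use h in auto)
  also have "(\<integral>x. indicator (S (2 * pi) (2 * pi + h)) x * F x \<partial>lborel) = (\<integral>x. indicator (S 0 h) x * F x \<partial>lborel)"
    using lborel_integral_shift[of "\<lambda>x. indicator (S (2 * pi) (2 * pi + h)) x * F x" "axis i (2 * pi)"] unfolding c3 by simp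
  also have "(\<integral>x. indicator (S h (2 * pi)) x * F x \<partial>lborel) + (\<integral>x. indicator (S 0 h) x * F x \<partial>lborel)
      = (\<integral>x. indicator cell x * F x \<partial>lborel)"
    unfolding c2 by (intro Bochner_Integration.integral_add[symmetric] SI) (use h in auto)
  also have "\<dots> = (\<integral>x. F x \<partial>torus)" by (subst torus_integral_eq) auto
  finally show ?thesis .
qed

text \<open>The difference quotients in direction \<open>i\<close> have zero integral by shift
  invariance, and they converge dominatedly to the derivative; the mean value theorem gives the
  uniform bound.\<close>

lemma integral_pd_zero:
  fixes F :: "real^3 \<Rightarrow> real"
  assumes C: "Ck 1 F" and p: "periodic F"
  shows "(\<integral>x. pd i F x \<partial>torus) = 0"
proof -
  define G where "G = pd i F"
  have dF: "(F has_derivative frechet_derivative F (at x)) (at x)" for x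
    using C by (simp add: frechet_derivative_works)
  have ax0: "axis i (0::real) = 0" by (simp add: axis_def vec_eq_iff)
  have cF: "continuous_on UNIV F" using Ck_cont[OF C] .
  have cG: "continuous_on UNIV G" using C by (simp add: G_def pd_def)
  have lin: "frechet_derivative F (at x) (axis i h) = h * G x" for x h
  proof -
    have "axis i h = h *\<^sub>R axis i (1::real)" by (simp add: axis_def vec_eq_iff)
    then show ?thesis
      using linear_cmul[OF linear_frechet_derivative[of F "at x"], of h "axis i 1"] C
      by (simp add: G_def pd_def)
  qed
  have der: "((\<lambda>h. F (x + axis i h)) has_real_derivative G (x + axis i h)) (at h)" for x h
  proof -
    have "((\<lambda>h. x + axis i h) has_derivative axis i) (at h)"
    proof -
      have "axis i = (\<lambda>h. h *\<^sub>R axis i (1::real))" by (auto simp: axis_def vec_eq_iff)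
      moreover have "((\<lambda>h. x + h *\<^sub>R axis i (1::real)) has_derivative (\<lambda>h. h *\<^sub>R axis i 1)) (at h)"
        by (auto intro!: derivative_eq_intros)
      ultimately show ?thesis by metis
    qed
    from has_derivative_compose[OF this dF] show ?thesis
      by (simp add: has_field_derivative_def lin mult.commute[of _ "G (x + axis i h)"])
  qed
  \<comment> \<open>The intermediate point of the mean value theorem may leave the cell by less than
    the step, which is at most 1; hence a cube enlarged by 1.\<close>
  define K where "K = cbox (0::real^3) (\<chi> i. 2 * pi + 1)"
  have "compact (G ` K)" unfolding K_def
    by (rule compact_continuous_image[OF continuous_on_subset[OF cG subset_UNIV] compact_cbox])
  then have "bounded (G ` K)" by (rule compact_imp_bounded)
  then obtain B where B: "\<And>x. x \<in> K \<Longrightarrow> \<bar>G x\<bar> \<le> B"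
    unfolding bounded_iff by auto
  define h where "h n = inverse (real (Suc n))" for n
  have h: "0 < h n" "h n \<le> 1" for n by (auto simp: h_def field_simps)
  have hlim: "h \<longlonglongrightarrow> 0" unfolding h_def by (rule LIMSEQ_inverse_real_of_nat)
  define D where "D n x = (F (x + axis i (h n)) - F x) / h n" for n x
  have intD: "(\<integral>x. D n x \<partial>torus) = 0" for n
  proof -
    have "integrable torus (\<lambda>x. F (x + axis i (h n)))" "integrable torus F"
      by (intro torus_integrable_continuous continuous_on_compose2[OF cF] continuous_intros subset_UNIV cF)+
    then show ?thesis
      unfolding D_def using periodic_shift_integral[OF cF p, of "h n" i] h[of n] pi_gt3
      by simp
  qed
  have "(\<lambda>n. \<integral>x. D n x \<partial>torus) \<longlonglongrightarrow> (\<integral>x. G x \<partial>torus)"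
  proof (rule integral_dominated_convergence[where w="\<lambda>_. B"])
    show "G \<in> borel_measurable torus" using torus_integrable_continuous[OF cG] by auto
    show "D n \<in> borel_measurable torus" for n
      unfolding D_def by (intro borel_measurable_torusI borel_measurable_continuous_onI continuous_intros 
          continuous_on_compose2[OF cF]) (use h[of n] in auto)
    show "AE x in torus. (\<lambda>n. D n x) \<longlonglongrightarrow> G x"
    proof (rule AE_I2)
      fix x
      have "((\<lambda>y. (F (x + axis i y) - F x) / y) \<longlongrightarrow> G x) (at 0)"
        using der[of x 0] by (simp add: DERIV_def ax0)
      then show "(\<lambda>n. D n x) \<longlonglongrightarrow> G x" unfolding D_def
        by (rule filterlim_compose) (use hlim h in \<open>auto simp: filterlim_at less_imp_neq[symmetric]\<close>)
    qed
    show "AE x in torus. norm (D n x) \<le> B" for n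
    proof (rule AE_I2)
      fix x assume x: "x \<in> space torus"
      obtain z where z: "0 < z" "z < h n" "F (x + axis i (h n)) - F (x + axis i 0) = (h n - 0) * G (x + axis i z)"
        using MVT2[of 0 "h n" "\<lambda>h. F (x + axis i h)" "\<lambda>h. G (x + axis i h)"] der h[of n] by blast
      have "x + axis i z \<in> K"
      proof -
        have "0 \<le> x $ j + axis i z $ j \<and> x $ j + axis i z $ j \<le> 2 * pi + 1" for j
        proof -
          have "0 \<le> x $ j" "x $ j < 2 * pi" using x by auto
          moreover have "0 \<le> axis i z $ j" "axis i z $ j \<le> 1" using z h[of n] by (auto simp: axis_def)
          ultimately show ?thesis by linarith
        qed
        then show ?thesis by (simp add: K_def mem_box_cart)
      qed
      moreover have "D n x = G (x + axis i z)"
        using z(3) h[of n] by (simp add: D_def ax0)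
      ultimately show "norm (D n x) \<le> B" using B by simp
    qed
  qed simp
  then show ?thesis using intD LIMSEQ_unique[of "\<lambda>_. 0" 0] by (simp add: G_def)
qed

lemma pd_eqI: "(f has_derivative f') (at x) \<Longrightarrow> pd i f x = f' (axis i 1)"
  by (metis frechet_derivative_at pd_def)

lemma smoothD: "smooth f \<Longrightarrow> Ck n f" by (simp add: smooth_def)

lemma smooth_continuous: "smooth f \<Longrightarrow> continuous_on UNIV f"
  using Ck_cont smoothD by blast

lemma smooth_pd: "smooth f \<Longrightarrow> smooth (pd i f)"
  unfolding smooth_def pd_def by (metis (no_types, lifting) Ck.simps(2) ext)

lemma smooth_has_derivative: 
  "smooth f \<Longrightarrow> (f has_derivative frechet_derivative f (at x)) (at x)"
  using smoothD[of f 1] by (simp add: frechet_derivative_works)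

lemma pd_mult:
  fixes f g :: "real^3 \<Rightarrow> real"
  assumes "smooth f" "smooth g"
  shows "pd i (\<lambda>x. f x * g x) x = f x * pd i g x + pd i f x * g x"
  using pd_eqI[OF has_derivative_mult[OF smooth_has_derivative[OF assms(1)] smooth_has_derivative[OF assms(2)]]]
  by (simp add: pd_def)

lemma smooth_mult:
  fixes f g :: "'a::real_normed_vector \<Rightarrow> real"
  shows "smooth f \<Longrightarrow> smooth g \<Longrightarrow> smooth (\<lambda>x. f x * g x)"
  by (simp add: smooth_def Ck_mult)

lemma integral_by_parts_torus:
  fixes f g :: "real^3 \<Rightarrow> real"
  assumes "smooth f" "smooth g" "periodic f" "periodic g"
  shows "(\<integral>x. pd i f x * g x \<partial>torus) = - (\<integral>x. f x * pd i g x \<partial>torus)"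
proof -
  have "(\<integral>x. pd i (\<lambda>x. f x * g x) x \<partial>torus) = 0"
    by (rule integral_pd_zero) (use assms in \<open>auto intro!: smooth_mult smoothD simp: periodic_def simp del: One_nat_def\<close>)
  moreover have "(\<integral>x. pd i (\<lambda>x. f x * g x) x \<partial>torus)
      = (\<integral>x. f x * pd i g x \<partial>torus) + (\<integral>x. pd i f x * g x \<partial>torus)"
    unfolding pd_mult[OF assms(1,2)]
    by (intro Bochner_Integration.integral_add torus_integrable_continuous continuous_intros 
        smooth_continuous smooth_pd assms)
  ultimately show ?thesis by simp
qed

section \<open>Trigonometric modes on the torus\<close>

definition trig :: "int^3 \<Rightarrow> real \<Rightarrow> real^3 \<Rightarrow> real" where
  "trig k \<theta> x = cos (freq k \<bullet> x + \<theta>)"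

lemma Ck_trig: "Ck n (trig k \<theta>)"
  unfolding trig_def by (rule Ck_comp_bounded_linear[OF bounded_linear_inner_right Ck_cos])

lemma smooth_trig: "smooth (trig k \<theta>)"
  using Ck_trig by (simp add: smooth_def)

lemma freq_nth [simp]: "freq k $ i = of_int (k $ i)"
  by (simp add: freq_def)

lemma freq_axis: "freq k \<bullet> axis i h = of_int (k $ i) * h"
  by (simp add: inner_axis)

lemma periodic_trig: "periodic (trig k \<theta>)"
proof -
  have "cos (freq k \<bullet> (x + axis i (2 * pi)) + \<theta>) = cos (freq k \<bullet> x + \<theta>)" for x i
  proof -
    have "freq k \<bullet> (x + axis i (2 * pi)) + \<theta> = (freq k \<bullet> x + \<theta>) + 2 * pi * of_int (k $ i)"
      by (simp add: inner_add_right freq_axis)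
    then show ?thesis
      using cos_add[of "freq k \<bullet> x + \<theta>" "2 * pi * of_int (k $ i)"] by (simp add: add_ac)
  qed
  then show ?thesis by (simp add: periodic_def trig_def)
qed

lemma pd_trig: "pd i (trig k \<theta>) x = of_int (k $ i) * trig k (\<theta> + pi / 2) x"
proof -
  have "(trig k \<theta> has_derivative (\<lambda>v. - sin (freq k \<bullet> x + \<theta>) * (freq k \<bullet> v))) (at x)"
    unfolding trig_def by (auto intro!: derivative_eq_intros)
  from pd_eqI[OF this] show ?thesis
    using cos_add[of "freq k \<bullet> x + \<theta>" "pi / 2"] by (simp add: trig_def freq_axis add.assoc)
qed

lemma trig_continuous: "continuous_on UNIV (trig k \<theta>)"
  using smooth_trig smooth_continuous by blast

lemma abs_trig_le: "\<bar>trig k \<theta> x\<bar> \<le> 1" by (simp add: trig_def)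

text \<open>Up to the nonzero factor \<open>k $ i\<close>, the mode is the derivative of the mode
  whose phase is lowered by \<open>pi / 2\<close>.\<close>

lemma trig_integral_zero:
  assumes "k \<noteq> 0"
  shows "(\<integral>x. trig k \<theta> x \<partial>torus) = 0"
proof -
  obtain i where i: "k $ i \<noteq> 0" using assms by (auto simp: vec_eq_iff)
  have "(\<integral>x. pd i (trig k (\<theta> - pi / 2)) x \<partial>torus) = 0"
    by (rule integral_pd_zero[OF Ck_trig periodic_trig])
  then show ?thesis using i by (simp add: pd_trig)
qed

definition fmode :: "int^3 \<Rightarrow> real^3 \<Rightarrow> complex" where
  "fmode k x = cis (freq k \<bullet> x)"

lemma fmode_trig: "fmode k x = Complex (trig k 0 x) (- trig k (pi / 2) x)"
  by (simp add: fmode_def trig_def complex_eq_iff cos_add)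

lemma fmode_continuous: "continuous_on UNIV (fmode k)"
  unfolding fmode_def by (intro continuous_intros)

lemma norm_fmode [simp]: "norm (fmode k x) = 1" by (simp add: fmode_def)

lemma freq_add: "freq (k + l) = freq k + freq l" by (simp add: vec_eq_iff)
lemma freq_minus: "freq (- k) = - freq k" by (simp add: vec_eq_iff)
lemma freq_0 [simp]: "freq 0 = 0" by (simp add: vec_eq_iff)

lemma fmode_add: "fmode (k + l) x = fmode k x * fmode l x"
  by (simp add: fmode_def freq_add inner_add_left cis_mult)

lemma fmode_cnj: "cnj (fmode k x) = fmode (- k) x"
  by (simp add: fmode_def freq_minus cis_cnj)

lemma fmode_0 [simp]: "fmode 0 x = 1" by (simp add: fmode_def)

lemma periodic_fmode: "periodic (fmode k)"
  using periodic_trig[of k] by (simp add: periodic_def fmode_trig)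

lemma fmode_borel [measurable]: "fmode k \<in> borel_measurable torus"
  by (intro borel_measurable_torusI borel_measurable_continuous_onI fmode_continuous)

lemma fmode_integral: "(\<integral>x. fmode k x \<partial>torus) = (if k = 0 then of_real ((2 * pi) ^ 3) else 0)"
proof (cases "k = 0")
  case True
  then show ?thesis by (simp add: scaleR_conv_of_real)
next
  case False
  have i: "integrable torus (fmode k)" by (intro torus_integrable_continuous fmode_continuous)
  have "(\<integral>x. Re (fmode k x) \<partial>torus) = 0" "(\<integral>x. Im (fmode k x) \<partial>torus) = 0"
    using trig_integral_zero[OF False] by (simp_all add: fmode_trig)
  then have "Re (\<integral>x. fmode k x \<partial>torus) = 0" "Im (\<integral>x. fmode k x \<partial>torus) = 0"
    using integral_Re[OF i] integral_Im[OF i] by simp_all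
  then show ?thesis using False by (simp add: complex_eq_iff)
qed

subsection \<open>Square-integrable functions and Parseval's identity\<close>

definition cL2 :: "(real^3 \<Rightarrow> complex) set" where
  "cL2 = {f. f \<in> borel_measurable torus \<and> integrable torus (\<lambda>x. (cmod (f x))\<^sup>2)}"

definition cL2_sqnorm :: "(real^3 \<Rightarrow> complex) \<Rightarrow> real" where
  "cL2_sqnorm f = (\<integral>x. (cmod (f x))\<^sup>2 \<partial>torus)"

definition cL2_inner :: "(real^3 \<Rightarrow> complex) \<Rightarrow> (real^3 \<Rightarrow> complex) \<Rightarrow> complex" where
  "cL2_inner f g = (\<integral>x. f x * cnj (g x) \<partial>torus)"

abbreviation vol :: real where "vol \<equiv> (2 * pi) ^ 3"

text \<open>The factor \<open>1 / vol\<close> agrees with \<open>fourier_coeff\<close> and gives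
  each mode the coefficient 1 at its own frequency; Parseval's identity then carries the factor
  \<open>vol\<close>.\<close>

definition coef :: "(real^3 \<Rightarrow> complex) \<Rightarrow> int^3 \<Rightarrow> complex" where
  "coef f k = cL2_inner f (fmode k) / of_real vol"

lemma cL2_measurable [measurable_dest]: "f \<in> cL2 \<Longrightarrow> f \<in> borel_measurable torus"
  by (simp add: cL2_def)

lemma cL2_norm_sq_integrable: "f \<in> cL2 \<Longrightarrow> integrable torus (\<lambda>x. (cmod (f x))\<^sup>2)"
  by (simp add: cL2_def)

lemma cL2_sqnorm_nonneg: "0 \<le> cL2_sqnorm f" by (simp add: cL2_sqnorm_def)

lemma cmod_mult_le: "2 * cmod (a * b) \<le> (cmod a)\<^sup>2 + (cmod b)\<^sup>2"
  using sum_squares_bound[of "cmod a" "cmod b"] by (simp add: norm_mult)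

lemma cL2_mult_integrable:
  assumes "f \<in> cL2" "g \<in> cL2"
  shows "integrable torus (\<lambda>x. f x * g x)"
proof (rule Bochner_Integration.integrable_bound)
  show "integrable torus (\<lambda>x. (cmod (f x))\<^sup>2 + (cmod (g x))\<^sup>2)"
    using assms by (intro Bochner_Integration.integrable_add cL2_norm_sq_integrable)
  show "(\<lambda>x. f x * g x) \<in> borel_measurable torus" using assms by measurable
  show "AE x in torus. cmod (f x * g x) \<le> norm ((cmod (f x))\<^sup>2 + (cmod (g x))\<^sup>2)"
    using cmod_mult_le norm_ge_zero by (intro AE_I2) (smt (verit, best) real_norm_def zero_le_power2)
qed

lemma cmod_add_sq_le: "(cmod (a + b))\<^sup>2 \<le> 2 * (cmod a)\<^sup>2 + 2 * (cmod b)\<^sup>2"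
proof -
  have "(cmod (a + b))\<^sup>2 \<le> (cmod a + cmod b)\<^sup>2"
    by (intro power_mono norm_triangle_ineq norm_ge_zero)
  also have "\<dots> \<le> 2 * (cmod a)\<^sup>2 + 2 * (cmod b)\<^sup>2"
    using sum_squares_bound[of "cmod a" "cmod b"] by (simp add: power2_sum)
  finally show ?thesis .
qed

lemma cL2_add:
  assumes "f \<in> cL2" "g \<in> cL2"
  shows "(\<lambda>x. f x + g x) \<in> cL2"
proof -
  have "integrable torus (\<lambda>x. (cmod (f x + g x))\<^sup>2)"
  proof (rule Bochner_Integration.integrable_bound)
    show "integrable torus (\<lambda>x. 2 * (cmod (f x))\<^sup>2 + 2 * (cmod (g x))\<^sup>2)"
      using assms by (intro Bochner_Integration.integrable_add integrable_mult_right cL2_norm_sq_integrable)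
    show "(\<lambda>x. (cmod (f x + g x))\<^sup>2) \<in> borel_measurable torus" using assms by measurable
    show "AE x in torus. norm ((cmod (f x + g x))\<^sup>2) \<le> norm (2 * (cmod (f x))\<^sup>2 + 2 * (cmod (g x))\<^sup>2)"
      using cmod_add_sq_le by (intro AE_I2) simp
  qed
  moreover have "(\<lambda>x. f x + g x) \<in> borel_measurable torus" using assms by measurable
  ultimately show ?thesis by (simp add: cL2_def)
qed

lemma cL2_cmult:
  assumes "f \<in> cL2" shows "(\<lambda>x. c * f x) \<in> cL2"
proof -
  have "(\<lambda>x. c * f x) \<in> borel_measurable torus" using assms by measurable
  then show ?thesis
    using cL2_norm_sq_integrable[OF assms] by (simp add: cL2_def norm_mult power_mult_distrib)
qed

lemma cL2_diff: "f \<in> cL2 \<Longrightarrow> g \<in> cL2 \<Longrightarrow> (\<lambda>x. f x - g x) \<in> cL2"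
  using cL2_add[of f "\<lambda>x. (-1) * g x"] cL2_cmult[of g "-1"] by simp

lemma cL2_cnj:
  assumes "f \<in> cL2" shows "(\<lambda>x. cnj (f x)) \<in> cL2"
proof -
  have "cnj \<in> borel_measurable borel"
    by (intro borel_measurable_continuous_onI continuous_intros)
  then have "(\<lambda>x. cnj (f x)) \<in> borel_measurable torus"
    by (rule measurable_compose[OF cL2_measurable[OF assms]])
  then show ?thesis using assms by (simp add: cL2_def)
qed

lemma cL2_bounded:
  assumes "f \<in> borel_measurable torus" "\<And>x. x \<in> cell \<Longrightarrow> cmod (f x) \<le> B"
  shows "f \<in> cL2"
proof -
  have "integrable torus (\<lambda>x. (cmod (f x))\<^sup>2)"
    by (rule torus.integrable_const_bound[where B="B\<^sup>2"]) (use assms in \<open>auto intro!: AE_I2 power_mono\<close>)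
  then show ?thesis using assms by (simp add: cL2_def)
qed

lemma cL2_fmode: "fmode k \<in> cL2" by (rule cL2_bounded[where B=1]) auto

lemma cL2_mult_fmode:
  assumes "f \<in> cL2" shows "(\<lambda>x. f x * fmode k x) \<in> cL2"
proof -
  have "(\<lambda>x. f x * fmode k x) \<in> borel_measurable torus"
    by (intro borel_measurable_times cL2_measurable assms fmode_borel)
  then show ?thesis using cL2_norm_sq_integrable[OF assms] by (simp add: cL2_def norm_mult)
qed

lemma cL2_sum: "finite A \<Longrightarrow> (\<And>a. a \<in> A \<Longrightarrow> f a \<in> cL2) \<Longrightarrow> (\<lambda>x. \<Sum>a\<in>A. f a x) \<in> cL2"
proof (induction A rule: finite_induct)
  case empty
  then show ?case using cL2_bounded[of "\<lambda>_. 0" 0] by simp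
next
  case (insert a A)
  then show ?case by (simp add: cL2_add)
qed

lemma cL2_integrable: "f \<in> cL2 \<Longrightarrow> integrable torus f"
  using cL2_mult_integrable[OF _ cL2_fmode[of 0]] by simp

lemma cL2_inner_integrable: "f \<in> cL2 \<Longrightarrow> g \<in> cL2 \<Longrightarrow> integrable torus (\<lambda>x. f x * cnj (g x))"
  by (intro cL2_mult_integrable cL2_cnj)

lemma cL2_inner_self: "cL2_inner f f = of_real (cL2_sqnorm f)"
  by (simp add: cL2_inner_def cL2_sqnorm_def complex_norm_square[symmetric] flip: of_real_power)

lemma cL2_inner_add_left: "f \<in> cL2 \<Longrightarrow> g \<in> cL2 \<Longrightarrow> h \<in> cL2 \<Longrightarrow> cL2_inner (\<lambda>x. f x + g x) h = cL2_inner f h + cL2_inner g h"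
  unfolding cL2_inner_def by (simp add: distrib_right cL2_inner_integrable)

lemma cL2_inner_cmult_left: "cL2_inner (\<lambda>x. c * f x) h = c * cL2_inner f h"
  unfolding cL2_inner_def by (simp add: mult.assoc)

lemma cL2_inner_cnj: "cnj (cL2_inner f g) = cL2_inner g f"
  unfolding cL2_inner_def by (simp flip: Bochner_Integration.integral_cnj add: mult.commute)

lemma cL2_inner_sum_left: "finite A \<Longrightarrow> (\<And>a. a \<in> A \<Longrightarrow> f a \<in> cL2) \<Longrightarrow> g \<in> cL2 
    \<Longrightarrow> cL2_inner (\<lambda>x. \<Sum>a\<in>A. f a x) g = (\<Sum>a\<in>A. cL2_inner (f a) g)"
  unfolding cL2_inner_def by (simp add: sum_distrib_right cL2_inner_integrable)

lemma cL2_inner_fmode: "cL2_inner (fmode k) (fmode l) = (if k = l then of_real vol else 0)"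
  unfolding cL2_inner_def fmode_cnj fmode_add[symmetric] using fmode_integral[of "k + - l"] by simp

lemma coef_fmode: "coef (fmode k) l = (if k = l then 1 else 0)"
  by (simp add: coef_def cL2_inner_fmode)

lemma coef_add: "f \<in> cL2 \<Longrightarrow> g \<in> cL2 \<Longrightarrow> coef (\<lambda>x. f x + g x) k = coef f k + coef g k"
  by (simp add: coef_def cL2_inner_add_left cL2_fmode add_divide_distrib)

lemma coef_cmult: "coef (\<lambda>x. c * f x) k = c * coef f k"
  by (simp add: coef_def cL2_inner_cmult_left)

lemma coef_diff: "f \<in> cL2 \<Longrightarrow> g \<in> cL2 \<Longrightarrow> coef (\<lambda>x. f x - g x) k = coef f k - coef g k"
  using coef_add[of f "\<lambda>x. (-1) * g x" k] cL2_cmult[of g "-1"] coef_cmult[of "-1" g k] by simp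

lemma coef_sum_fmode: "finite F \<Longrightarrow> coef (\<lambda>x. \<Sum>k\<in>F. c k * fmode k x) l = (if l \<in> F then c l else 0)"
proof -
  assume F: "finite F"
  have "coef (\<lambda>x. \<Sum>k\<in>F. c k * fmode k x) l = (\<Sum>k\<in>F. coef (\<lambda>x. c k * fmode k x) l)"
    unfolding coef_def by (simp add: cL2_inner_sum_left F cL2_cmult cL2_fmode sum_divide_distrib)
  also have "\<dots> = (\<Sum>k\<in>F. if k = l then c k else 0)"
    by (intro sum.cong) (auto simp: coef_cmult coef_fmode)
  finally show ?thesis using F by simp
qed

lemma vol_pos: "0 < vol" by simp

lemma cL2_sqnorm_diff:
  assumes "f \<in> cL2" "g \<in> cL2"
  shows "cL2_sqnorm (\<lambda>x. f x - g x) = cL2_sqnorm f - 2 * Re (cL2_inner f g) + cL2_sqnorm g"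
proof -
  have "complex_of_real (cL2_sqnorm (\<lambda>x. f x - g x)) = (\<integral>x. f x * cnj (f x) - f x * cnj (g x) - g x * cnj (f x) + g x * cnj (g x) \<partial>torus)"
    unfolding cL2_inner_self[symmetric] cL2_inner_def by (simp add: algebra_simps)
  also have "\<dots> = cL2_inner f f - cL2_inner f g - cL2_inner g f + cL2_inner g g"
    unfolding cL2_inner_def using assms by (simp add: cL2_inner_integrable)
  also have "\<dots> = of_real (cL2_sqnorm f) - cL2_inner f g - cnj (cL2_inner f g) + of_real (cL2_sqnorm g)"
    by (simp add: cL2_inner_self cL2_inner_cnj)
  finally show ?thesis by (simp add: complex_eq_iff)
qed

lemma cL2_inner_sum_fmode: "finite F \<Longrightarrow> f \<in> cL2 \<Longrightarrow> cL2_inner f (\<lambda>x. \<Sum>k\<in>F. c k * fmode k x) = of_real vol * (\<Sum>k\<in>F. coef f k * cnj (c k))"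
proof -
  assume F: "finite F" and f: "f \<in> cL2"
  have "cL2_inner f (\<lambda>x. \<Sum>k\<in>F. c k * fmode k x) = cnj (\<Sum>k\<in>F. c k * cL2_inner (fmode k) f)"
    by (subst cL2_inner_cnj[symmetric]) (simp add: cL2_inner_sum_left F cL2_cmult cL2_fmode f cL2_inner_cmult_left)
  also have "\<dots> = (\<Sum>k\<in>F. cnj (c k) * cL2_inner f (fmode k))" by (simp add: cL2_inner_cnj)
  also have "\<dots> = of_real vol * (\<Sum>k\<in>F. coef f k * cnj (c k))"
    unfolding coef_def sum_distrib_left by (intro sum.cong) auto
  finally show ?thesis .
qed

lemma cL2_sqnorm_sum_fmode: "finite F \<Longrightarrow> cL2_sqnorm (\<lambda>x. \<Sum>k\<in>F. c k * fmode k x) = vol * (\<Sum>k\<in>F. (cmod (c k))\<^sup>2)"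
proof -
  assume F: "finite F"
  have "complex_of_real (cL2_sqnorm (\<lambda>x. \<Sum>k\<in>F. c k * fmode k x)) = of_real vol * (\<Sum>k\<in>F. c k * cnj (c k))"
    unfolding cL2_inner_self[symmetric]
    by (subst cL2_inner_sum_fmode) (auto simp: F coef_sum_fmode cL2_sum cL2_cmult cL2_fmode)
  also have "\<dots> = of_real (vol * (\<Sum>k\<in>F. (cmod (c k))\<^sup>2))"
    by (simp add: complex_norm_square[symmetric])
  finally show ?thesis using of_real_eq_iff by blast
qed

text \<open>Completing the square. The coefficients \<open>c\<close> enter only through their
  distance to those of \<open>f\<close>: the choice \<open>c = coef f\<close> gives Bessel's
  inequality, and for arbitrary \<open>c\<close> dropping the last sum gives the lower bound that
  turns density into Parseval's identity.\<close>

lemma cL2_sqnorm_diff_sum_fmode: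
  assumes F: "finite F" and f: "f \<in> cL2"
  shows "cL2_sqnorm (\<lambda>x. f x - (\<Sum>k\<in>F. c k * fmode k x))
    = cL2_sqnorm f - vol * (\<Sum>k\<in>F. (cmod (coef f k))\<^sup>2) + vol * (\<Sum>k\<in>F. (cmod (coef f k - c k))\<^sup>2)"
proof -
  have "(cmod (a - b))\<^sup>2 = (cmod a)\<^sup>2 - 2 * Re (a * cnj b) + (cmod b)\<^sup>2" for a b
    by (simp only: cmod_power2) (simp add: power2_eq_square algebra_simps)
  then have "(\<Sum>k\<in>F. (cmod (coef f k - c k))\<^sup>2)
      = (\<Sum>k\<in>F. (cmod (coef f k))\<^sup>2) - 2 * Re (\<Sum>k\<in>F. coef f k * cnj (c k)) + (\<Sum>k\<in>F. (cmod (c k))\<^sup>2)"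
    by (simp only: sum.distrib sum_subtractf sum_distrib_left[symmetric] Re_sum)
  then have e: "vol * (\<Sum>k\<in>F. (cmod (coef f k - c k))\<^sup>2)
      = vol * (\<Sum>k\<in>F. (cmod (coef f k))\<^sup>2) - 2 * (vol * Re (\<Sum>k\<in>F. coef f k * cnj (c k))) + vol * (\<Sum>k\<in>F. (cmod (c k))\<^sup>2)"
    by (simp only: distrib_left right_diff_distrib mult.left_commute)
  have "(\<lambda>x. \<Sum>k\<in>F. c k * fmode k x) \<in> cL2"
    using F by (intro cL2_sum cL2_cmult cL2_fmode)
  from cL2_sqnorm_diff[OF f this] show ?thesis
    unfolding e cL2_inner_sum_fmode[OF F f] cL2_sqnorm_sum_fmode[OF F] by simp
qed

lemma bessel: "finite F \<Longrightarrow> f \<in> cL2 \<Longrightarrow> vol * (\<Sum>k\<in>F. (cmod (coef f k))\<^sup>2) \<le> cL2_sqnorm f"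
  using cL2_sqnorm_diff_sum_fmode[of F f "coef f"] cL2_sqnorm_nonneg[of "\<lambda>x. f x - (\<Sum>k\<in>F. coef f k * fmode k x)"] by simp

section \<open>Density of trigonometric polynomials in square mean\<close>

inductive_set trig_polys :: "(real^3 \<Rightarrow> complex) set" where
  trig_polys_fmode: "fmode k \<in> trig_polys"
| trig_polys_add: "p \<in> trig_polys \<Longrightarrow> q \<in> trig_polys \<Longrightarrow> (\<lambda>x. p x + q x) \<in> trig_polys"
| trig_polys_cmult: "p \<in> trig_polys \<Longrightarrow> (\<lambda>x. c * p x) \<in> trig_polys"

lemma trig_polys_mult: "p \<in> trig_polys \<Longrightarrow> q \<in> trig_polys \<Longrightarrow> (\<lambda>x. p x * q x) \<in> trig_polys"
proof (induction rule: trig_polys.induct)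
  case (trig_polys_fmode k)
  from trig_polys_fmode show ?case
  proof (induction rule: trig_polys.induct)
    case (trig_polys_fmode l)
    show ?case using trig_polys.trig_polys_fmode[of "k + l"] by (simp add: fmode_add[abs_def])
  next
    case (trig_polys_add p q)
    then show ?case using trig_polys.trig_polys_add by (fastforce simp: distrib_left)
  next
    case (trig_polys_cmult p c)
    then show ?case using trig_polys.trig_polys_cmult[of "\<lambda>x. fmode k x * p x" c] by (simp add: mult.left_commute)
  qed
next
  case (trig_polys_add p q)
  then show ?case using trig_polys.trig_polys_add by (fastforce simp: distrib_right)
next
  case (trig_polys_cmult p c)
  then show ?case using trig_polys.trig_polys_cmult[of "\<lambda>x. p x * q x" c] by (simp add: mult.assoc)
qed

lemma trig_polys_const: "(\<lambda>x. c) \<in> trig_polys"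
  using trig_polys_cmult[OF trig_polys_fmode[of 0], of c] by simp

lemma trig_polys_cL2: "p \<in> trig_polys \<Longrightarrow> p \<in> cL2"
  by (induction rule: trig_polys.induct) (auto intro: cL2_fmode cL2_add cL2_cmult)

lemma trig_polys_expand: "p \<in> trig_polys \<Longrightarrow> \<exists>F c. finite F \<and> p = (\<lambda>x. \<Sum>k\<in>F. c k * fmode k x)"
proof (induction rule: trig_polys.induct)
  case (trig_polys_fmode k)
  show ?case by (intro exI[of _ "{k}"] exI[of _ "\<lambda>_. 1"]) auto
next
  case (trig_polys_add p q)
  then obtain F c G d where *: "finite F" "p = (\<lambda>x. \<Sum>k\<in>F. c k * fmode k x)"
     "finite G" "q = (\<lambda>x. \<Sum>k\<in>G. d k * fmode k x)" by blast
  let ?e = "\<lambda>k. (if k \<in> F then c k else 0) + (if k \<in> G then d k else 0)"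
  have "(\<Sum>k\<in>F \<union> G. ?e k * fmode k x) = (\<Sum>k\<in>F. c k * fmode k x) + (\<Sum>k\<in>G. d k * fmode k x)" for x
  proof -
    have "(\<Sum>k\<in>F. c k * fmode k x) = (\<Sum>k\<in>F \<union> G. (if k \<in> F then c k else 0) * fmode k x)"
      by (rule sum.mono_neutral_cong_left) (use * in auto)
    moreover have "(\<Sum>k\<in>G. d k * fmode k x) = (\<Sum>k\<in>F \<union> G. (if k \<in> G then d k else 0) * fmode k x)"
      by (rule sum.mono_neutral_cong_left) (use * in auto)
    ultimately show ?thesis by (simp add: distrib_right sum.distrib)
  qed
  then have "(\<lambda>x. p x + q x) = (\<lambda>x. \<Sum>k\<in>F \<union> G. ?e k * fmode k x)" using * by simp
  moreover have "finite (F \<union> G)" using * by simp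
  ultimately show ?case
    by (intro exI[of _ "F \<union> G"] exI[of _ ?e] conjI)
next
  case (trig_polys_cmult p c)
  then obtain F d where *: "finite F" "p = (\<lambda>x. \<Sum>k\<in>F. d k * fmode k x)" by blast
  then show ?case
    by (intro exI[of _ F] exI[of _ "\<lambda>k. c * d k"]) (auto simp: sum_distrib_left mult.assoc)
qed

definition trig_approx :: "(real^3 \<Rightarrow> complex) \<Rightarrow> bool" where
  "trig_approx f \<longleftrightarrow> f \<in> cL2 \<and> (\<forall>e>0. \<exists>p\<in>trig_polys. cL2_sqnorm (\<lambda>x. f x - p x) < e)"

lemma trig_approx_trig_polys: "p \<in> trig_polys \<Longrightarrow> trig_approx p"
  unfolding trig_approx_def using trig_polys_cL2 by (auto intro!: bexI[of _ p] simp: cL2_sqnorm_def)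

lemma cL2_sqnorm_add_le:
  assumes "f \<in> cL2" "g \<in> cL2"
  shows "cL2_sqnorm (\<lambda>x. f x + g x) \<le> 2 * cL2_sqnorm f + 2 * cL2_sqnorm g"
proof -
  have "cL2_sqnorm (\<lambda>x. f x + g x) \<le> (\<integral>x. 2 * (cmod (f x))\<^sup>2 + 2 * (cmod (g x))\<^sup>2 \<partial>torus)"
    unfolding cL2_sqnorm_def
    by (intro integral_mono Bochner_Integration.integrable_add integrable_mult_right cL2_norm_sq_integrable cL2_add assms cmod_add_sq_le)
  also have "\<dots> = 2 * cL2_sqnorm f + 2 * cL2_sqnorm g"
    unfolding cL2_sqnorm_def using assms by (simp add: cL2_norm_sq_integrable)
  finally show ?thesis .
qed

text \<open>Square-mean approximability survives dominated pointwise limits; each passage to the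
  limit on the way from boxes to arbitrary functions goes through this.\<close>

lemma trig_approx_lim:
  assumes g: "\<And>n::nat. trig_approx (g n)" and f: "f \<in> cL2"
    and lim: "AE x in torus. (\<lambda>n. g n x) \<longlonglongrightarrow> f x"
    and w: "integrable torus w" and bd: "\<And>n. AE x in torus. (cmod (f x - g n x))\<^sup>2 \<le> w x"
  shows "trig_approx f"
  unfolding trig_approx_def
proof (intro conjI allI impI f)
  fix e :: real assume e: "e > 0"
  have gL: "g n \<in> cL2" for n using g by (simp add: trig_approx_def)
  have "(\<lambda>n. cL2_sqnorm (\<lambda>x. f x - g n x)) \<longlonglongrightarrow> (\<integral>x. 0 \<partial>torus)"
    unfolding cL2_sqnorm_def
  proof (rule integral_dominated_convergence[OF _ _ w])
    show "(\<lambda>x. (cmod (f x - g i x))\<^sup>2) \<in> borel_measurable torus" for i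
      using f gL[of i] by measurable
    show "AE x in torus. (\<lambda>n. (cmod (f x - g n x))\<^sup>2) \<longlonglongrightarrow> 0"
      using lim
    proof (rule AE_mp, intro AE_I2 impI)
      fix x assume "(\<lambda>n. g n x) \<longlonglongrightarrow> f x"
      then have "(\<lambda>n. (cmod (f x - g n x))\<^sup>2) \<longlonglongrightarrow> (cmod (f x - f x))\<^sup>2"
        by (intro tendsto_intros)
      then show "(\<lambda>n. (cmod (f x - g n x))\<^sup>2) \<longlonglongrightarrow> 0" by simp
    qed
    show "AE x in torus. norm ((cmod (f x - g n x))\<^sup>2) \<le> w x" for n using bd by simp
  qed simp
  then have "(\<lambda>n. cL2_sqnorm (\<lambda>x. f x - g n x)) \<longlonglongrightarrow> 0" by simp
  \<comment> \<open>The squared norm satisfies the triangle inequality only up to a factor 2, so two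
    errors below \<open>e / 4\<close> add up to less than \<open>e\<close>.\<close>
  then have "eventually (\<lambda>n. cL2_sqnorm (\<lambda>x. f x - g n x) < e / 4) sequentially"
    using e by (intro order_tendstoD) auto
  then obtain n where n: "cL2_sqnorm (\<lambda>x. f x - g n x) < e / 4" by (auto simp: eventually_sequentially)
  obtain p where p: "p \<in> trig_polys" "cL2_sqnorm (\<lambda>x. g n x - p x) < e / 4"
    using g[of n] e unfolding trig_approx_def by (metis divide_pos_pos zero_less_numeral)
  have "cL2_sqnorm (\<lambda>x. (f x - g n x) + (g n x - p x)) \<le> 2 * cL2_sqnorm (\<lambda>x. f x - g n x) + 2 * cL2_sqnorm (\<lambda>x. g n x - p x)"
    by (intro cL2_sqnorm_add_le cL2_diff f gL trig_polys_cL2 p)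
  also have "\<dots> < e" using n p(2) by simp
  finally show "\<exists>p\<in>trig_polys. cL2_sqnorm (\<lambda>x. f x - p x) < e" using p(1) by auto
qed

lemma trig_approx_add:
  assumes "trig_approx f" "trig_approx g"
  shows "trig_approx (\<lambda>x. f x + g x)"
  unfolding trig_approx_def
proof (intro conjI allI impI)
  have fg: "f \<in> cL2" "g \<in> cL2" using assms by (auto simp: trig_approx_def)
  then show "(\<lambda>x. f x + g x) \<in> cL2" by (rule cL2_add)
  fix e :: real assume e: "e > 0"
  obtain p where p: "p \<in> trig_polys" "cL2_sqnorm (\<lambda>x. f x - p x) < e / 4"
    using assms(1) e unfolding trig_approx_def by (metis divide_pos_pos zero_less_numeral)
  obtain q where q: "q \<in> trig_polys" "cL2_sqnorm (\<lambda>x. g x - q x) < e / 4"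
    using assms(2) e unfolding trig_approx_def by (metis divide_pos_pos zero_less_numeral)
  have "cL2_sqnorm (\<lambda>x. (f x - p x) + (g x - q x)) \<le> 2 * cL2_sqnorm (\<lambda>x. f x - p x) + 2 * cL2_sqnorm (\<lambda>x. g x - q x)"
    by (intro cL2_sqnorm_add_le cL2_diff fg trig_polys_cL2 p q)
  also have "\<dots> < e" using p(2) q(2) by simp
  finally have "cL2_sqnorm (\<lambda>x. (f x + g x) - (p x + q x)) < e" by (simp add: algebra_simps)
  then show "\<exists>p\<in>trig_polys. cL2_sqnorm (\<lambda>x. f x + g x - p x) < e" 
    using trig_polys_add[OF p(1) q(1)] by (intro bexI[of _ "\<lambda>x. p x + q x"]) auto
qed

lemma trig_approx_cmult:
  assumes "trig_approx f"
  shows "trig_approx (\<lambda>x. c * f x)"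
  unfolding trig_approx_def
proof (intro conjI allI impI)
  have f: "f \<in> cL2" using assms by (auto simp: trig_approx_def)
  then show "(\<lambda>x. c * f x) \<in> cL2" by (rule cL2_cmult)
  fix e :: real assume e: "e > 0"
  \<comment> \<open>Adding 1 keeps the quotient meaningful when \<open>c = 0\<close>.\<close>
  let ?d = "e / ((cmod c)\<^sup>2 + 1)"
  have d: "?d > 0" using e by (intro divide_pos_pos add_nonneg_pos) auto
  then obtain p where p: "p \<in> trig_polys" "cL2_sqnorm (\<lambda>x. f x - p x) < ?d"
    using assms unfolding trig_approx_def by blast
  have "cL2_sqnorm (\<lambda>x. c * f x - c * p x) = (cmod c)\<^sup>2 * cL2_sqnorm (\<lambda>x. f x - p x)"
    unfolding cL2_sqnorm_def by (simp add: right_diff_distrib[symmetric] norm_mult power_mult_distrib)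
  also have "\<dots> \<le> ((cmod c)\<^sup>2 + 1) * cL2_sqnorm (\<lambda>x. f x - p x)"
    using cL2_sqnorm_nonneg by (intro mult_right_mono) auto
  also have "\<dots> < ((cmod c)\<^sup>2 + 1) * ?d"
    using p(2) by (intro mult_strict_left_mono) (auto intro: add_nonneg_pos)
  also have "\<dots> = e" by (simp add: add_nonneg_pos less_imp_neq[symmetric])
  finally show "\<exists>p\<in>trig_polys. cL2_sqnorm (\<lambda>x. c * f x - p x) < e" 
    using trig_polys_cmult[OF p(1)] by (intro bexI[of _ "\<lambda>x. c * p x"]) auto
qed

lemma trig_polys_cos: "(\<lambda>x. complex_of_real (cos (x $ i - c))) \<in> trig_polys"
proof -
  let ?k = "axis i 1 :: int^3"
  have f: "freq ?k \<bullet> x = x $ i" for x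
  proof -
    have "freq ?k = axis i 1" by (simp add: vec_eq_iff axis_def)
    then show ?thesis by (simp add: inner_axis')
  qed
  have "complex_of_real (cos (x $ i - c)) = (cis (- c) / 2) * fmode ?k x + (cis c / 2) * fmode (- ?k) x" for x
    by (simp add: fmode_def freq_minus f complex_eq_iff cos_diff sin_diff field_simps)
  then show ?thesis
    using trig_polys_add[OF trig_polys_cmult[OF trig_polys_fmode[of ?k], of "cis (- c) / 2"] trig_polys_cmult[OF trig_polys_fmode[of "- ?k"], of "cis c / 2"]]
    by simp
qed

text \<open>A linear form is expanded along the coordinate axes; products are covered because
  trigonometric polynomials are closed under multiplication.\<close>

lemma trig_polys_real_polynomial:
  assumes "real_polynomial_function g"
  shows "(\<lambda>x. complex_of_real (g (\<chi> i. cos (x $ i - c $ i)))) \<in> trig_polys"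
  using assms
proof (induction rule: real_polynomial_function.induct)
  case (linear f)
  have "complex_of_real (f (\<chi> i. cos (x $ i - c $ i)))
      = (\<Sum>i\<in>UNIV. of_real (f (axis i 1)) * of_real (cos (x $ i - c $ i)))" for x :: "real^3"
  proof -
    have "f (\<chi> i. cos (x $ i - c $ i)) = f (\<Sum>i\<in>UNIV. cos (x $ i - c $ i) *\<^sub>R axis i 1)"
      by (rule arg_cong[where f=f]) (simp add: vec_eq_iff axis_def if_distrib cong: if_cong)
    also have "\<dots> = (\<Sum>i\<in>UNIV. cos (x $ i - c $ i) *\<^sub>R f (axis i 1))"
      using linear by (simp add: linear_simps linear_sum bounded_linear.linear)
    finally show ?thesis by (simp add: mult.commute)
  qed
  then show ?case
    unfolding sum_3[of "\<lambda>i. of_real (f (axis i 1)) * of_real (cos (_ $ i - c $ i)) :: complex"]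
    by (auto simp: sum_3 intro!: trig_polys_add trig_polys_cmult trig_polys_cos)
next
  case (const a)
  show ?case by (rule trig_polys_const)
next
  case (add f g)
  then show ?case using trig_polys_add by fastforce
next
  case (mult f g)
  then show ?case using trig_polys_mult by fastforce
qed

text \<open>The window for \<open>y\<close> excludes the arcs around \<open>2 * pi\<close> and
  \<open>- 2 * pi\<close>, where the cosine would exceed \<open>cos r\<close> again.\<close>

lemma cos_gt_iff:
  assumes "0 \<le> r" "r \<le> pi" "\<bar>y\<bar> \<le> 2 * pi - r"
  shows "cos y > cos r \<longleftrightarrow> \<bar>y\<bar> < r"
proof -
  have "cos \<bar>y\<bar> > cos r" if "\<bar>y\<bar> < r"
    using cos_monotone_0_pi[of "\<bar>y\<bar>" r] that assms by simp
  moreover have "cos \<bar>y\<bar> \<le> cos r" if "\<not> \<bar>y\<bar> < r"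
  proof (cases "\<bar>y\<bar> \<le> pi")
    case True
    then show ?thesis using cos_monotone_0_pi_le[of r "\<bar>y\<bar>"] that assms by simp
  next
    case False
    have "cos (2 * pi - \<bar>y\<bar>) \<le> cos r"
      using cos_monotone_0_pi_le[of r "2 * pi - \<bar>y\<bar>"] that assms False by simp
    then show ?thesis by (simp add: cos_diff)
  qed
  ultimately show ?thesis by (metis cos_abs_real not_less)
qed

text \<open>Inside the cell an open box is cut out by the inequalities
  \<open>cos (x $ i - c $ i) > cos (r i)\<close>, with \<open>c\<close> the centre and
  \<open>r\<close> the half side lengths. A continuous function of these cosines lives on a cube,
  where the Stone-Weierstrass theorem approximates it uniformly by polynomials, and polynomials in
  shifted cosines are trigonometric. This takes the place of a summation kernel.\<close>

lemma trig_approx_box0: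
  fixes a b :: "real^3"
  assumes ab: "\<And>i. 0 \<le> a $ i" "\<And>i. a $ i < b $ i" "\<And>i. b $ i \<le> 2 * pi"
  shows "trig_approx (\<lambda>x. indicator (box a b) x)"
proof -
  define c where "c = (\<chi> i. (a $ i + b $ i) / 2)"
  define r where "r i = (b $ i - a $ i) / 2" for i
  define \<gamma> where "\<gamma> i = cos (r i)" for i
  define cv :: "real^3 \<Rightarrow> real^3" where "cv x = (\<chi> i. cos (x $ i - c $ i))" for x
  \<comment> \<open>Clamped ramps: for growing slope they tend to the indicator of
    \<open>t > \<gamma> i\<close>, with the value 0 at the threshold itself, as an open box
    requires.\<close>
  define cl :: "nat \<Rightarrow> 3 \<Rightarrow> real \<Rightarrow> real" where "cl m i t = min 1 (max 0 (real m * (t - \<gamma> i)))" for m i t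
  define \<Phi> where "\<Phi> m y = (\<Prod>i\<in>UNIV. cl m i (y $ i))" for m and y :: "real^3"
  define K where "K = cbox (- 1) (1 :: real^3)"
  have cvK: "cv x \<in> K" for x by (simp add: K_def cv_def mem_box_cart)
  have "\<exists>g. real_polynomial_function g \<and> (\<forall>y\<in>K. \<bar>\<Phi> m y - g y\<bar> < inverse (real (Suc m)))" for m
  proof -
    have K: "compact K" unfolding K_def by (rule compact_cbox)
    have c: "continuous_on K (\<Phi> m)" unfolding \<Phi>_def cl_def
      by (intro continuous_on_prod continuous_on_min continuous_on_max continuous_on_const continuous_on_mult 
          continuous_on_diff continuous_on_component continuous_on_id)
    have e: "0 < inverse (real (Suc m))" by simp
    obtain g where "real_polynomial_function g" "\<And>y. y \<in> K \<Longrightarrow> \<bar>\<Phi> m y - g y\<bar> < inverse (real (Suc m))"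
      using Stone_Weierstrass_real_polynomial_function[OF K c e] by metis
    then show ?thesis by (intro exI[of _ g]) simp
  qed
  then obtain g where g: "\<And>m. real_polynomial_function (g m)"
     "\<And>m y. y \<in> K \<Longrightarrow> \<bar>\<Phi> m y - g m y\<bar> < inverse (real (Suc m))" by metis
  define p where "p m x = complex_of_real (g m (cv x))" for m x
  have p: "p m \<in> trig_polys" for m
    using trig_polys_real_polynomial[OF g(1), of m c] by (simp add: p_def[abs_def] cv_def)
  have \<Phi>_bd: "0 \<le> \<Phi> m y" "\<Phi> m y \<le> 1" for m y
    unfolding \<Phi>_def by (auto intro!: prod_nonneg prod_le_1 simp: cl_def)
  have cl_lim: "(\<lambda>m. cl m i t) \<longlonglongrightarrow> (if t > \<gamma> i then 1 else 0)" for i t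
  proof (cases "t > \<gamma> i")
    case True
    obtain N :: nat where N: "1 < real N * (t - \<gamma> i)"
      using reals_Archimedean3[of "t - \<gamma> i"] True by auto
    have "eventually (\<lambda>m. cl m i t = 1) sequentially"
    proof (rule eventually_sequentiallyI[of N])
      fix m assume "N \<le> m"
      then have "real N * (t - \<gamma> i) \<le> real m * (t - \<gamma> i)" using True by (intro mult_right_mono) auto
      then show "cl m i t = 1" using N by (simp add: cl_def)
    qed
    then show ?thesis using True by (simp add: tendsto_eventually)
  next
    case False
    then have "real m * (t - \<gamma> i) \<le> 0" for m by (simp add: mult_nonneg_nonpos)
    then have "cl m i t = 0" for m by (simp add: cl_def max_absorb1)
    then show ?thesis using False by simp
  qed
  have box_iff: "x \<in> box a b \<longleftrightarrow> (\<forall>i. cv x $ i > \<gamma> i)" if "x \<in> cell" for x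
  proof -
    have "a $ i < x $ i \<and> x $ i < b $ i \<longleftrightarrow> cv x $ i > \<gamma> i" for i
    proof -
      have x: "0 \<le> x $ i" "x $ i < 2 * pi" using that by auto
      have "cos (x $ i - c $ i) > cos (r i) \<longleftrightarrow> \<bar>x $ i - c $ i\<bar> < r i"
      proof (rule cos_gt_iff)
        show "0 \<le> r i" "r i \<le> pi" using ab(1)[of i] ab(2)[of i] ab(3)[of i] by (simp_all add: r_def)
        show "\<bar>x $ i - c $ i\<bar> \<le> 2 * pi - r i"
          using ab(1)[of i] ab(2)[of i] ab(3)[of i] x unfolding r_def c_def by (simp add: abs_le_iff field_simps)
      qed
      then show ?thesis unfolding \<gamma>_def cv_def r_def c_def by (simp add: abs_less_iff field_simps) linarith
    qed
    then show ?thesis by (simp add: mem_box_cart)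
  qed
  have lim: "(\<lambda>m. p m x) \<longlonglongrightarrow> indicator (box a b) x" if x: "x \<in> cell" for x
  proof -
    have "(\<lambda>m. \<Phi> m (cv x)) \<longlonglongrightarrow> (\<Prod>i\<in>UNIV. if cv x $ i > \<gamma> i then 1 else 0)"
      unfolding \<Phi>_def by (intro tendsto_prod cl_lim)
    moreover have "(\<Prod>i\<in>UNIV. if cv x $ i > \<gamma> i then 1 else 0 :: real) = indicator (box a b) x"
      using box_iff[OF x] by (auto simp: indicator_def prod_zero_iff split: if_splits)
    ultimately have 1: "(\<lambda>m. \<Phi> m (cv x)) \<longlonglongrightarrow> indicator (box a b) x" by simp
    have 2: "(\<lambda>m. g m (cv x) - \<Phi> m (cv x)) \<longlonglongrightarrow> 0"
    proof (rule Lim_null_comparison[OF _ LIMSEQ_inverse_real_of_nat])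
      show "eventually (\<lambda>m. norm (g m (cv x) - \<Phi> m (cv x)) \<le> inverse (real (Suc m))) sequentially"
        using g(2)[OF cvK, of _ x] by (intro always_eventually allI) (simp add: abs_minus_commute less_imp_le)
    qed
    from tendsto_add[OF 2 1] have "(\<lambda>m. g m (cv x)) \<longlonglongrightarrow> indicator (box a b) x" by simp
    then have "(\<lambda>m. complex_of_real (g m (cv x))) \<longlonglongrightarrow> of_real (indicator (box a b) x)"
      by (rule tendsto_of_real)
    then show ?thesis unfolding p_def by (cases "x \<in> box a b") simp_all
  qed
  have pb: "cmod (p m x) \<le> 2" for m x
  proof -
    have "\<bar>g m (cv x)\<bar> \<le> \<bar>\<Phi> m (cv x)\<bar> + \<bar>\<Phi> m (cv x) - g m (cv x)\<bar>" by linarith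
    also have "\<dots> \<le> 1 + inverse (real (Suc m))"
      using \<Phi>_bd[of m "cv x"] g(2)[OF cvK, of m x] by linarith
    also have "\<dots> \<le> 2" by (simp add: field_simps)
    finally show ?thesis by (simp add: p_def)
  qed
  have im: "(\<lambda>x. indicator (box a b) x :: complex) \<in> borel_measurable torus"
    by (intro borel_measurable_torusI) simp
  \<comment> \<open>The polynomials are bounded by \<open>1 + 1 = 2\<close> and the indicator by 1,
    so the squared difference is at most \<open>3^2 = 9\<close>.\<close>
  show ?thesis
  proof (rule trig_approx_lim[where g=p and w="\<lambda>_. 9"])
    show "trig_approx (p m)" for m by (rule trig_approx_trig_polys[OF p])
    show "(\<lambda>x. indicator (box a b) x :: complex) \<in> cL2"
      by (rule cL2_bounded[where B=1]) (use im in \<open>auto simp: indicator_def\<close>)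
    show "AE x in torus. (\<lambda>n. p n x) \<longlonglongrightarrow> indicator (box a b) x"
      by (rule AE_I2) (use lim in simp)
    show "AE x in torus. (cmod (indicator (box a b) x - p n x))\<^sup>2 \<le> 9" for n
    proof (rule AE_I2)
      fix x
      have "cmod (indicator (box a b) x - p n x) \<le> 1 + 2"
        using norm_triangle_ineq4[of "indicator (box a b) x" "p n x"] pb[of n x]
        by (auto simp: indicator_def split: if_splits)
      then have "(cmod (indicator (box a b) x - p n x))\<^sup>2 \<le> 3\<^sup>2" by (intro power_mono) auto
      then show "(cmod (indicator (box a b) x - p n x))\<^sup>2 \<le> 9" by simp
    qed
  qed simp
qed

lemma trig_approx_cong_AE:
  assumes "trig_approx f" "g \<in> borel_measurable torus" "AE x in torus. f x = g x"
  shows "trig_approx g"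
proof (rule trig_approx_lim[where g="\<lambda>_. f" and w="\<lambda>_. 0"])
  have f: "f \<in> cL2" using assms by (simp add: trig_approx_def)
  have "integrable torus (\<lambda>x. (cmod (g x))\<^sup>2)"
  proof (rule Bochner_Integration.integrable_cong_AE_imp[OF cL2_norm_sq_integrable[OF f]])
    show "AE x in torus. (cmod (f x))\<^sup>2 = (cmod (g x))\<^sup>2"
      using assms(3) by (rule AE_mp) (intro AE_I2 impI, simp)
  qed (use assms in measurable)
  then show "g \<in> cL2" using assms by (simp add: cL2_def)
  show "AE x in torus. (\<lambda>n. f x) \<longlonglongrightarrow> g x"
    using assms(3) by (rule AE_mp) (intro AE_I2 impI, simp)
  show "AE x in torus. (cmod (g x - f x))\<^sup>2 \<le> 0"
    using assms(3) by (rule AE_mp) (intro AE_I2 impI, simp)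
qed (use assms in auto)

lemma AE_torus_nth_nonzero: "AE x in torus. x $ i \<noteq> 0"
proof -
  have "negligible {x::real^3. x $ i = 0}" by (rule negligible_standard_hyperplane_cart)
  then have "AE x in lebesgue. x \<notin> {x::real^3. x $ i = 0}"
    by (intro AE_not_in) (simp add: negligible_iff_null_sets)
  then show ?thesis unfolding torus_def
    by (subst AE_restrict_space_iff) (auto intro: cell_lebesgue)
qed

lemma trig_approx_zero: "trig_approx (\<lambda>_. 0)"
  by (rule trig_approx_trig_polys[OF trig_polys_const])

lemma trig_approx_box:
  fixes a b :: "real^3"
  shows "trig_approx (\<lambda>x. indicator (box a b) x)"
proof -
  define a' where "a' = (\<chi> i. max 0 (a $ i))"
  define b' where "b' = (\<chi> i. min (2 * pi) (b $ i))"
  have d: "trig_approx (\<lambda>x. indicator (box a' b') x)"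
  proof (cases "\<forall>i. a' $ i < b' $ i")
    case True
    then show ?thesis by (intro trig_approx_box0) (auto simp: a'_def b'_def)
  next
    case False
    then have "box a' b' = {}" by (simp add: interval_eq_empty_cart not_less)
    then show ?thesis using trig_approx_zero by simp
  qed
  show ?thesis
  proof (rule trig_approx_cong_AE[OF d])
    show "(\<lambda>x. indicator (box a b) x :: complex) \<in> borel_measurable torus"
      by (intro borel_measurable_torusI) simp
    \<comment> \<open>Within the cell the clipped box and the given one differ only on the faces
      where a coordinate is 0, a null set.\<close>
    have "AE x in torus. \<forall>i\<in>UNIV. x $ i \<noteq> 0" by (intro AE_finite_allI AE_torus_nth_nonzero) auto
    then show "AE x in torus. (indicator (box a' b') x :: complex) = indicator (box a b) x"
    proof (rule AE_mp, intro AE_I2 impI)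
      fix x assume x: "x \<in> space torus" and nz: "\<forall>i\<in>UNIV. x $ i \<noteq> 0"
      have "0 < x $ i \<and> x $ i < 2 * pi" for i
      proof -
        have "0 \<le> x $ i" "x $ i < 2 * pi" using x by simp_all
        then show ?thesis using nz by (simp add: less_le)
      qed
      then have "x \<in> box a' b' \<longleftrightarrow> x \<in> box a b"
        by (simp add: mem_box_cart a'_def b'_def)
      then show "(indicator (box a' b') x :: complex) = indicator (box a b) x" by (simp add: indicator_def)
    qed
  qed
qed

lemma cmod_indicator_diff: "(cmod (indicator A x - indicator B x))\<^sup>2 \<le> 1"
  by (auto simp: indicator_def)

text \<open>Boxes form an intersection-stable generator of the Borel sets, and approximability
  passes to complements and to disjoint countable unions.\<close>

lemma trig_approx_borel:
  fixes A :: "(real^3) set"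
  assumes "A \<in> sets borel"
  shows "trig_approx (\<lambda>x. indicator A x)"
proof -
  let ?G = "range (\<lambda>(a, b). box a b :: (real^3) set)"
  have sb: "sigma_sets UNIV ?G = sets borel"
    by (simp add: borel_eq_box)
  have "Int_stable ?G" by (auto simp: Int_stable_def box_Int_box)
  moreover have "?G \<subseteq> Pow UNIV" by simp
  moreover have "A \<in> sigma_sets UNIV ?G" using assms sb by simp
  ultimately show ?thesis
  proof (induction rule: sigma_sets_induct_disjoint)
    case (basic A)
    then show ?case using trig_approx_box by auto
  next
    case empty
    show ?case using trig_approx_zero by simp
  next
    case (compl A)
    have "trig_approx (\<lambda>x. 1 + (-1) * indicator A x)"
      by (intro trig_approx_add trig_approx_cmult trig_approx_trig_polys[OF trig_polys_const] compl)
    moreover have "(1 + (-1) * indicator A x :: complex) = indicator (UNIV - A) x" for x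
      by (simp add: indicator_def)
    ultimately show ?case by simp
  next
    case (union A)
    have Am: "A i \<in> sets borel" for i using union(2) sb by blast
    have fin: "trig_approx (\<lambda>x. indicator (\<Union>i<n. A i) x)" for n
    proof (induction n)
      case 0
      show ?case using trig_approx_zero by simp
    next
      case (Suc n)
      have "(indicator (\<Union>i<n. A i) x + indicator (A n) x :: complex) = indicator (\<Union>i<Suc n. A i) x" for x
      proof -
        have "(\<Union>i<n. A i) \<inter> A n = {}"
        proof -
          have "A n \<inter> A i = {}" if "i < n" for i
            using disjoint_family_onD[OF union(1), of n i] that by simp
          then show ?thesis by (subst Int_commute) (simp add: Int_UN_distrib)
        qed
        moreover have "(\<Union>i<Suc n. A i) = (\<Union>i<n. A i) \<union> A n"
          by (simp add: lessThan_Suc Un_commute)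
        ultimately show ?thesis by (simp add: indicator_add)
      qed
      then show ?case using trig_approx_add[OF Suc union(3)[of n]] by simp
    qed
    show ?case
    proof (rule trig_approx_lim[OF fin, where w="\<lambda>_. 1"])
      have "(\<lambda>x. indicator (\<Union>i. A i) x :: complex) \<in> borel_measurable torus"
        using Am by (intro borel_measurable_torusI borel_measurable_indicator) auto
      then show "(\<lambda>x. indicator (\<Union>i. A i) x :: complex) \<in> cL2"
        by (rule cL2_bounded[where B=1]) (auto simp: indicator_def)
      show "AE x in torus. (\<lambda>n. indicator (\<Union>i<n. A i) x :: complex) \<longlonglongrightarrow> indicator (\<Union>i. A i) x"
        by (rule AE_I2) (rule LIMSEQ_indicator_UN)
      show "AE x in torus. (cmod (indicator (\<Union>i. A i) x - indicator (\<Union>i<n. A i) x))\<^sup>2 \<le> 1" for n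
        by (rule AE_I2) (rule cmod_indicator_diff)
    qed simp
  qed
qed

text \<open>A Lebesgue set differs from its Borel main part only by a null set, which
  \<open>trig_approx_cong_AE\<close> ignores.\<close>

lemma trig_approx_indicator:
  assumes "A \<in> sets torus"
  shows "trig_approx (\<lambda>x. indicator A x)"
proof (rule trig_approx_cong_AE)
  have A: "A \<in> sets lebesgue" using assms cell_lebesgue
    by (auto simp: torus_def sets_restrict_space)
  show "trig_approx (\<lambda>x. indicator (main_part lborel A) x)"
    using A main_part_sets[of A lborel] by (intro trig_approx_borel) auto
  show "(\<lambda>x. indicator A x :: complex) \<in> borel_measurable torus"
    using assms by simp
  have "AE x in lborel. x \<notin> null_part lborel A" using A by (rule AE_notin_null_part)
  then have "AE x in lebesgue. x \<notin> null_part lborel A" by (rule AE_completion)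
  then have "AE x in torus. x \<notin> null_part lborel A"
    unfolding torus_def by (subst AE_restrict_space_iff) (auto intro: cell_lebesgue)
  then show "AE x in torus. (indicator (main_part lborel A) x :: complex) = indicator A x"
  proof (rule AE_mp, intro AE_I2 impI)
    fix x assume "x \<notin> null_part lborel A"
    moreover have "main_part lborel A \<union> null_part lborel A = A" using A by simp
    ultimately have "x \<in> main_part lborel A \<longleftrightarrow> x \<in> A" by blast
    then show "(indicator (main_part lborel A) x :: complex) = indicator A x" by (simp add: indicator_def)
  qed
qed

lemma trig_approx_sum: "finite A \<Longrightarrow> (\<And>a. a \<in> A \<Longrightarrow> trig_approx (f a)) \<Longrightarrow> trig_approx (\<lambda>x. \<Sum>a\<in>A. f a x)"
  by (induction A rule: finite_induct) (auto intro: trig_approx_zero trig_approx_add)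

lemma trig_approx_cL2:
  assumes f: "f \<in> cL2"
  shows "trig_approx f"
proof -
  obtain s where s: "\<And>i. simple_function torus (s i)" "\<And>x. x \<in> space torus \<Longrightarrow> (\<lambda>i. s i x) \<longlonglongrightarrow> f x"
    "\<And>i x. x \<in> space torus \<Longrightarrow> dist (s i x) 0 \<le> 2 * dist (f x) 0"
    using borel_measurable_implies_sequence_metric[OF cL2_measurable[OF f], of 0] by blast
  have ds: "trig_approx (s i)" for i
  proof -
    have fin: "finite (s i ` space torus)" using s(1) by (rule simple_functionD)
    have 1: "trig_approx (\<lambda>x. \<Sum>y\<in>s i ` space torus. y * indicator (s i -` {y} \<inter> space torus) x)"
      by (intro trig_approx_sum trig_approx_cmult trig_approx_indicator fin simple_functionD(2)[OF s(1)])
    show ?thesis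
    proof (rule trig_approx_cong_AE[OF 1])
      show "s i \<in> borel_measurable torus" using s(1) by (rule borel_measurable_simple_function)
      show "AE x in torus. (\<Sum>y\<in>s i ` space torus. y * indicator (s i -` {y} \<inter> space torus) x) = s i x"
      proof (rule AE_I2)
        fix x assume x: "x \<in> space torus"
        have "(\<Sum>y\<in>s i ` space torus. y * indicator (s i -` {y} \<inter> space torus) x)
            = (\<Sum>y\<in>s i ` space torus. if s i x = y then y else 0)"
          by (rule sum.cong) (use x in \<open>simp_all add: indicator_def\<close>)
        then show "(\<Sum>y\<in>s i ` space torus. y * indicator (s i -` {y} \<inter> space torus) x) = s i x"
          using x fin by (subst (asm) sum.delta') (simp_all del: space_torus)
      qed
    qed
  qed
  \<comment> \<open>The simple functions satisfy \<open>|s| \<le> 2 |f|\<close>, hence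
    \<open>|f - s| \<le> 3 |f|\<close>; this is the factor 9.\<close>
  show ?thesis
  proof (rule trig_approx_lim[OF ds f, where w="\<lambda>x. 9 * (cmod (f x))\<^sup>2"])
    show "AE x in torus. (\<lambda>n. s n x) \<longlonglongrightarrow> f x" by (rule AE_I2) (rule s(2))
    show "integrable torus (\<lambda>x. 9 * (cmod (f x))\<^sup>2)"
      using cL2_norm_sq_integrable[OF f] by simp
    show "AE x in torus. (cmod (f x - s n x))\<^sup>2 \<le> 9 * (cmod (f x))\<^sup>2" for n
    proof (rule AE_I2)
      fix x assume "x \<in> space torus"
      from s(3)[OF this, of n] have "cmod (f x - s n x) \<le> 3 * cmod (f x)"
        using norm_triangle_ineq4[of "f x" "s n x"] by (simp add: dist_norm)
      then have "(cmod (f x - s n x))\<^sup>2 \<le> (3 * cmod (f x))\<^sup>2" by (rule power_mono) simp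
      then show "(cmod (f x - s n x))\<^sup>2 \<le> 9 * (cmod (f x))\<^sup>2" by (simp add: power_mult_distrib)
    qed
  qed
qed

text \<open>Bessel's inequality bounds the finite sums from above. A trigonometric polynomial close
  to \<open>f\<close> shows that their supremum is not smaller than the norm, since the coefficients
  of \<open>f\<close> on its frequencies approximate at least as well.\<close>

theorem parseval:
  assumes f: "f \<in> cL2"
  shows "((\<lambda>k. (cmod (coef f k))\<^sup>2) has_sum (cL2_sqnorm f / vol)) UNIV"
proof -
  have bd: "(\<Sum>k\<in>F. (cmod (coef f k))\<^sup>2) \<le> cL2_sqnorm f / vol" if "finite F" for F
    using bessel[OF that f] by (simp add: field_simps)
  have s: "((\<lambda>k. (cmod (coef f k))\<^sup>2) has_sum (SUP F\<in>{F. finite F \<and> F \<subseteq> UNIV}. \<Sum>k\<in>F. (cmod (coef f k))\<^sup>2)) UNIV"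
    by (rule nonneg_bdd_above_has_sum) (use bd in \<open>auto intro!: bdd_aboveI2[where M="cL2_sqnorm f / vol"]\<close>)
  moreover have "(SUP F\<in>{F. finite F \<and> F \<subseteq> UNIV}. \<Sum>k\<in>F. (cmod (coef f k))\<^sup>2) = cL2_sqnorm f / vol"
  proof (rule cSup_eq_non_empty)
    fix y assume y: "\<And>z. z \<in> (\<lambda>F. \<Sum>k\<in>F. (cmod (coef f k))\<^sup>2) ` {F. finite F \<and> F \<subseteq> UNIV} \<Longrightarrow> z \<le> y"
    have "cL2_sqnorm f \<le> vol * y + e" if e: "e > 0" for e
    proof -
      obtain p where p: "p \<in> trig_polys" "cL2_sqnorm (\<lambda>x. f x - p x) < e"
        using trig_approx_cL2[OF f] e unfolding trig_approx_def by blast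
      obtain F c where F: "finite F" "p = (\<lambda>x. \<Sum>k\<in>F. c k * fmode k x)" using trig_polys_expand[OF p(1)] by blast
      have "cL2_sqnorm f - vol * (\<Sum>k\<in>F. (cmod (coef f k))\<^sup>2) \<le> cL2_sqnorm (\<lambda>x. f x - p x)"
        unfolding F(2) cL2_sqnorm_diff_sum_fmode[OF F(1) f] by (simp add: sum_nonneg)
      moreover have "vol * (\<Sum>k\<in>F. (cmod (coef f k))\<^sup>2) \<le> vol * y"
        using y[OF imageI[of F]] F(1) by (intro mult_left_mono) auto
      ultimately show ?thesis using p(2) by linarith
    qed
    then have "cL2_sqnorm f \<le> vol * y" by (rule field_le_epsilon)
    then show "cL2_sqnorm f / vol \<le> y" by (simp add: field_simps)
  qed (use bd in auto)
  ultimately show ?thesis by simp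
qed

text \<open>Polarisation of \<open>parseval\<close>: four squares with the factors 1, -1, \<i> and
  -\<i>. Unordered summability of the product series comes along with it.\<close>

theorem parseval_cL2_inner:
  assumes f: "f \<in> cL2" and g: "g \<in> cL2"
  shows "((\<lambda>k. coef f k * cnj (coef g k)) has_sum (cL2_inner f g / of_real vol)) UNIV"
proof -
  have pol: "z * cnj w = 1/4 * (of_real ((cmod (z + 1 * w))\<^sup>2) + (-1) * of_real ((cmod (z + (-1) * w))\<^sup>2)
      + \<i> * of_real ((cmod (z + \<i> * w))\<^sup>2) + (-\<i>) * of_real ((cmod (z + (-\<i>) * w))\<^sup>2))" for z w
    unfolding complex_norm_square by (simp add: algebra_simps)
  define h where "h c x = f x + c * g x" for c x
  have h: "h c \<in> cL2" for c unfolding h_def by (intro cL2_add cL2_cmult f g)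
  have hs: "((\<lambda>k. complex_of_real ((cmod (coef f k + c * coef g k))\<^sup>2)) has_sum of_real (cL2_sqnorm (h c) / vol)) UNIV" for c
  proof -
    have "coef (h c) k = coef f k + c * coef g k" for k
      unfolding h_def by (simp add: coef_add[OF f cL2_cmult[OF g]] coef_cmult)
    then show ?thesis using has_sum_of_real[OF parseval[OF h[of c]]] by (simp only:)
  qed
  have "((\<lambda>k. (of_real ((cmod (coef f k + 1 * coef g k))\<^sup>2) + (-1) * of_real ((cmod (coef f k + (-1) * coef g k))\<^sup>2)
      + \<i> * of_real ((cmod (coef f k + \<i> * coef g k))\<^sup>2) + (-\<i>) * of_real ((cmod (coef f k + (-\<i>) * coef g k))\<^sup>2)))
     has_sum (of_real (cL2_sqnorm (h 1) / vol) + (-1) * of_real (cL2_sqnorm (h (-1)) / vol)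
       + \<i> * of_real (cL2_sqnorm (h \<i>) / vol) + (-\<i>) * of_real (cL2_sqnorm (h (-\<i>)) / vol))) UNIV"
    by (intro has_sum_add has_sum_cmult_right hs)
  from has_sum_cmult_right[OF this, of "1/4"]
  have 1: "((\<lambda>k. coef f k * cnj (coef g k)) has_sum (1/4 * (of_real (cL2_sqnorm (h 1) / vol) + (-1) * of_real (cL2_sqnorm (h (-1)) / vol)
       + \<i> * of_real (cL2_sqnorm (h \<i>) / vol) + (-\<i>) * of_real (cL2_sqnorm (h (-\<i>)) / vol)))) UNIV"
    unfolding pol .
  have int: "integrable torus (\<lambda>x. complex_of_real ((cmod (h c x))\<^sup>2))" for c
    using cL2_norm_sq_integrable[OF h] by (rule integrable_of_real)
  have "cL2_inner f g = (\<integral>x. 1/4 * (of_real ((cmod (h 1 x))\<^sup>2) + (-1) * of_real ((cmod (h (-1) x))\<^sup>2)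
      + \<i> * of_real ((cmod (h \<i> x))\<^sup>2) + (-\<i>) * of_real ((cmod (h (-\<i>) x))\<^sup>2)) \<partial>torus)"
    unfolding cL2_inner_def pol h_def ..
  also have "\<dots> = 1/4 * ((\<integral>x. of_real ((cmod (h 1 x))\<^sup>2) \<partial>torus) + (-1) * (\<integral>x. of_real ((cmod (h (-1) x))\<^sup>2) \<partial>torus)
      + \<i> * (\<integral>x. of_real ((cmod (h \<i> x))\<^sup>2) \<partial>torus) + (-\<i>) * (\<integral>x. of_real ((cmod (h (-\<i>) x))\<^sup>2) \<partial>torus))"
    by (simp only: integral_mult_right_zero Bochner_Integration.integral_add int
        Bochner_Integration.integrable_add integrable_mult_right)
  also have "\<dots> = 1/4 * (of_real (cL2_sqnorm (h 1)) + (-1) * of_real (cL2_sqnorm (h (-1)))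
      + \<i> * of_real (cL2_sqnorm (h \<i>)) + (-\<i>) * of_real (cL2_sqnorm (h (-\<i>))))"
    unfolding cL2_sqnorm_def integral_complex_of_real by simp
  finally have e: "cL2_inner f g = 1/4 * (of_real (cL2_sqnorm (h 1)) + (-1) * of_real (cL2_sqnorm (h (-1)))
      + \<i> * of_real (cL2_sqnorm (h \<i>)) + (-\<i>) * of_real (cL2_sqnorm (h (-\<i>))))" .
  have "cL2_inner f g / of_real vol = 1/4 * (of_real (cL2_sqnorm (h 1) / vol) + (-1) * of_real (cL2_sqnorm (h (-1)) / vol)
       + \<i> * of_real (cL2_sqnorm (h \<i>) / vol) + (-\<i>) * of_real (cL2_sqnorm (h (-\<i>)) / vol))"
    by (simp only: e of_real_divide times_divide_eq_right add_divide_distrib[symmetric])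
  then show ?thesis using 1 by (simp only:)
qed

lemma coef_cnj_mult_fmode: "coef (\<lambda>x. cnj (g x) * fmode l x) p = cnj (coef g (l - p))"
proof -
  have "cL2_inner (\<lambda>x. cnj (g x) * fmode l x) (fmode p) = cnj (cL2_inner g (fmode (l - p)))"
  proof -
    have "cnj (cL2_inner g (fmode (l - p))) = (\<integral>x. cnj (g x) * fmode (l - p) x \<partial>torus)"
      unfolding cL2_inner_def by (simp flip: Bochner_Integration.integral_cnj)
    also have "\<dots> = cL2_inner (\<lambda>x. cnj (g x) * fmode l x) (fmode p)"
      unfolding cL2_inner_def fmode_cnj using fmode_add[of l "- p"] by (simp add: mult.assoc)
    finally show ?thesis by simp
  qed
  then show ?thesis by (simp add: coef_def)
qed

text \<open>Parseval's identity applied to \<open>f\<close> and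
  \<open>\<lambda>x. cnj (g x) * fmode l x\<close>, whose coefficient at \<open>p\<close> is the
  conjugate of \<open>coef g (l - p)\<close>. The product is in general only integrable, which
  suffices for its coefficients to make sense.\<close>

lemma coef_mult:
  assumes "f \<in> cL2" "g \<in> cL2"
  shows "((\<lambda>p. coef f p * coef g (l - p)) has_sum coef (\<lambda>x. f x * g x) l) UNIV"
proof -
  have "cL2_inner f (\<lambda>x. cnj (g x) * fmode l x) = cL2_inner (\<lambda>x. f x * g x) (fmode l)"
    by (simp add: cL2_inner_def mult.assoc)
  then show ?thesis
    using parseval_cL2_inner[OF assms(1) cL2_mult_fmode[OF cL2_cnj[OF assms(2)]], of l]
    by (simp add: coef_cnj_mult_fmode coef_def)
qed

subsection \<open>The Riesz--Fischer theorem and weak derivatives\<close>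

lemma cL2_sqnorm_sum_fmode_diff:
  assumes "finite G" "F \<subseteq> G"
  shows "cL2_sqnorm (\<lambda>x. (\<Sum>k\<in>G. c k * fmode k x) - (\<Sum>k\<in>F. c k * fmode k x)) = vol * (\<Sum>k\<in>G - F. (cmod (c k))\<^sup>2)"
proof -
  have "(\<lambda>x. (\<Sum>k\<in>G. c k * fmode k x) - (\<Sum>k\<in>F. c k * fmode k x)) = (\<lambda>x. \<Sum>k\<in>G - F. c k * fmode k x)"
    using assms by (simp add: sum_diff)
  then show ?thesis using cL2_sqnorm_sum_fmode[of "G - F" c] assms by simp
qed

text \<open>The limit is built as an almost everywhere limit of rapidly converging partial sums, so
  that a concrete function results which is periodic at every point.\<close>

theorem riesz_fischer:
  assumes sm: "(\<lambda>k. (cmod (c k))\<^sup>2) summable_on UNIV"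
  obtains g where "g \<in> cL2" "periodic g" "\<And>k. coef g k = c k"
proof -
  let ?a = "\<lambda>k. (cmod (c k))\<^sup>2"
  define S where "S = (\<Sum>\<^sub>\<infinity>k. ?a k)"
  have hs: "(?a has_sum S) UNIV" using sm by (simp add: S_def)
  \<comment> \<open>Squared tails below \<open>(1/4)^n\<close> make consecutive partial sums differ
    by order \<open>(1/2)^n\<close> in norm, which is summable.\<close>
  have "\<exists>F. finite F \<and> S - (\<Sum>k\<in>F. ?a k) < (1/4)^n" for n
  proof -
    have "(0::real) < (1/4)^n" by simp
    from has_sum_finite_approximation[OF hs, of "(1/4)^n / 2"] obtain F where 
      "finite F" "dist (sum ?a F) S \<le> (1/4)^n / 2" by auto
    moreover have "(1/4)^n / 2 < (1/4::real)^n" by simp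
    moreover have "S - sum ?a F \<le> dist (sum ?a F) S" by (simp add: dist_real_def)
    ultimately show ?thesis by (intro exI[of _ F]) linarith
  qed
  then obtain F0 where F0: "\<And>n. finite (F0 n)" "\<And>n. S - (\<Sum>k\<in>F0 n. ?a k) < (1/4)^n" by metis
  define F where "F n = (\<Union>i\<le>n. F0 i)" for n
  have Ffin: "finite (F n)" for n by (simp add: F_def F0)
  have Fmono: "F n \<subseteq> F m" if "n \<le> m" for n m
    unfolding F_def using that by (intro UN_mono) auto
  have le_S: "(\<Sum>k\<in>G. ?a k) \<le> S" if "finite G" for G
    unfolding S_def using that by (intro finite_sum_le_infsum sm) auto
  have out: "(\<Sum>k\<in>G - F n. ?a k) < (1/4)^n" if "finite G" for G n
  proof -
    have "(\<Sum>k\<in>F0 n. ?a k) + (\<Sum>k\<in>G - F n. ?a k) = (\<Sum>k\<in>F0 n \<union> (G - F n). ?a k)"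
      by (rule sum.union_disjoint[symmetric]) (use F0 that in \<open>auto simp: F_def\<close>)
    also have "\<dots> \<le> S" using that F0 by (intro le_S) auto
    finally show ?thesis using F0(2)[of n] by linarith
  qed
  define s where "s n x = (\<Sum>k\<in>F n. c k * fmode k x)" for n x
  have sL: "s n \<in> cL2" for n
    unfolding s_def[abs_def] using Ffin by (intro cL2_sum cL2_cmult cL2_fmode)
  have sd: "cL2_sqnorm (\<lambda>x. s m x - s n x) \<le> vol * (1/4)^n" if "n \<le> m" for m n
    unfolding s_def cL2_sqnorm_sum_fmode_diff[OF Ffin Fmono[OF that]]
    using out[OF Ffin[of m], of n] by (intro mult_left_mono) auto
  define d where "d n x = s (Suc n) x - s n x" for n x
  have dL: "d n \<in> cL2" for n unfolding d_def[abs_def] by (intro cL2_diff sL)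
  \<comment> \<open>The inequality \<open>t \<le> 2^n * t^2 + (1/2)^n\<close> trades the square norm
    for the first-power norm on a space of finite measure; both contributions come out as
    \<open>vol * (1/2)^n\<close>.\<close>
  have d1: "(\<integral>x. cmod (d n x) \<partial>torus) \<le> 2 * vol * (1/2)^n" for n
  proof -
    have "(\<integral>x. cmod (d n x) \<partial>torus) \<le> (\<integral>x. 2^n * (cmod (d n x))\<^sup>2 + (1/2)^n \<partial>torus)"
    proof (rule integral_mono)
      show "integrable torus (\<lambda>x. cmod (d n x))" using cL2_integrable[OF dL] by (rule integrable_norm)
      show "integrable torus (\<lambda>x. 2^n * (cmod (d n x))\<^sup>2 + (1/2)^n)"
        using cL2_norm_sq_integrable[OF dL[of n]] by simp
      fix x
      let ?t = "cmod (d n x)"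
      have "0 \<le> (2^n * ?t - 1)\<^sup>2 + 2^n * ?t * 0" by simp
      then have "2 * (2^n * ?t) \<le> (2^n * ?t)\<^sup>2 + 1" by (simp add: power2_diff)
      moreover have "0 \<le> 2^n * ?t" by simp
      ultimately have "2^n * ?t \<le> (2^n * ?t)\<^sup>2 + 1" by linarith
      then have "2^n * ?t \<le> 2^n * (2^n * ?t\<^sup>2 + (1/2)^n)"
        by (simp add: power_mult_distrib distrib_left power2_eq_square power_one_over mult_ac)
      then show "?t \<le> 2^n * ?t\<^sup>2 + (1/2)^n" by (rule mult_left_le_imp_le) simp
    qed
    also have "\<dots> = 2^n * cL2_sqnorm (d n) + vol * (1/2)^n"
      using cL2_norm_sq_integrable[OF dL[of n]] by (simp add: cL2_sqnorm_def)
    also have "2^n * cL2_sqnorm (d n) \<le> 2^n * (vol * (1/4)^n)"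
      unfolding d_def[abs_def] by (intro mult_left_mono sd) auto
    also have "2^n * (vol * (1/4)^n) = vol * (1/2)^n"
    proof -
      have "(2::real)^n * (1/4)^n = (2 * (1/4))^n" by (simp only: power_mult_distrib)
      then show ?thesis by (simp add: mult.left_commute)
    qed
    finally show ?thesis by simp
  qed
  have ae: "AE x in torus. summable (\<lambda>n. cmod (d n x))"
  proof -
    have m: "(\<lambda>x. ennreal (cmod (d n x))) \<in> borel_measurable torus" for n
      using cL2_measurable[OF dL] by measurable
    have "(\<integral>\<^sup>+x. (\<Sum>n. ennreal (cmod (d n x))) \<partial>torus) = (\<Sum>n. \<integral>\<^sup>+x. ennreal (cmod (d n x)) \<partial>torus)"
      using m by (rule nn_integral_suminf)
    also have "\<dots> \<le> (\<Sum>n. ennreal (2 * vol * (1/2)^n))"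
    proof (intro suminf_le allI)
      fix n
      have "(\<integral>\<^sup>+x. ennreal (cmod (d n x)) \<partial>torus) = ennreal (\<integral>x. cmod (d n x) \<partial>torus)"
        using cL2_integrable[OF dL] by (intro nn_integral_eq_integral integrable_norm) auto
      also have "\<dots> \<le> ennreal (2 * vol * (1/2)^n)" by (intro ennreal_leI d1)
      finally show "(\<integral>\<^sup>+x. ennreal (cmod (d n x)) \<partial>torus) \<le> ennreal (2 * vol * (1/2)^n)" .
    qed auto
    also have "\<dots> = ennreal (\<Sum>n. 2 * vol * (1/2)^n)"
      by (intro suminf_ennreal2) (auto intro!: summable_mult summable_geometric)
    also have "\<dots> < \<infinity>" by simp
    finally have "(\<integral>\<^sup>+x. (\<Sum>n. ennreal (cmod (d n x))) \<partial>torus) \<noteq> \<infinity>" by simp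
    moreover have "(\<lambda>x. \<Sum>n. ennreal (cmod (d n x))) \<in> borel_measurable torus" using m by measurable
    ultimately have "AE x in torus. (\<Sum>n. ennreal (cmod (d n x))) \<noteq> \<infinity>"
      by (intro nn_integral_PInf_AE)
    then show ?thesis
      by (rule AE_mp) (auto intro!: AE_I2 summable_suminf_not_top)
  qed
  \<comment> \<open>\<open>lim\<close> assigns the same value to identical sequences even where they
    diverge, so periodicity of the partial sums passes to \<open>g\<close> at every point.\<close>
  define g where "g x = lim (\<lambda>n. s n x)" for x
  have conv: "AE x in torus. (\<lambda>n. s n x) \<longlonglongrightarrow> g x"
    using ae
  proof (rule AE_mp, intro AE_I2 impI)
    fix x assume "summable (\<lambda>n. cmod (d n x))"
    then have "summable (\<lambda>n. d n x)" by (rule summable_norm_cancel)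
    then have "(\<lambda>n. \<Sum>i<n. d i x) \<longlonglongrightarrow> (\<Sum>i. d i x)" by (rule summable_LIMSEQ)
    moreover have "(\<Sum>i<n. d i x) = s n x - s 0 x" for n
      unfolding d_def by (rule sum_lessThan_telescope)
    ultimately have "(\<lambda>n. s n x - s 0 x) \<longlonglongrightarrow> (\<Sum>i. d i x)" by simp
    from tendsto_add[OF this tendsto_const[of "s 0 x"]] have "convergent (\<lambda>n. s n x)"
      by (simp add: convergent_def) blast
    then show "(\<lambda>n. s n x) \<longlonglongrightarrow> g x" by (simp add: g_def convergent_LIMSEQ_iff)
  qed
  have gm: "g \<in> borel_measurable torus"
    unfolding g_def[abs_def] by (intro borel_measurable_lim_metric cL2_measurable sL)
  \<comment> \<open>Fatou's lemma turns the Cauchy estimate into a bound for the distance to the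
    limit, which also yields square integrability of \<open>g\<close>.\<close>
  have fatou: "(\<integral>\<^sup>+x. ennreal ((cmod (g x - s n x))\<^sup>2) \<partial>torus) \<le> ennreal (vol * (1/4)^n)" for n
  proof -
    have "(\<integral>\<^sup>+x. ennreal ((cmod (g x - s n x))\<^sup>2) \<partial>torus)
        = (\<integral>\<^sup>+x. liminf (\<lambda>m. ennreal ((cmod (s m x - s n x))\<^sup>2)) \<partial>torus)"
    proof (rule nn_integral_cong_AE, rule AE_mp[OF conv], intro AE_I2 impI)
      fix x assume "(\<lambda>n. s n x) \<longlonglongrightarrow> g x"
      then have "(\<lambda>m. ennreal ((cmod (s m x - s n x))\<^sup>2)) \<longlonglongrightarrow> ennreal ((cmod (g x - s n x))\<^sup>2)"
        by (intro tendsto_intros)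
      then show "ennreal ((cmod (g x - s n x))\<^sup>2) = liminf (\<lambda>m. ennreal ((cmod (s m x - s n x))\<^sup>2))"
        using lim_imp_Liminf[OF sequentially_bot] by metis
    qed
    also have "\<dots> \<le> liminf (\<lambda>m. \<integral>\<^sup>+x. ennreal ((cmod (s m x - s n x))\<^sup>2) \<partial>torus)"
      using cL2_measurable[OF sL] by (intro nn_integral_liminf) measurable
    also have "\<dots> \<le> liminf (\<lambda>m. ennreal (vol * (1/4)^n))"
    proof (rule Liminf_mono, rule eventually_sequentiallyI[of n])
      fix m assume "n \<le> m"
      have "(\<integral>\<^sup>+x. ennreal ((cmod (s m x - s n x))\<^sup>2) \<partial>torus) = ennreal (cL2_sqnorm (\<lambda>x. s m x - s n x))"
        unfolding cL2_sqnorm_def by (intro nn_integral_eq_integral cL2_norm_sq_integrable cL2_diff sL) auto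
      also have "\<dots> \<le> ennreal (vol * (1/4)^n)" by (intro ennreal_leI sd \<open>n \<le> m\<close>)
      finally show "(\<integral>\<^sup>+x. ennreal ((cmod (s m x - s n x))\<^sup>2) \<partial>torus) \<le> ennreal (vol * (1/4)^n)" .
    qed
    also have "\<dots> = ennreal (vol * (1/4)^n)" by (simp add: Liminf_const)
    finally show ?thesis .
  qed
  have gsL: "(\<lambda>x. g x - s n x) \<in> cL2" for n
  proof -
    have m: "(\<lambda>x. g x - s n x) \<in> borel_measurable torus"
      using gm cL2_measurable[OF sL] by measurable
    have "integrable torus (\<lambda>x. (cmod (g x - s n x))\<^sup>2)"
      using fatou[of n] m by (intro integrableI_nonneg) (auto simp: order_le_less_trans[OF fatou])
    then show ?thesis using m by (simp add: cL2_def)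
  qed
  have sqg: "cL2_sqnorm (\<lambda>x. g x - s n x) \<le> vol * (1/4)^n" for n
  proof -
    have "ennreal (cL2_sqnorm (\<lambda>x. g x - s n x)) \<le> ennreal (vol * (1/4)^n)"
      using fatou[of n] unfolding cL2_sqnorm_def
      by (subst (asm) nn_integral_eq_integral) (auto intro: cL2_norm_sq_integrable gsL)
    then show ?thesis by (subst (asm) ennreal_le_iff) auto
  qed
  have gL: "g \<in> cL2" using cL2_add[OF gsL[of 0] sL[of 0]] by simp
  have "coef g k = c k" for k
  proof -
    have b: "(cmod (coef g k - c k))\<^sup>2 \<le> 4 * (1/4)^n" for n
    proof -
      have "coef g k - c k = coef (\<lambda>x. g x - s n x) k + (coef (s n) k - c k)"
        using coef_diff[OF gL sL[of n]] by simp
      then have "(cmod (coef g k - c k))\<^sup>2 \<le> 2 * (cmod (coef (\<lambda>x. g x - s n x) k))\<^sup>2 + 2 * (cmod (coef (s n) k - c k))\<^sup>2"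
        using cmod_add_sq_le by metis
      moreover have "(cmod (coef (\<lambda>x. g x - s n x) k))\<^sup>2 \<le> (1/4)^n"
      proof -
        have "vol * (cmod (coef (\<lambda>x. g x - s n x) k))\<^sup>2 \<le> vol * (1/4)^n"
          using order_trans[OF bessel[of "{k}", OF _ gsL[of n]] sqg[of n]] by simp
        then show ?thesis using vol_pos by (rule mult_left_le_imp_le)
      qed
      moreover have "(cmod (coef (s n) k - c k))\<^sup>2 \<le> (1/4)^n"
        unfolding s_def coef_sum_fmode[OF Ffin] using out[of "{k}" n] by (cases "k \<in> F n") (simp_all add: less_imp_le insert_Diff_if)
      ultimately show ?thesis by linarith
    qed
    have "(\<lambda>n. 4 * (1/4::real)^n) \<longlonglongrightarrow> 4 * 0" by (intro tendsto_intros) auto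
    then have "(cmod (coef g k - c k))\<^sup>2 \<le> 4 * 0"
      by (rule LIMSEQ_le_const) (use b in blast)
    then show ?thesis by simp
  qed
  moreover have "periodic g"
    using periodic_fmode by (simp add: periodic_def g_def s_def)
  ultimately show ?thesis using that gL by blast
qed

section \<open>Real vector fields, their components and weak derivatives\<close>

definition component :: "field \<Rightarrow> 3 \<Rightarrow> real^3 \<Rightarrow> complex" where
  "component f i x = of_real (f x $ i)"

lemma fourier_coeff_component: "fourier_coeff f k $ i = coef (component f i) k"
  by (simp add: fourier_coeff_def coef_def cL2_inner_def component_def fmode_def cis_conv_exp exp_cnj)

lemma measurable_nth: "f \<in> borel_measurable M \<Longrightarrow> (\<lambda>x. f x $ i) \<in> borel_measurable M"
  for f :: "'a \<Rightarrow> real^'n"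
  by (rule measurable_compose[OF _ borel_measurable_continuous_onI]) (auto intro: continuous_intros)

lemma L2_component:
  assumes "f \<in> L2"
  shows "component f i \<in> cL2"
proof -
  have m: "(\<lambda>x. f x $ i) \<in> borel_measurable torus" using assms by (intro measurable_nth) (simp add: L2_def)
  have "integrable torus (\<lambda>x. (cmod (component f i x))\<^sup>2)"
  proof (rule Bochner_Integration.integrable_bound)
    show "integrable torus (\<lambda>x. (norm (f x))\<^sup>2)" using assms by (simp add: L2_def)
    show "(\<lambda>x. (cmod (component f i x))\<^sup>2) \<in> borel_measurable torus" using m unfolding component_def by measurable
    show "AE x in torus. norm ((cmod (component f i x))\<^sup>2) \<le> norm ((norm (f x))\<^sup>2)"
    proof (rule AE_I2)
      fix x
      have "\<bar>f x $ i\<bar>\<^sup>2 \<le> (norm (f x))\<^sup>2" by (intro power_mono component_le_norm_cart abs_ge_zero)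
      then show "norm ((cmod (component f i x))\<^sup>2) \<le> norm ((norm (f x))\<^sup>2)" by (simp add: component_def)
    qed
  qed
  then show ?thesis using m unfolding cL2_def component_def by simp
qed

lemma measurable_vecI:
  fixes f :: "'a \<Rightarrow> real^'n"
  assumes "\<And>i. (\<lambda>x. f x $ i) \<in> borel_measurable M"
  shows "f \<in> borel_measurable M"
  by (subst borel_measurable_euclidean_space) (use assms in \<open>auto simp: Basis_vec_def inner_axis\<close>)

lemma norm_vec_sq: "(norm (v::real^3))\<^sup>2 = (\<Sum>i\<in>UNIV. (v $ i)\<^sup>2)"
  by (simp add: norm_vec_def L2_set_def sum_nonneg)

lemma L2I:
  assumes "periodic f" "\<And>i. (\<lambda>x. f x $ i) \<in> borel_measurable torus" "\<And>i. integrable torus (\<lambda>x. (f x $ i)\<^sup>2)"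
  shows "f \<in> L2"
  using assms measurable_vecI[of f torus] unfolding L2_def norm_vec_sq by simp

lemma L2_scaled_integrable:
  fixes \<eta> :: "real^3 \<Rightarrow> real"
  assumes f: "f \<in> L2" and c: "continuous_on UNIV \<eta>"
  shows "integrable torus (\<lambda>x. \<eta> x *\<^sub>R f x)"
proof (rule Bochner_Integration.integrable_bound)
  show "integrable torus (\<lambda>x. (\<eta> x)\<^sup>2 + (norm (f x))\<^sup>2)"
    by (rule Bochner_Integration.integrable_add[OF torus_integrable_continuous[OF continuous_on_power[OF c]]])
      (use f in \<open>simp add: L2_def\<close>)
  have "\<eta> \<in> borel_measurable torus" using torus_integrable_continuous[OF c] by simp
  then show "(\<lambda>x. \<eta> x *\<^sub>R f x) \<in> borel_measurable torus"
    by (rule borel_measurable_scaleR) (use f in \<open>simp add: L2_def\<close>)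
  show "AE x in torus. norm (\<eta> x *\<^sub>R f x) \<le> norm ((\<eta> x)\<^sup>2 + (norm (f x))\<^sup>2)"
  proof (rule AE_I2)
    fix x
    have "2 * (\<bar>\<eta> x\<bar> * norm (f x)) \<le> (\<eta> x)\<^sup>2 + (norm (f x))\<^sup>2"
      using sum_squares_bound[of "\<bar>\<eta> x\<bar>" "norm (f x)"] by simp
    moreover have "0 \<le> \<bar>\<eta> x\<bar> * norm (f x)" by simp
    ultimately have "\<bar>\<eta> x\<bar> * norm (f x) \<le> (\<eta> x)\<^sup>2 + (norm (f x))\<^sup>2" by linarith
    then show "norm (\<eta> x *\<^sub>R f x) \<le> norm ((\<eta> x)\<^sup>2 + (norm (f x))\<^sup>2)" by simp
  qed
qed

lemma integral_nth:
  fixes f :: "real^3 \<Rightarrow> real^3"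
  shows "integrable M f \<Longrightarrow> (\<integral>x. f x \<partial>M) $ j = (\<integral>x. f x $ j \<partial>M)"
  using integral_bounded_linear[OF bounded_linear_vec_nth] by metis

lemma integrable_nth:
  fixes f :: "real^3 \<Rightarrow> real^3"
  shows "integrable M f \<Longrightarrow> integrable M (\<lambda>x. f x $ j)"
  by (rule integrable_bounded_linear[OF bounded_linear_vec_nth])

lemma trig_measurable [measurable]: "trig k \<theta> \<in> borel_measurable torus"
  using torus_integrable_continuous[OF trig_continuous] by simp

lemma integrable_times_trig:
  fixes h :: "real^3 \<Rightarrow> real"
  assumes "integrable torus h"
  shows "integrable torus (\<lambda>x. h x * trig k \<theta> x)"
proof (rule Bochner_Integration.integrable_bound[OF assms])
  show "(\<lambda>x. h x * trig k \<theta> x) \<in> borel_measurable torus" using assms by measurable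
  show "AE x in torus. norm (h x * trig k \<theta> x) \<le> norm (h x)"
    by (rule AE_I2) (simp add: abs_mult abs_trig_le mult_left_le)
qed

text \<open>The conjugated mode is \<open>cos - \<i> sin\<close>, and the phase
  \<open>pi / 2\<close> produces exactly \<open>- sin\<close>; thus real and imaginary parts
  correspond to the phases 0 and \<open>pi / 2\<close>.\<close>

lemma coef_real:
  fixes h :: "real^3 \<Rightarrow> real"
  assumes "integrable torus h"
  shows "coef (\<lambda>x. of_real (h x)) k
    = Complex (\<integral>x. h x * trig k 0 x \<partial>torus) (\<integral>x. h x * trig k (pi / 2) x \<partial>torus) / of_real vol"
proof -
  have i: "integrable torus (\<lambda>x. complex_of_real (h x) * cnj (fmode k x))"
  proof (rule Bochner_Integration.integrable_bound[OF assms])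
    have "(\<lambda>x. cnj (fmode k x)) \<in> borel_measurable torus" unfolding fmode_cnj by (rule fmode_borel)
    then show "(\<lambda>x. complex_of_real (h x) * cnj (fmode k x)) \<in> borel_measurable torus" using assms by measurable
  qed (auto simp: norm_mult)
  have "Re (cL2_inner (\<lambda>x. of_real (h x)) (fmode k)) = (\<integral>x. h x * trig k 0 x \<partial>torus)"
    unfolding cL2_inner_def integral_Re[OF i, symmetric] by (simp add: fmode_trig)
  moreover have "Im (cL2_inner (\<lambda>x. of_real (h x)) (fmode k)) = (\<integral>x. h x * trig k (pi / 2) x \<partial>torus)"
    unfolding cL2_inner_def integral_Im[OF i, symmetric] by (simp add: fmode_trig)
  ultimately show ?thesis by (simp add: coef_def complex_eq_iff)
qed

lemma trig_pi: "trig k (\<theta> + pi / 2 + pi / 2) x = - trig k \<theta> x"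
  by (simp add: trig_def add.assoc[symmetric] cos_add)

lemma integral_pd_trig:
  fixes \<eta> :: "real^3 \<Rightarrow> real"
  assumes "smooth \<eta>" "periodic \<eta>"
  shows "(\<integral>x. pd i \<eta> x * trig k \<theta> x \<partial>torus) = - of_int (k $ i) * (\<integral>x. \<eta> x * trig k (\<theta> + pi / 2) x \<partial>torus)"
proof -
  have "(\<integral>x. pd i \<eta> x * trig k \<theta> x \<partial>torus) = - (\<integral>x. of_int (k $ i) * (\<eta> x * trig k (\<theta> + pi / 2) x) \<partial>torus)"
    using integral_by_parts_torus[OF assms(1) smooth_trig assms(2) periodic_trig, of i k \<theta>]
    unfolding pd_trig by (simp add: mult.left_commute)
  then show ?thesis by simp
qed

lemma coef_pd:
  fixes \<eta> :: "real^3 \<Rightarrow> real"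
  assumes "smooth \<eta>" "periodic \<eta>"
  shows "coef (\<lambda>x. of_real (pd i \<eta> x)) k = \<i> * of_int (k $ i) * coef (\<lambda>x. of_real (\<eta> x)) k"
proof -
  note parts = integral_pd_trig[OF assms]
  have i: "integrable torus (pd i \<eta>)" "integrable torus \<eta>"
    by (intro torus_integrable_continuous smooth_continuous smooth_pd assms)+
  have "(\<integral>x. \<eta> x * trig k (0 + pi / 2 + pi / 2) x \<partial>torus) = - (\<integral>x. \<eta> x * trig k 0 x \<partial>torus)"
    unfolding trig_pi by simp
  then show ?thesis
    unfolding coef_real[OF i(1)] coef_real[OF i(2)] parts by (simp add: complex_eq_iff)
qed

text \<open>The Riesz-Fischer theorem supplies functions with the coefficients expected of the
  derivative, and Parseval's identity moves the derivative from the test function onto them.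
  Existence is what licenses reasoning about \<open>weak_pd\<close>, which is defined by
  choice.\<close>

lemma has_weak_pd_exists:
  assumes f: "f \<in> L2" and sm: "\<And>j. (\<lambda>k. (of_int (k $ i))\<^sup>2 * (cmod (coef (component f j) k))\<^sup>2) summable_on UNIV"
  shows "has_weak_pd i f (weak_pd i f)"
proof -
  have "\<exists>g. g \<in> cL2 \<and> periodic g \<and> (\<forall>k. coef g k = \<i> * of_int (k $ i) * coef (component f j) k)" for j
  proof -
    have "(\<lambda>k. (cmod (\<i> * of_int (k $ i) * coef (component f j) k))\<^sup>2) summable_on UNIV"
      using sm[of j] by (simp add: norm_mult power_mult_distrib)
    from riesz_fischer[OF this] show ?thesis by metis
  qed
  then obtain G where G: "\<And>j. G j \<in> cL2" "\<And>j. periodic (G j)"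
    "\<And>j k. coef (G j) k = \<i> * of_int (k $ i) * coef (component f j) k" by metis
  \<comment> \<open>The functions \<open>G j\<close> are complex valued. Taking real parts is
    harmless: the test function is real, and the other side of the identity is real as well.\<close>
  define g :: field where "g x = (\<chi> j. Re (G j x))" for x
  have gm: "(\<lambda>x. g x $ j) \<in> borel_measurable torus" for j
    using cL2_measurable[OF G(1)] by (simp add: g_def)
  have gL2: "g \<in> L2"
  proof (rule L2I)
    show "periodic g" using G(2) by (simp add: periodic_def g_def)
    show "integrable torus (\<lambda>x. (g x $ j)\<^sup>2)" for j
    proof (rule Bochner_Integration.integrable_bound[OF cL2_norm_sq_integrable[OF G(1)[of j]]])
      show "(\<lambda>x. (g x $ j)\<^sup>2) \<in> borel_measurable torus" using gm by measurable
      show "AE x in torus. norm ((g x $ j)\<^sup>2) \<le> norm ((cmod (G j x))\<^sup>2)"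
        by (rule AE_I2) (simp add: g_def cmod_power2)
    qed
  qed (rule gm)
  have "has_weak_pd i f g"
    unfolding has_weak_pd_def
  proof (intro conjI gL2 allI impI)
    fix \<eta> :: "real^3 \<Rightarrow> real" assume "smooth \<eta> \<and> periodic \<eta>"
    then have \<eta>: "smooth \<eta>" "periodic \<eta>" by auto
    define e where "e x = complex_of_real (\<eta> x)" for x
    define e' where "e' x = complex_of_real (pd i \<eta> x)" for x
    have ce: "continuous_on UNIV \<eta>" "continuous_on UNIV (pd i \<eta>)" 
      by (intro smooth_continuous smooth_pd \<eta>)+
    have cc: "h \<in> cL2" if "continuous_on UNIV h" for h
    proof -
      have "integrable torus (\<lambda>x. (cmod (h x))\<^sup>2)" "integrable torus h"
        by (rule torus_integrable_continuous, intro continuous_intros that)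
          (rule torus_integrable_continuous[OF that])
      then show ?thesis by (simp add: cL2_def)
    qed
    have eL: "e \<in> cL2" "e' \<in> cL2" unfolding e_def[abs_def] e'_def[abs_def]
      by (intro cc continuous_intros ce)+
    have "(\<integral>x. pd i \<eta> x * f x $ j \<partial>torus) = - (\<integral>x. \<eta> x * g x $ j \<partial>torus)" for j
    proof -
      have "((\<lambda>k. coef (component f j) k * cnj (coef e' k)) has_sum (cL2_inner (component f j) e' / of_real vol)) UNIV"
        by (rule parseval_cL2_inner[OF L2_component[OF f] eL(2)])
      moreover have "coef (component f j) k * cnj (coef e' k) = - (coef (G j) k * cnj (coef e k))" for k
        unfolding e'_def[abs_def] coef_pd[OF \<eta>] e_def[abs_def] G(3) by simp
      ultimately have "((\<lambda>k. - (coef (G j) k * cnj (coef e k))) has_sum (cL2_inner (component f j) e' / of_real vol)) UNIV"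
        by simp
      moreover have "((\<lambda>k. - (coef (G j) k * cnj (coef e k))) has_sum - (cL2_inner (G j) e / of_real vol)) UNIV"
        using parseval_cL2_inner[OF G(1) eL(1), of j] by (simp add: has_sum_uminus)
      ultimately have "cL2_inner (component f j) e' / of_real vol = - (cL2_inner (G j) e / of_real vol)"
        by (rule has_sum_unique)
      then have ipe: "cL2_inner (component f j) e' = - cL2_inner (G j) e" by (simp add: field_simps)
      have "cL2_inner (component f j) e' = of_real (\<integral>x. pd i \<eta> x * f x $ j \<partial>torus)"
        unfolding cL2_inner_def component_def e'_def by (simp flip: integral_complex_of_real add: mult.commute)
      moreover have "Re (cL2_inner (G j) e) = (\<integral>x. \<eta> x * g x $ j \<partial>torus)"
        unfolding cL2_inner_def integral_Re[OF cL2_inner_integrable[OF G(1) eL(1)], symmetric]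
        by (simp add: e_def g_def mult.commute)
      ultimately show ?thesis using ipe by (metis Re_complex_of_real uminus_complex.sel(1))
    qed
    then show "(\<integral>x. pd i \<eta> x *\<^sub>R f x \<partial>torus) = - (\<integral>x. \<eta> x *\<^sub>R g x \<partial>torus)"
      by (simp add: vec_eq_iff integral_nth L2_scaled_integrable f gL2 ce)
  qed
  then show ?thesis unfolding weak_pd_def by (rule someI[where P="has_weak_pd i f"])
qed

lemma L2_nth_integrable: "f \<in> L2 \<Longrightarrow> integrable torus (\<lambda>x. f x $ j)"
  using integrable_nth[OF L2_scaled_integrable[of f "\<lambda>_. 1"]] by simp

lemma has_weak_pd_trig:
  assumes "f \<in> L2" "has_weak_pd i f g"
  shows "(\<integral>x. g x $ j * trig k \<theta> x \<partial>torus) = - of_int (k $ i) * (\<integral>x. f x $ j * trig k (\<theta> + pi / 2) x \<partial>torus)"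
proof -
  have gL: "g \<in> L2" and e: "(\<integral>x. pd i (trig k \<theta>) x *\<^sub>R f x \<partial>torus) = - (\<integral>x. trig k \<theta> x *\<^sub>R g x \<partial>torus)"
    using assms(2) smooth_trig periodic_trig unfolding has_weak_pd_def by blast+
  have "(\<integral>x. pd i (trig k \<theta>) x *\<^sub>R f x \<partial>torus) $ j = - (\<integral>x. trig k \<theta> x *\<^sub>R g x \<partial>torus) $ j"
    unfolding e by simp
  then have "(\<integral>x. pd i (trig k \<theta>) x * f x $ j \<partial>torus) = - (\<integral>x. trig k \<theta> x * g x $ j \<partial>torus)"
    by (simp add: integral_nth L2_scaled_integrable assms gL trig_continuous smooth_continuous smooth_pd smooth_trig)
  moreover have "pd i (trig k \<theta>) x * f x $ j = of_int (k $ i) * (f x $ j * trig k (\<theta> + pi / 2) x)" for x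
    by (simp add: pd_trig)
  ultimately have "of_int (k $ i) * (\<integral>x. f x $ j * trig k (\<theta> + pi / 2) x \<partial>torus) = - (\<integral>x. trig k \<theta> x * g x $ j \<partial>torus)"
    by simp
  then show ?thesis by (simp add: mult.commute)
qed

text \<open>Testing with the real modes recovers the coefficients, so every weak derivative has the
  same ones, whichever representative was chosen.\<close>

lemma has_weak_pd_coef:
  assumes "f \<in> L2" "has_weak_pd i f g"
  shows "coef (component g j) k = \<i> * of_int (k $ i) * coef (component f j) k"
proof -
  have gL: "g \<in> L2" using assms(2) by (simp add: has_weak_pd_def)
  have "(\<integral>x. f x $ j * trig k (0 + pi / 2 + pi / 2) x \<partial>torus) = - (\<integral>x. f x $ j * trig k 0 x \<partial>torus)"
    unfolding trig_pi by simp
  then show ?thesis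
    unfolding component_def[abs_def] coef_real[OF L2_nth_integrable[OF gL]] coef_real[OF L2_nth_integrable[OF assms(1)]]
      has_weak_pd_trig[OF assms] by (simp add: complex_eq_iff)
qed

subsection \<open>Lattice sums\<close>

text \<open>The maximum norm makes counting exact: its balls are cubes with
  \<open>(2 * n + 1) ^ 3\<close> lattice points.\<close>

definition freq_sup :: "int^3 \<Rightarrow> nat" where
  "freq_sup k = nat (max \<bar>k $ 1\<bar> (max \<bar>k $ 2\<bar> \<bar>k $ 3\<bar>))"

text \<open>Takes the place of \<open>(1 + |k|^2)^(1/2)\<close>, to which it is comparable.\<close>

definition bracket :: "int^3 \<Rightarrow> real" where "bracket k = 1 + real (freq_sup k)"

lemma freq_sup_le_iff: "freq_sup k \<le> n \<longleftrightarrow> (\<forall>i. \<bar>k $ i\<bar> \<le> int n)"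
  by (simp add: freq_sup_def forall_3 nat_le_iff)

lemma freq_sup_le_norm: "real (freq_sup k) \<le> norm (freq k)"
proof -
  have "real (freq_sup k) \<in> {\<bar>freq k $ 1\<bar>, \<bar>freq k $ 2\<bar>, \<bar>freq k $ 3\<bar>}"
    unfolding freq_sup_def by (simp add: max_def)
  then show ?thesis using component_le_norm_cart[of "freq k"] by auto
qed

lemma bracket_ge1: "1 \<le> bracket k" and bracket_pos: "0 < bracket k"
  by (simp_all add: bracket_def)

lemma freq_sup_ball: "finite {k. freq_sup k \<le> n}" "card {k. freq_sup k \<le> n} = (2 * n + 1) ^ 3"
proof -
  let ?I = "{- int n..int n}"
  have b: "bij_betw (\<lambda>k::int^3. (k $ 1, k $ 2, k $ 3)) {k. freq_sup k \<le> n} (?I \<times> ?I \<times> ?I)"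
  proof (rule bij_betw_byWitness[where f'="\<lambda>q. vector [fst q, fst (snd q), snd (snd q)]"])
    show "\<forall>k\<in>{k. freq_sup k \<le> n}. vector [fst (k $ 1, k $ 2, k $ 3), fst (snd (k $ 1, k $ 2, k $ 3)), snd (snd (k $ 1, k $ 2, k $ 3))] = k"
      by (simp add: vec_eq_iff forall_3)
    show "(\<lambda>k::int^3. (k $ 1, k $ 2, k $ 3)) ` {k. freq_sup k \<le> n} \<subseteq> ?I \<times> ?I \<times> ?I"
      by (auto simp: freq_sup_le_iff abs_le_iff minus_le_iff)
    show "(\<lambda>q. vector [fst q, fst (snd q), snd (snd q)] :: int^3) ` (?I \<times> ?I \<times> ?I) \<subseteq> {k. freq_sup k \<le> n}"
      by (auto simp: freq_sup_le_iff forall_3)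
  qed simp
  show "finite {k. freq_sup k \<le> n}" using bij_betw_finite[OF b] by simp
  show "card {k. freq_sup k \<le> n} = (2 * n + 1) ^ 3"
  proof -
    have "card ?I = 2 * n + 1" by (simp add: nat_add_distrib nat_mult_distrib)
    then show ?thesis using bij_betw_same_card[OF b] by (simp only: card_cartesian_product power3_eq_cube mult.assoc)
  qed
qed

text \<open>Summation by shells: the number of lattice points added is
  \<open>(2n+3)^3 - (2n+1)^3\<close>, which expands to the quadratic polynomial.\<close>

lemma freq_sup_ball_sum_Suc:
  fixes f :: "nat \<Rightarrow> real"
  shows "(\<Sum>k | freq_sup k \<le> Suc n. f (freq_sup k)) = (\<Sum>k | freq_sup k \<le> n. f (freq_sup k)) + (24 * real n^2 + 48 * real n + 26) * f (Suc n)"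
proof -
  let ?B = "\<lambda>n. {k. freq_sup k \<le> n}"
  let ?S = "?B (Suc n) - ?B n"
  have "(\<Sum>k\<in>?S. f (freq_sup k)) = (\<Sum>k\<in>?S. f (Suc n))"
    by (rule sum.cong) (auto simp: le_Suc_eq)
  also have "\<dots> = real (card ?S) * f (Suc n)" by simp
  also have "card ?S = (2 * Suc n + 1) ^ 3 - (2 * n + 1) ^ 3"
    by (subst card_Diff_subset) (auto simp: freq_sup_ball)
  also have "real ((2 * Suc n + 1) ^ 3 - (2 * n + 1) ^ 3) = 24 * real n^2 + 48 * real n + 26"
    by (subst of_nat_diff) (auto intro!: power_mono simp: power3_eq_cube power2_eq_square algebra_simps)
  finally have "(\<Sum>k\<in>?S. f (freq_sup k)) = (24 * real n^2 + 48 * real n + 26) * f (Suc n)" .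
  moreover have "(\<Sum>k\<in>?B (Suc n). f (freq_sup k)) = (\<Sum>k\<in>?B n. f (freq_sup k)) + (\<Sum>k\<in>?S. f (freq_sup k))"
    by (subst sum.subset_diff[of "?B n" "?B (Suc n)"]) (auto simp: freq_sup_ball)
  ultimately show ?thesis by simp
qed

lemma freq_sup_0_ball: "{k. freq_sup k \<le> 0} = {0}"
  unfolding freq_sup_le_iff by (auto simp: vec_eq_iff)

text \<open>The shell of radius \<open>n + 1\<close> has of order \<open>n^2\<close> points, each
  contributing of order \<open>1 / n\<close>, so the sum grows quadratically. The constant 26 is the
  size of the first shell and is large enough for the induction to close.\<close>

lemma bracket_sum1: "(\<Sum>k | freq_sup k \<le> n. 1 / bracket k) \<le> 26 * (1 + real n)^2"
proof (induction n)
  case 0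
  show ?case unfolding freq_sup_0_ball using bracket_ge1[of 0] by (simp add: divide_le_eq)
next
  case (Suc n)
  have "24 * real n^2 + 48 * real n + 26 \<le> 26 * (2 * real n + 3) * (2 + real n)"
    by (simp add: power2_eq_square algebra_simps)
  then have "(24 * real n^2 + 48 * real n + 26) * (1 / (2 + real n)) \<le> 26 * (2 * real n + 3)"
    by (simp only: times_divide_eq_right mult_1_right) (subst pos_divide_le_eq, auto)
  moreover have "26 * (1 + real n)^2 + 26 * (2 * real n + 3) = 26 * (1 + real (Suc n))^2"
    by (simp add: power2_eq_square algebra_simps)
  ultimately show ?case
    using Suc freq_sup_ball_sum_Suc[of "\<lambda>m. 1 / (1 + real m)" n] by (simp add: bracket_def)
qed

text \<open>With the squared weight each shell contributes at most 26, hence linear growth.\<close>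

lemma bracket_sum2: "(\<Sum>k | freq_sup k \<le> n. 1 / (bracket k)^2) \<le> 26 * (1 + real n)"
proof (induction n)
  case 0
  show ?case unfolding freq_sup_0_ball using one_le_power[OF bracket_ge1, of 0 2] by (simp add: divide_le_eq)
next
  case (Suc n)
  have "24 * real n^2 + 48 * real n + 26 \<le> 26 * (2 + real n)^2"
    by (simp add: power2_eq_square algebra_simps)
  then have "(24 * real n^2 + 48 * real n + 26) * (1 / (2 + real n)^2) \<le> 26"
    by (simp only: times_divide_eq_right mult_1_right) (subst pos_divide_le_eq, auto intro: zero_less_power)
  then show ?case
    using Suc freq_sup_ball_sum_Suc[of "\<lambda>m. 1 / (1 + real m)^2" n] by (simp add: bracket_def)
qed

lemma square_sum2_le: "(x + y)\<^sup>2 \<le> 2 * x\<^sup>2 + 2 * (y::real)\<^sup>2"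
  using sum_squares_bound[of x y] by (simp add: power2_sum)

text \<open>Lattice form of the inequality \<open>\<parallel>uv\<parallel>\<^sub>0 \<le> C \<parallel>u\<parallel>\<^sub>1 \<parallel>v\<parallel>\<^bsub>1/2\<^esub>\<close>. The sum is split according to
  whether the frequency \<open>p\<close> dominates; in either part the Cauchy--Schwarz inequality leaves a
  lattice sum over the smaller frequency alone.\<close>

lemma trilinear_finite:
  fixes a b c :: "int^3 \<Rightarrow> real"
  assumes F: "finite F" and G: "finite G"
    and A: "\<And>H. finite H \<Longrightarrow> (\<Sum>p\<in>H. (bracket p)\<^sup>2 * (a p)\<^sup>2) \<le> A"
    and B: "\<And>H. finite H \<Longrightarrow> (\<Sum>p\<in>H. (b p)\<^sup>2) \<le> B"
    and C: "\<And>H. finite H \<Longrightarrow> (\<Sum>k\<in>H. bracket k * (c k)\<^sup>2) \<le> C"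
  shows "(\<Sum>k\<in>F. \<Sum>p\<in>G. a p * b (k - p) * c k)\<^sup>2 \<le> 260 * A * B * C"
proof -
  have nn: "0 \<le> A" "0 \<le> B" "0 \<le> C" using A[of "{}"] B[of "{}"] C[of "{}"] by auto
  define S1 where "S1 = {(k, p) \<in> F \<times> G. freq_sup k \<le> 2 * freq_sup p}"
  define S2 where "S2 = {(k, p) \<in> F \<times> G. \<not> freq_sup k \<le> 2 * freq_sup p}"
  define f where "f = (\<lambda>(k, p). a p * b (k - p) * c k)"
  have sub: "S1 \<subseteq> F \<times> G" "S2 \<subseteq> F \<times> G" by (auto simp: S1_def S2_def)
  have fin: "finite S1" "finite S2" using F G by (auto intro: finite_subset[OF sub(1)] finite_subset[OF sub(2)])
  have T: "(\<Sum>k\<in>F. \<Sum>p\<in>G. a p * b (k - p) * c k) = sum f S1 + sum f S2"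
  proof -
    have "F \<times> G = S1 \<union> S2" "S1 \<inter> S2 = {}" by (auto simp: S1_def S2_def)
    then have "sum f (F \<times> G) = sum f S1 + sum f S2" using fin by (simp add: sum.union_disjoint)
    then show ?thesis by (simp add: f_def sum.cartesian_product)
  qed
  have shift: "(\<Sum>p\<in>G. (b (k - p))\<^sup>2) \<le> B" for k
  proof -
    have "(\<Sum>p\<in>G. (b (k - p))\<^sup>2) = (\<Sum>q\<in>(\<lambda>p. k - p) ` G. (b q)\<^sup>2)"
      by (subst sum.reindex) (auto simp: inj_on_def)
    then show ?thesis using B[of "(\<lambda>p. k - p) ` G"] G by simp
  qed
  have shift': "(\<Sum>k\<in>F. (b (k - p))\<^sup>2) \<le> B" for p
  proof -
    have "(\<Sum>k\<in>F. (b (k - p))\<^sup>2) = (\<Sum>q\<in>(\<lambda>k. k - p) ` F. (b q)\<^sup>2)"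
      by (subst sum.reindex) (auto simp: inj_on_def)
    then show ?thesis using B[of "(\<lambda>k. k - p) ` F"] F by simp
  qed
  \<comment> \<open>Here \<open>|k| \<le> 2 |p|\<close> in the maximum norm. The weight given to
    \<open>c\<close> is paid for by \<open>1 / bracket k\<close>, whose sum over that ball of
    \<open>k\<close> is at most \<open>26 * (2 * bracket p)^2\<close>; this gives
    \<open>104 = 26 * 4\<close>.\<close>
  have S1: "(sum f S1)\<^sup>2 \<le> (C * B) * (104 * A)"
  proof -
    have "sum f S1 = (\<Sum>(k, p)\<in>S1. (b (k - p) * (sqrt (bracket k) * c k)) * (a p / sqrt (bracket k)))"
      unfolding f_def by (rule sum.cong) (auto simp: bracket_pos less_imp_neq[symmetric] split: prod.split)
    also have "\<dots>\<^sup>2 \<le> (\<Sum>(k, p)\<in>S1. (b (k - p) * (sqrt (bracket k) * c k))\<^sup>2) * (\<Sum>(k, p)\<in>S1. (a p / sqrt (bracket k))\<^sup>2)"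
      unfolding case_prod_beta by (rule Cauchy_Schwarz_ineq_sum)
    also have "\<dots> \<le> (C * B) * (104 * A)"
    proof (rule mult_mono)
      have "(\<Sum>(k, p)\<in>S1. (b (k - p) * (sqrt (bracket k) * c k))\<^sup>2)
          \<le> (\<Sum>(k, p)\<in>F \<times> G. (b (k - p) * (sqrt (bracket k) * c k))\<^sup>2)"
        by (rule sum_mono2) (use F G sub in auto)
      also have "\<dots> = (\<Sum>k\<in>F. (bracket k * (c k)\<^sup>2) * (\<Sum>p\<in>G. (b (k - p))\<^sup>2))"
        unfolding sum.cartesian_product[symmetric] sum_distrib_left
        by (intro sum.cong refl) (simp add: power_mult_distrib bracket_pos less_imp_le mult_ac)
      also have "\<dots> \<le> (\<Sum>k\<in>F. (bracket k * (c k)\<^sup>2) * B)"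
        by (intro sum_mono mult_left_mono shift) (simp add: bracket_pos less_imp_le)
      also have "\<dots> \<le> C * B"
        unfolding sum_distrib_right[symmetric] by (intro mult_right_mono C F nn)
      finally show "(\<Sum>(k, p)\<in>S1. (b (k - p) * (sqrt (bracket k) * c k))\<^sup>2) \<le> C * B" .
      have "(\<Sum>(k, p)\<in>S1. (a p / sqrt (bracket k))\<^sup>2) = (\<Sum>(k, p)\<in>S1. (a p)\<^sup>2 * (1 / bracket k))"
        by (intro sum.cong) (auto simp: power_divide bracket_pos less_imp_le)
      also have "\<dots> = (\<Sum>(k, p)\<in>F \<times> G. if freq_sup k \<le> 2 * freq_sup p then (a p)\<^sup>2 * (1 / bracket k) else 0)"
        by (rule sum.mono_neutral_cong_left) (use F G in \<open>auto simp: S1_def split: if_splits\<close>)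
      also have "\<dots> = (\<Sum>p\<in>G. \<Sum>k\<in>F. if freq_sup k \<le> 2 * freq_sup p then (a p)\<^sup>2 * (1 / bracket k) else 0)"
        unfolding sum.cartesian_product[symmetric] by (rule sum.swap)
      also have "\<dots> \<le> (\<Sum>p\<in>G. 104 * ((bracket p)\<^sup>2 * (a p)\<^sup>2))"
      proof (rule sum_mono)
        fix p
        have "(\<Sum>k\<in>F. if freq_sup k \<le> 2 * freq_sup p then (a p)\<^sup>2 * (1 / bracket k) else 0)
            = (a p)\<^sup>2 * (\<Sum>k\<in>{k\<in>F. freq_sup k \<le> 2 * freq_sup p}. 1 / bracket k)"
          unfolding sum_distrib_left by (rule sum.inter_filter[OF F, symmetric])
        also have "\<dots> \<le> (a p)\<^sup>2 * (\<Sum>k | freq_sup k \<le> 2 * freq_sup p. 1 / bracket k)"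
          by (intro mult_left_mono sum_mono2 freq_sup_ball) (auto simp: bracket_pos less_imp_le)
        also have "\<dots> \<le> (a p)\<^sup>2 * (26 * (1 + real (2 * freq_sup p))\<^sup>2)"
          by (intro mult_left_mono bracket_sum1) auto
        also have "\<dots> \<le> (a p)\<^sup>2 * (26 * (2 * bracket p)\<^sup>2)"
          by (intro mult_left_mono power_mono) (auto simp: bracket_def)
        finally show "(\<Sum>k\<in>F. if freq_sup k \<le> 2 * freq_sup p then (a p)\<^sup>2 * (1 / bracket k) else 0) \<le> 104 * ((bracket p)\<^sup>2 * (a p)\<^sup>2)"
          by (simp add: power_mult_distrib mult_ac)
      qed
      also have "\<dots> \<le> 104 * A"
        unfolding sum_distrib_left[symmetric] by (intro mult_left_mono A G) auto
      finally show "(\<Sum>(k, p)\<in>S1. (a p / sqrt (bracket k))\<^sup>2) \<le> 104 * A" .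
    qed (use nn in \<open>auto intro!: sum_nonneg\<close>)
    finally show ?thesis .
  qed
  \<comment> \<open>Here \<open>2 |p| < |k|\<close>, so the factor \<open>1 / (bracket p)^2\<close>
    is summed over a ball of \<open>p\<close> with radius \<open>freq_sup k\<close> and costs at
    most \<open>26 * bracket k\<close>, the weight available for \<open>c\<close>.\<close>
  have S2: "(sum f S2)\<^sup>2 \<le> (A * B) * (26 * C)"
  proof -
    have "sum f S2 = (\<Sum>(k, p)\<in>S2. (b (k - p) * (bracket p * a p)) * (c k / bracket p))"
      unfolding f_def by (rule sum.cong) (auto simp: bracket_pos less_imp_neq[symmetric] split: prod.split)
    also have "\<dots>\<^sup>2 \<le> (\<Sum>(k, p)\<in>S2. (b (k - p) * (bracket p * a p))\<^sup>2) * (\<Sum>(k, p)\<in>S2. (c k / bracket p)\<^sup>2)"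
      unfolding case_prod_beta by (rule Cauchy_Schwarz_ineq_sum)
    also have "\<dots> \<le> (A * B) * (26 * C)"
    proof (rule mult_mono)
      have "(\<Sum>(k, p)\<in>S2. (b (k - p) * (bracket p * a p))\<^sup>2)
          \<le> (\<Sum>(k, p)\<in>F \<times> G. (b (k - p) * (bracket p * a p))\<^sup>2)"
        by (rule sum_mono2) (use F G sub in auto)
      also have "\<dots> = (\<Sum>p\<in>G. (\<Sum>k\<in>F. (b (k - p) * (bracket p * a p))\<^sup>2))"
        unfolding sum.cartesian_product[symmetric] by (rule sum.swap)
      also have "\<dots> = (\<Sum>p\<in>G. ((bracket p)\<^sup>2 * (a p)\<^sup>2) * (\<Sum>k\<in>F. (b (k - p))\<^sup>2))"
        unfolding sum_distrib_left by (intro sum.cong refl) (simp add: power_mult_distrib mult_ac)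
      also have "\<dots> \<le> (\<Sum>p\<in>G. ((bracket p)\<^sup>2 * (a p)\<^sup>2) * B)"
        by (intro sum_mono mult_left_mono shift') simp
      also have "\<dots> \<le> A * B"
        unfolding sum_distrib_right[symmetric] by (intro mult_right_mono A G nn)
      finally show "(\<Sum>(k, p)\<in>S2. (b (k - p) * (bracket p * a p))\<^sup>2) \<le> A * B" .
      have "(\<Sum>(k, p)\<in>S2. (c k / bracket p)\<^sup>2) = (\<Sum>(k, p)\<in>S2. (c k)\<^sup>2 * (1 / (bracket p)\<^sup>2))"
        by (intro sum.cong) (auto simp: power_divide)
      also have "\<dots> = (\<Sum>(k, p)\<in>F \<times> G. if \<not> freq_sup k \<le> 2 * freq_sup p then (c k)\<^sup>2 * (1 / (bracket p)\<^sup>2) else 0)"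
        by (rule sum.mono_neutral_cong_left) (use F G in \<open>auto simp: S2_def split: if_splits\<close>)
      also have "\<dots> = (\<Sum>k\<in>F. \<Sum>p\<in>G. if \<not> freq_sup k \<le> 2 * freq_sup p then (c k)\<^sup>2 * (1 / (bracket p)\<^sup>2) else 0)"
        unfolding sum.cartesian_product[symmetric] ..
      also have "\<dots> \<le> (\<Sum>k\<in>F. 26 * (bracket k * (c k)\<^sup>2))"
      proof (rule sum_mono)
        fix k
        have "(\<Sum>p\<in>G. if \<not> freq_sup k \<le> 2 * freq_sup p then (c k)\<^sup>2 * (1 / (bracket p)\<^sup>2) else 0)
            = (c k)\<^sup>2 * (\<Sum>p\<in>{p\<in>G. \<not> freq_sup k \<le> 2 * freq_sup p}. 1 / (bracket p)\<^sup>2)"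
          unfolding sum_distrib_left by (rule sum.inter_filter[OF G, symmetric])
        also have "\<dots> \<le> (c k)\<^sup>2 * (\<Sum>p | freq_sup p \<le> freq_sup k. 1 / (bracket p)\<^sup>2)"
          by (intro mult_left_mono sum_mono2 freq_sup_ball) auto
        also have "\<dots> \<le> (c k)\<^sup>2 * (26 * (1 + real (freq_sup k)))"
          by (intro mult_left_mono bracket_sum2) auto
        finally show "(\<Sum>p\<in>G. if \<not> freq_sup k \<le> 2 * freq_sup p then (c k)\<^sup>2 * (1 / (bracket p)\<^sup>2) else 0) \<le> 26 * (bracket k * (c k)\<^sup>2)"
          by (simp only: bracket_def mult_ac)
      qed
      also have "\<dots> \<le> 26 * C"
        unfolding sum_distrib_left[symmetric] by (intro mult_left_mono C F) auto
      finally show "(\<Sum>(k, p)\<in>S2. (c k / bracket p)\<^sup>2) \<le> 26 * C" .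
    qed (use nn in \<open>auto intro!: sum_nonneg\<close>)
    finally show ?thesis .
  qed
  \<comment> \<open>Collecting the constants: \<open>2 * 104 + 2 * 26 = 260\<close>.\<close>
  have "(sum f S1 + sum f S2)\<^sup>2 \<le> 2 * (sum f S1)\<^sup>2 + 2 * (sum f S2)\<^sup>2" by (rule square_sum2_le)
  also have "\<dots> \<le> 2 * ((C * B) * (104 * A)) + 2 * ((A * B) * (26 * C))"
    by (intro add_mono mult_left_mono S1 S2) auto
  finally show ?thesis unfolding T by (simp add: mult_ac)
qed

text \<open>A form of Young's inequality with exponents 4 and 4/3, without the sharp constant: if
  \<open>t\<close> exceeded the sum of \<open>X\<close> and \<open>B\<close>, then
  \<open>t ^ 4\<close> would exceed \<open>B * X ^ 3\<close>.\<close>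

lemma fourth_power_bound:
  fixes t B X :: real
  assumes "t ^ 4 \<le> B * X ^ 3" "0 \<le> X" "0 \<le> B"
  shows "t \<le> X + B"
proof (rule ccontr)
  assume "\<not> t \<le> X + B"
  then have t: "X + B < t" by simp
  have "B * X ^ 3 \<le> B * t ^ 3" using t assms by (intro mult_left_mono power_mono) auto
  moreover have "B * t ^ 3 < t * t ^ 3"
    using t assms by (intro mult_strict_right_mono zero_less_power) auto
  ultimately show False using assms(1) by (simp add: eval_nat_numeral)
qed

subsection \<open>Absolutely continuous functions and Gronwall's inequality\<close>

text \<open>The integrated form of \<open>(y^2)' = 2 y y'\<close> for a primitive \<open>y\<close>
  of an integrable \<open>g\<close>, obtained without differentiation: \<open>g s * g r\<close> is
  integrated over the triangle \<open>r \<le> s\<close>, and the two orders of integration give two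
  different expressions in \<open>y\<close>.\<close>

lemma integral_square_identity_real:
  fixes g :: "real \<Rightarrow> real"
  assumes t: "0 \<le> t" and g: "integrable (lebesgue_on {0..t}) g"
    and y: "\<And>s. s \<in> {0..t} \<Longrightarrow> y s = (\<integral>r. indicator {..s} r * g r \<partial>lebesgue_on {0..t})"
  shows "(y t)\<^sup>2 = 2 * (\<integral>s. y s * g s \<partial>lebesgue_on {0..t})"
proof -
  define M where "M = lebesgue_on {0..t}"
  interpret M: finite_measure M
    unfolding M_def by (intro finite_measure_lebesgue_on) simp
  interpret P: pair_sigma_finite M M ..
  have gi: "integrable M g" using g by (simp add: M_def)
  have gm [measurable]: "g \<in> borel_measurable M" using gi by simp
  have idm [measurable]: "(\<lambda>x. x) \<in> borel_measurable M"
    unfolding M_def by (intro measurable_restrict_space1 measurable_completion) simp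
  have sp: "space M = {0..t}" by (simp add: M_def)
  have setm: "{..s} \<in> sets borel" "{s..} \<in> sets borel" for s :: real by auto
  have indm: "(\<lambda>r. indicator {..s} r * g r) \<in> borel_measurable M" for s
  proof -
    have "(\<lambda>r. indicator {..s} r :: real) \<in> borel_measurable M"
      using measurable_compose[OF idm borel_measurable_indicator[OF setm(1)]] by simp
    then show ?thesis by measurable
  qed
  define h where "h = (\<lambda>(s, r). (if r \<le> s then 1 else 0) * (g s * g r))"
  have hm: "h \<in> borel_measurable (M \<Otimes>\<^sub>M M)" unfolding h_def by measurable
  have pm: "integrable M (\<lambda>r. g s * g r)" for s using gi by simp
  have hi: "integrable M (\<lambda>r. h (s, r))" for s
  proof (rule Bochner_Integration.integrable_bound[OF pm[of s]])
    show "(\<lambda>r. h (s, r)) \<in> borel_measurable M" unfolding h_def by simp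
  qed (auto simp: h_def)
  have hP: "integrable (M \<Otimes>\<^sub>M M) h"
  proof (rule P.Fubini_integrable[OF hm])
    show "AE x in M. integrable M (\<lambda>y. h (x, y))" using hi by simp
    show "integrable M (\<lambda>x. \<integral>y. norm (h (x, y)) \<partial>M)"
    proof (rule Bochner_Integration.integrable_bound)
      show "integrable M (\<lambda>x. \<bar>g x\<bar> * (\<integral>y. \<bar>g y\<bar> \<partial>M))" using gi by simp
      have "(\<lambda>(x, y). norm (h (x, y))) \<in> borel_measurable (M \<Otimes>\<^sub>M M)" using hm by simp
      then show "(\<lambda>x. \<integral>y. norm (h (x, y)) \<partial>M) \<in> borel_measurable M"
        by (intro M.borel_measurable_lebesgue_integral) simp
      show "AE x in M. norm (\<integral>y. norm (h (x, y)) \<partial>M) \<le> norm (\<bar>g x\<bar> * (\<integral>y. \<bar>g y\<bar> \<partial>M))"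
      proof (rule AE_I2)
        fix x
        have "(\<integral>y. norm (h (x, y)) \<partial>M) \<le> (\<integral>y. \<bar>g x\<bar> * \<bar>g y\<bar> \<partial>M)"
          by (rule integral_mono[OF integrable_norm[OF hi]]) (use gi in \<open>auto simp: h_def abs_mult\<close>)
        then show "norm (\<integral>y. norm (h (x, y)) \<partial>M) \<le> norm (\<bar>g x\<bar> * (\<integral>y. \<bar>g y\<bar> \<partial>M))" by simp
      qed
    qed
  qed
  have y': "y s = (\<integral>r. indicator {..s} r * g r \<partial>M)" if "s \<in> {0..t}" for s
    using y[OF that] by (simp add: M_def)
  have yt: "y t = (\<integral>r. g r \<partial>M)"
    unfolding y'[of t, simplified, OF t] by (intro Bochner_Integration.integral_cong) (auto simp: sp)
  have in1: "(\<integral>r. h (s, r) \<partial>M) = y s * g s" if "s \<in> space M" for s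
  proof -
    have "(\<integral>r. h (s, r) \<partial>M) = (\<integral>r. g s * (indicator {..s} r * g r) \<partial>M)"
      by (intro Bochner_Integration.integral_cong) (auto simp: h_def indicator_def)
    then show ?thesis using y'[of s] that by (simp add: sp mult.commute)
  qed
  \<comment> \<open>For fixed \<open>r\<close> the variable \<open>s\<close> runs over
    \<open>s \<ge> r\<close>. This set and the complement of \<open>{..r}\<close> differ only in the
    null point \<open>s = r\<close>.\<close>
  have in2: "(\<integral>s. h (s, r) \<partial>M) = (y t - y r) * g r" if r: "r \<in> space M" for r
  proof -
    have ae: "AE s in M. s \<noteq> r"
    proof -
      have "AE s in lebesgue. s \<notin> {r}" by (intro AE_not_in) (simp add: negligible_iff_null_sets[symmetric])
      then show ?thesis unfolding M_def by (subst AE_restrict_space_iff) auto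
    qed
    have gI: "integrable M (\<lambda>s. indicator {..r} s * g s)"
      by (rule Bochner_Integration.integrable_bound[OF gi indm]) (auto simp: indicator_def)
    have "(\<integral>s. h (s, r) \<partial>M) = (\<integral>s. g r * (g s - indicator {..r} s * g s) \<partial>M)"
    proof (rule integral_cong_AE)
      show "(\<lambda>s. h (s, r)) \<in> borel_measurable M" unfolding h_def by simp
      show "(\<lambda>s. g r * (g s - indicator {..r} s * g s)) \<in> borel_measurable M" using indm by simp
      show "AE s in M. h (s, r) = g r * (g s - indicator {..r} s * g s)"
        using ae by (rule AE_mp) (auto intro!: AE_I2 simp: h_def indicator_def)
    qed
    also have "\<dots> = g r * ((\<integral>s. g s \<partial>M) - (\<integral>s. indicator {..r} s * g s \<partial>M))"
      using gi gI by simp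
    finally show ?thesis using y'[of r] yt r by (simp add: sp mult.commute)
  qed
  \<comment> \<open>With \<open>I\<close> the integral of \<open>y * g\<close>, Fubini's theorem
    gives \<open>I = (y t)^2 - I\<close>.\<close>
  have "(\<integral>s. y s * g s \<partial>M) = (\<integral>s. (\<integral>r. h (s, r) \<partial>M) \<partial>M)"
    by (intro Bochner_Integration.integral_cong) (auto simp: in1)
  also have "\<dots> = (\<integral>r. (\<integral>s. h (s, r) \<partial>M) \<partial>M)"
    using P.Fubini_integral[of "\<lambda>s r. h (s, r)"] hP by simp
  also have "\<dots> = (\<integral>r. y t * g r - y r * g r \<partial>M)"
    by (intro Bochner_Integration.integral_cong) (auto simp: in2 algebra_simps)
  also have "\<dots> = (\<integral>r. y t * g r \<partial>M) - (\<integral>r. y r * g r \<partial>M)"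
  proof (rule Bochner_Integration.integral_diff)
    show "integrable M (\<lambda>r. y t * g r)" using gi by simp
    have "integrable M (\<lambda>s. \<integral>r. h (s, r) \<partial>M)"
      using P.integrable_fst'[OF hP] by simp
    then show "integrable M (\<lambda>r. y r * g r)"
      by (rule Bochner_Integration.integrable_cong[THEN iffD1, rotated -1]) (auto simp: in1)
  qed
  also have "(\<integral>r. y t * g r \<partial>M) = (y t)\<^sup>2" using yt by (simp add: power2_eq_square)
  finally show ?thesis by (simp add: M_def)
qed

text \<open>The coefficient \<open>h\<close> is only integrable, so instead of differentiating an
  exponential factor the last zero of the majorant \<open>F\<close> is used: just to the right of it
  the integral of \<open>h\<close> is below 1, which would force \<open>F\<close> to vanish there
  too.\<close>

lemma gronwall_zero:
  fixes h Y :: "real \<Rightarrow> real"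
  assumes t0: "0 \<le> t0"
    and h: "h absolutely_integrable_on {0..t0}" and hY: "(\<lambda>s. h s * Y s) absolutely_integrable_on {0..t0}"
    and hn: "\<And>s. 0 \<le> h s" and Yn: "\<And>s. s \<in> {0..t0} \<Longrightarrow> 0 \<le> Y s"
    and le: "\<And>s. s \<in> {0..t0} \<Longrightarrow> Y s \<le> integral {0..s} (\<lambda>r. h r * Y r)"
  shows "Y t0 = 0"
proof -
  define F where "F s = integral {0..s} (\<lambda>r. h r * Y r)" for s
  define H where "H s = integral {0..s} h" for s
  have hi: "h integrable_on {0..t0}" "(\<lambda>r. h r * Y r) integrable_on {0..t0}"
    using h hY by (auto intro: set_lebesgue_integral_eq_integral(1))
  have hs: "h integrable_on {a..b}" "(\<lambda>r. h r * Y r) integrable_on {a..b}" if "0 \<le> a" "b \<le> t0" for a b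
    using hi that by (auto intro: integrable_on_subinterval)
  have Fc: "continuous_on {0..t0} F" and Hc: "continuous_on {0..t0} H"
    unfolding F_def H_def using hi by (auto intro: indefinite_integral_continuous_1)
  have Fsplit: "F b = F a + integral {a..b} (\<lambda>r. h r * Y r)" "H b = H a + integral {a..b} h" if "0 \<le> a" "a \<le> b" "b \<le> t0" for a b
    unfolding F_def H_def using that hs[of 0 b] by (simp_all add: Henstock_Kurzweil_Integration.integral_combine)
  have Fmono: "F a \<le> F b" if "0 \<le> a" "a \<le> b" "b \<le> t0" for a b
  proof -
    have "0 \<le> integral {a..b} (\<lambda>r. h r * Y r)"
      by (rule Henstock_Kurzweil_Integration.integral_nonneg[OF hs(2)]) (use that hn Yn in auto)
    then show ?thesis using Fsplit(1)[OF that] by simp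
  qed
  have F0: "F 0 = 0" by (simp add: F_def)
  have "F t0 \<le> 0"
  proof (rule ccontr)
    assume neg: "\<not> F t0 \<le> 0"
    define Z where "Z = {s \<in> {0..t0}. F s \<in> {0}}"
    have "closed Z" unfolding Z_def using Fc by (intro continuous_closed_preimage[where f=F, unfolded vimage_def Int_def, simplified]) auto
    then have Zc: "compact Z" 
    proof -
      have "{0..t0} \<inter> Z = Z" by (auto simp: Z_def)
      then show ?thesis using compact_Int_closed[OF compact_Icc \<open>closed Z\<close>] by metis
    qed
    have Zne: "Z \<noteq> {}" using F0 t0 by (auto simp: Z_def)
    obtain a where a: "a \<in> Z" "\<And>s. s \<in> Z \<Longrightarrow> s \<le> a" using compact_attains_sup[OF Zc Zne] by blast
    have a0: "0 \<le> a" "a \<le> t0" "F a = 0" using a(1) by (auto simp: Z_def)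
    have "a \<noteq> t0" using a0 neg by auto
    then have at: "a < t0" using a0 by simp
    \<comment> \<open>On \<open>{a..s}\<close> one has \<open>Y r \<le> F r \<le> F s\<close>, hence
      \<open>F s \<le> (H s - H a) * F s\<close>. Dividing by \<open>F s > 0\<close> leaves a bound
      that continuity of \<open>H\<close> at \<open>a\<close> refutes for \<open>s\<close> close to
      \<open>a\<close>.\<close>
    have key: "1 \<le> H s - H a" if s: "a < s" "s \<le> t0" for s
    proof -
      have "F s \<noteq> 0" using a(2)[of s] s a0 by (auto simp: Z_def)
      moreover have "0 \<le> F s" using Fmono[of 0 s] F0 s a0 by simp
      ultimately have Fs: "0 < F s" by simp
      have "F s = integral {a..s} (\<lambda>r. h r * Y r)" using Fsplit(1)[of a s] s a0 by simp
      also have "\<dots> \<le> integral {a..s} (\<lambda>r. h r * F s)"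
      proof (rule integral_le)
        show "(\<lambda>r. h r * Y r) integrable_on {a..s}" using hs s a0 by simp
        show "(\<lambda>r. h r * F s) integrable_on {a..s}" using hs(1)[of a s] s a0 by (simp add: integrable_on_mult_left)
        fix r assume r: "r \<in> {a..s}"
        have "Y r \<le> F r" using le[of r] r s a0 by (simp add: F_def)
        also have "\<dots> \<le> F s" using r s a0 by (intro Fmono) auto
        finally show "h r * Y r \<le> h r * F s" using hn by (intro mult_left_mono)
      qed
      also have "\<dots> = (H s - H a) * F s" using Fsplit(2)[of a s] s a0 by simp
      finally show ?thesis using Fs by simp
    qed
    have "continuous (at a within {0..t0}) H" using Hc a0 by (simp add: continuous_on_eq_continuous_within)
    then obtain \<delta> where \<delta>: "\<delta> > 0" "\<And>s. s \<in> {0..t0} \<Longrightarrow> dist s a < \<delta> \<Longrightarrow> dist (H s) (H a) < 1"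
      unfolding continuous_within_eps_delta by (metis zero_less_one)
    define s where "s = min t0 (a + \<delta> / 2)"
    have s: "a < s" "s \<le> t0" "dist s a < \<delta>" using at \<delta>(1) by (auto simp: s_def dist_real_def)
    have "dist (H s) (H a) < 1" using \<delta>(2)[of s] s a0 by simp
    then show False using key[OF s(1,2)] by (simp add: dist_real_def)
  qed
  then show ?thesis using le[of t0] Yn[of t0] t0 by (simp add: F_def)
qed

subsection \<open>Sobolev spaces\<close>

text \<open>Bilinear, without conjugation: \<open>cdot z (cvec (freq k))\<close> is then, up to the
  factor \<i>, the coefficient of the divergence, and the convolution formulas stay free of
  conjugates.\<close>

definition cdot :: "complex^3 \<Rightarrow> complex^3 \<Rightarrow> complex" where
  "cdot a b = (\<Sum>i\<in>UNIV. a $ i * b $ i)"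

definition cvec :: "real^3 \<Rightarrow> complex^3" where
  "cvec a = (\<chi> i. of_real (a $ i))"

lemma cvec_nth [simp]: "cvec a $ i = of_real (a $ i)" by (simp add: cvec_def)

lemma norm_cvec [simp]: "norm (cvec a) = norm a"
  by (simp add: norm_vec_def L2_set_def)

lemma cvec_add: "cvec (a + b) = cvec a + cvec b" by (simp add: vec_eq_iff)

lemma norm_cdot_le: "norm (cdot a b) \<le> norm a * norm b"
proof -
  have "norm (cdot a b) \<le> (\<Sum>i\<in>UNIV. \<bar>norm (a $ i)\<bar> * \<bar>norm (b $ i)\<bar>)"
    unfolding cdot_def by (rule order_trans[OF norm_sum]) (simp add: norm_mult)
  also have "\<dots> \<le> norm a * norm b"
    unfolding norm_vec_def by (rule L2_set_mult_ineq)
  finally show ?thesis .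
qed

lemma cdot_add_left: "cdot (a + b) c = cdot a c + cdot b c"
  and cdot_add_right: "cdot c (a + b) = cdot c a + cdot c b"
  and cdot_diff_left: "cdot (a - b) c = cdot a c - cdot b c"
  and cdot_diff_right: "cdot c (a - b) = cdot c a - cdot c b"
  and cdot_scale_left: "cdot (z *s a) c = z * cdot a c"
  and cdot_scale_right: "cdot c (z *s a) = z * cdot c a"
  and cdot_commute: "cdot a c = cdot c a"
  by (simp_all add: cdot_def sum.distrib sum_subtractf algebra_simps sum_distrib_left)

lemma norm_cscale: "norm (z *s (v :: complex^3)) = cmod z * norm v"
  by (simp add: norm_vec_def L2_set_def norm_mult power_mult_distrib sum_distrib_left[symmetric] real_sqrt_mult)

lemma cdot_cvec: "cdot (cvec a) (cvec b) = of_real (a \<bullet> b)"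
  by (simp add: cdot_def inner_vec_def)

lemma H_L2: "f \<in> H s \<Longrightarrow> f \<in> L2" by (simp add: H_def)

lemma H_weight_nonneg: "0 \<le> H_weight s f k"
  by (simp add: H_weight_def)

lemma H_sum_le: "f \<in> H s \<Longrightarrow> finite F \<Longrightarrow> (\<Sum>k\<in>F. H_weight s f k) \<le> (H_norm s f)\<^sup>2"
  using finite_sum_le_infsum[of "H_weight s f" UNIV F] infsum_nonneg[of UNIV "H_weight s f"]
  by (simp add: H_norm_def H_def H_weight_nonneg)

text \<open>Compares other weights with the Sobolev weight; the estimates derived from it differ in
  the choice of \<open>s\<close>, \<open>g\<close> and \<open>c\<close>.\<close>

lemma H_sum_le':
  assumes "f \<in> H s" "finite F" "0 \<le> c"
    and "\<And>k. g k \<le> c * (1 + norm (freq k) powr (2 * s))"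
  shows "(\<Sum>k\<in>F. g k * (norm (fourier_coeff f k))\<^sup>2) \<le> c * (H_norm s f)\<^sup>2"
proof -
  have "(\<Sum>k\<in>F. g k * (norm (fourier_coeff f k))\<^sup>2) \<le> (\<Sum>k\<in>F. c * H_weight s f k)"
  proof (rule sum_mono)
    fix k
    have "g k * (norm (fourier_coeff f k))\<^sup>2 \<le> (c * (1 + norm (freq k) powr (2 * s))) * (norm (fourier_coeff f k))\<^sup>2"
      by (intro mult_right_mono assms) simp
    then show "g k * (norm (fourier_coeff f k))\<^sup>2 \<le> c * H_weight s f k" by (simp add: H_weight_def mult.assoc)
  qed
  also have "\<dots> = c * (\<Sum>k\<in>F. H_weight s f k)" by (simp add: sum_distrib_left)
  also have "\<dots> \<le> c * (H_norm s f)\<^sup>2" by (intro mult_left_mono H_sum_le assms)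
  finally show ?thesis .
qed

lemma powr_three: "norm x powr (2 * (3 / 2)) = norm x ^ 3"
  using powr_numeral[of "norm x" "num.One"] by simp

lemma square_le_cube: "0 \<le> t \<Longrightarrow> t\<^sup>2 \<le> 1 + (t::real) ^ 3"
proof (cases "t \<le> 1")
  case True
  moreover assume "0 \<le> t"
  ultimately show ?thesis using power_le_one[of t 2] zero_le_power[of t 3] by linarith
next
  case False
  then have "t\<^sup>2 \<le> t ^ 3" by (intro power_increasing) auto
  then show ?thesis by linarith
qed

lemma H32_sum0: "f \<in> H (3/2) \<Longrightarrow> finite F \<Longrightarrow> (\<Sum>k\<in>F. (norm (fourier_coeff f k))\<^sup>2) \<le> (H_norm (3/2) f)\<^sup>2"
  using H_sum_le'[of f "3/2" F 1 "\<lambda>_. 1"] by simp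

lemma H12_sum0: "f \<in> H (1/2) \<Longrightarrow> finite F \<Longrightarrow> (\<Sum>k\<in>F. (norm (fourier_coeff f k))\<^sup>2) \<le> (H_norm (1/2) f)\<^sup>2"
  using H_sum_le'[of f "1/2" F 1 "\<lambda>_. 1"] by simp

lemma H32_sum1:
  assumes "f \<in> H (3/2)" "finite F"
  shows "(\<Sum>k\<in>F. (norm (freq k))\<^sup>2 * (norm (fourier_coeff f k))\<^sup>2) \<le> (H_norm (3/2) f)\<^sup>2"
proof -
  have "(norm (freq k))\<^sup>2 \<le> 1 + norm (freq k) ^ 3" for k by (rule square_le_cube) simp
  then show ?thesis
    using H_sum_le'[OF assms, of 1 "\<lambda>k. (norm (freq k))\<^sup>2"] unfolding powr_three by simp
qed

lemma bracket_cube_le: "(bracket k) ^ 3 \<le> 4 * (1 + norm (freq k) ^ 3)"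
proof -
  let ?m = "real (freq_sup k)"
  \<comment> \<open>This product is the difference of the two sides of the next inequality.\<close>
  have "0 \<le> 3 * (?m + 1) * (?m - 1)\<^sup>2" by simp
  then have "(bracket k) ^ 3 \<le> 4 * (1 + ?m ^ 3)"
    by (simp add: bracket_def power3_eq_cube power2_eq_square algebra_simps)
  also have "\<dots> \<le> 4 * (1 + norm (freq k) ^ 3)" using freq_sup_le_norm by (simp add: power_mono)
  finally show ?thesis .
qed

lemma H32_sum_jap3:
  assumes "f \<in> H (3/2)" "finite F"
  shows "(\<Sum>k\<in>F. (bracket k) ^ 3 * (norm (fourier_coeff f k))\<^sup>2) \<le> 4 * (H_norm (3/2) f)\<^sup>2"
  using H_sum_le'[OF assms, of 4 "\<lambda>k. (bracket k) ^ 3"] bracket_cube_le unfolding powr_three by simp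

lemma H12_sum_bracket:
  assumes "f \<in> H (1/2)" "finite F"
  shows "(\<Sum>k\<in>F. bracket k * (norm (fourier_coeff f k))\<^sup>2) \<le> (H_norm (1/2) f)\<^sup>2"
  using H_sum_le'[OF assms, of 1 bracket] freq_sup_le_norm by (simp add: bracket_def)

lemma H32_weak_pd:
  assumes f: "f \<in> H (3/2)"
  shows "has_weak_pd i f (weak_pd i f)"
proof (rule has_weak_pd_exists[OF H_L2[OF f]])
  fix j
  show "(\<lambda>k. (of_int (k $ i))\<^sup>2 * (cmod (coef (component f j) k))\<^sup>2) summable_on UNIV"
  proof (rule nonneg_bounded_partial_sums_imp_summable_on[where C="(H_norm (3/2) f)\<^sup>2"])
    show "eventually (\<lambda>F. (\<Sum>k\<in>F. (of_int (k $ i))\<^sup>2 * (cmod (coef (component f j) k))\<^sup>2) \<le> (H_norm (3/2) f)\<^sup>2) (finite_subsets_at_top UNIV)"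
    proof (rule eventually_finite_subsets_at_top_weakI)
      fix F :: "(int^3) set" assume F: "finite F"
      have "(\<Sum>k\<in>F. (of_int (k $ i))\<^sup>2 * (cmod (coef (component f j) k))\<^sup>2)
         \<le> (\<Sum>k\<in>F. (norm (freq k))\<^sup>2 * (norm (fourier_coeff f k))\<^sup>2)"
      proof (intro sum_mono mult_mono)
        fix k
        have "\<bar>freq k $ i\<bar>\<^sup>2 \<le> (norm (freq k))\<^sup>2" by (intro power_mono component_le_norm_cart) simp
        then show "(of_int (k $ i))\<^sup>2 \<le> (norm (freq k))\<^sup>2" by simp
        show "(cmod (coef (component f j) k))\<^sup>2 \<le> (norm (fourier_coeff f k))\<^sup>2"
          unfolding fourier_coeff_component[symmetric] by (intro power_mono Finite_Cartesian_Product.norm_nth_le) simp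
      qed auto
      then show "(\<Sum>k\<in>F. (of_int (k $ i))\<^sup>2 * (cmod (coef (component f j) k))\<^sup>2) \<le> (H_norm (3/2) f)\<^sup>2"
        using H32_sum1[OF f F] by linarith
    qed
  qed simp
qed

lemma H32_weak_pd_L2: "f \<in> H (3/2) \<Longrightarrow> weak_pd i f \<in> L2"
  using H32_weak_pd by (simp add: has_weak_pd_def)

lemma H32_weak_pd_coef: "f \<in> H (3/2) \<Longrightarrow> coef (component (weak_pd i f) j) k = \<i> * of_int (k $ i) * coef (component f j) k"
  using has_weak_pd_coef[OF H_L2 H32_weak_pd] .

subsection \<open>The nonlinear terms in Fourier variables\<close>

text \<open>Additivity under mere integrability, since a product of two square-integrable factors is
  in general only integrable.\<close>

lemma coef_add': "integrable torus f \<Longrightarrow> integrable torus g \<Longrightarrow> coef (\<lambda>x. f x + g x) k = coef f k + coef g k"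
proof -
  have i: "integrable torus (\<lambda>x. f x * cnj (fmode k x))" if "integrable torus f" for f
  proof (rule Bochner_Integration.integrable_bound[OF that])
    have "(\<lambda>x. cnj (fmode k x)) \<in> borel_measurable torus" unfolding fmode_cnj by (rule fmode_borel)
    then show "(\<lambda>x. f x * cnj (fmode k x)) \<in> borel_measurable torus" using that by simp
  qed (simp add: norm_mult)
  assume "integrable torus f" "integrable torus g"
  then show ?thesis by (simp add: coef_def cL2_inner_def distrib_right i add_divide_distrib)
qed

lemma integrable_of_real_iff: "integrable torus (\<lambda>x. complex_of_real (h x)) \<longleftrightarrow> integrable torus h"
  by (rule complex_of_real_integrable_eq)

lemma component_mult_integrable: "f \<in> L2 \<Longrightarrow> g \<in> L2 \<Longrightarrow> integrable torus (\<lambda>x. component f i x * component g j x)"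
  by (intro cL2_mult_integrable L2_component)

lemma coef_sum3:
  fixes f :: "3 \<Rightarrow> real^3 \<Rightarrow> complex"
  assumes "\<And>j. integrable torus (f j)"
  shows "coef (\<lambda>x. \<Sum>j\<in>UNIV. f j x) k = (\<Sum>j\<in>UNIV. coef (f j) k)"
  unfolding sum_3 using assms by (simp add: coef_add')

lemma convection_component: "component (convection u w) i x = (\<Sum>j\<in>UNIV. component u j x * component (weak_pd j w) i x)"
  by (simp add: convection_def component_def)

lemma grad_transpose_component: "component (grad_transpose u w) i x = (\<Sum>j\<in>UNIV. component (weak_pd i u) j x * component w j x)"
  by (simp add: grad_transpose_def component_def)

lemma convection_integrable:
  assumes "u \<in> L2" "w \<in> H (3/2)"
  shows "integrable torus (\<lambda>x. convection u w x $ i)"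
proof -
  have "integrable torus (component (convection u w) i)"
    unfolding convection_component[abs_def]
    by (intro Bochner_Integration.integrable_sum component_mult_integrable assms H32_weak_pd_L2)
  then show ?thesis unfolding component_def[abs_def] integrable_of_real_iff .
qed

lemma grad_transpose_integrable:
  assumes "u \<in> H (3/2)" "w \<in> L2"
  shows "integrable torus (\<lambda>x. grad_transpose u w x $ i)"
proof -
  have "integrable torus (component (grad_transpose u w) i)"
    unfolding grad_transpose_component[abs_def]
    by (intro Bochner_Integration.integrable_sum component_mult_integrable assms H32_weak_pd_L2)
  then show ?thesis unfolding component_def[abs_def] integrable_of_real_iff .
qed

lemma has_sum_sum3:
  fixes f :: "3 \<Rightarrow> 'a \<Rightarrow> complex"
  assumes "\<And>j. (f j has_sum s j) A"
  shows "((\<lambda>p. \<Sum>j\<in>UNIV. f j p) has_sum (\<Sum>j\<in>UNIV. s j)) A"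
  unfolding sum_3 by (intro has_sum_add assms)

lemma has_sum_diff:
  fixes f g :: "'a \<Rightarrow> complex"
  assumes "(f has_sum a) A" "(g has_sum b) A"
  shows "((\<lambda>x. f x - g x) has_sum (a - b)) A"
  using has_sum_add[OF assms(1) has_sum_uminusI[OF assms(2)]] by simp

section \<open>Convolution formulas and cancellation of the gradient parts\<close>

lemma fourier_convection:
  assumes u: "u \<in> L2" and w: "w \<in> H (3/2)"
  shows "((\<lambda>p. \<i> * cdot (fourier_coeff u p) (cvec (freq (l - p))) * fourier_coeff w (l - p) $ i)
     has_sum fourier_coeff (convection u w) l $ i) UNIV"
proof -
  have "((\<lambda>p. \<Sum>j\<in>UNIV. coef (component u j) p * coef (component (weak_pd j w) i) (l - p))
     has_sum (\<Sum>j\<in>UNIV. coef (\<lambda>x. component u j x * component (weak_pd j w) i x) l)) UNIV"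
    by (intro has_sum_sum3 coef_mult L2_component u H32_weak_pd_L2 w)
  moreover have "(\<Sum>j\<in>UNIV. coef (\<lambda>x. component u j x * component (weak_pd j w) i x) l) = fourier_coeff (convection u w) l $ i"
    unfolding fourier_coeff_component convection_component[abs_def]
    by (subst coef_sum3) (auto intro: component_mult_integrable u H32_weak_pd_L2 w)
  moreover have "(\<Sum>j\<in>UNIV. coef (component u j) p * coef (component (weak_pd j w) i) (l - p))
      = \<i> * cdot (fourier_coeff u p) (cvec (freq (l - p))) * fourier_coeff w (l - p) $ i" for p
    unfolding H32_weak_pd_coef[OF w] cdot_def fourier_coeff_component sum_distrib_left sum_distrib_right
    by (intro sum.cong) (auto simp: mult_ac)
  ultimately show ?thesis by simp
qed

lemma fourier_grad_transpose:
  assumes u: "u \<in> H (3/2)" and w: "w \<in> L2"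
  shows "((\<lambda>p. \<i> * of_int (p $ i) * cdot (fourier_coeff u p) (fourier_coeff w (l - p)))
     has_sum fourier_coeff (grad_transpose u w) l $ i) UNIV"
proof -
  have "((\<lambda>p. \<Sum>j\<in>UNIV. coef (component (weak_pd i u) j) p * coef (component w j) (l - p))
     has_sum (\<Sum>j\<in>UNIV. coef (\<lambda>x. component (weak_pd i u) j x * component w j x) l)) UNIV"
    by (intro has_sum_sum3 coef_mult L2_component w H32_weak_pd_L2 u)
  moreover have "(\<Sum>j\<in>UNIV. coef (\<lambda>x. component (weak_pd i u) j x * component w j x) l) = fourier_coeff (grad_transpose u w) l $ i"
    unfolding fourier_coeff_component grad_transpose_component[abs_def]
    by (subst coef_sum3) (auto intro: component_mult_integrable u H32_weak_pd_L2 w)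
  moreover have "(\<Sum>j\<in>UNIV. coef (component (weak_pd i u) j) p * coef (component w j) (l - p))
      = \<i> * of_int (p $ i) * cdot (fourier_coeff u p) (fourier_coeff w (l - p))" for p
    unfolding H32_weak_pd_coef[OF u] cdot_def fourier_coeff_component sum_distrib_left
    by (intro sum.cong) (auto simp: mult_ac)
  ultimately show ?thesis by simp
qed

lemma has_sum_cdot:
  assumes "\<And>i. ((\<lambda>p. f p $ i) has_sum (s $ i)) UNIV"
  shows "((\<lambda>p. cdot (f p) b) has_sum cdot s b) UNIV"
  unfolding cdot_def by (intro has_sum_sum3 has_sum_cmult_left assms)

text \<open>The symbol of the Leray projection. For \<open>k = 0\<close> the subtracted term is 0,
  so constants are kept; they are divergence free.\<close>

definition leray_part :: "complex^3 \<Rightarrow> int^3 \<Rightarrow> complex^3" where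
  "leray_part z k = z - (cdot z (cvec (freq k)) / of_real ((norm (freq k))\<^sup>2)) *s cvec (freq k)"

text \<open>Fourier form of the cancellations. Against a direction \<open>a\<close> orthogonal to
  \<open>l\<close>, the frequencies \<open>p\<close> and \<open>l - p\<close> agree up to sign.
  Together with the divergence condition on \<open>u\<close> this makes the component of
  \<open>w - u\<close> parallel to \<open>freq (l - p)\<close> cancel between the two terms, so that
  only its Leray part survives.\<close>

lemma nonlinear_has_sum:
  assumes u: "u \<in> H (3/2)" and w: "w \<in> H (3/2)"
    and div: "\<And>k. cdot (fourier_coeff u k) (cvec (freq k)) = 0"
    and a: "a \<bullet> freq l = 0"
  shows "((\<lambda>p. let U = fourier_coeff u p; V = leray_part (fourier_coeff w (l - p) - fourier_coeff u (l - p)) (l - p)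
            in \<i> * (cdot U (cvec (freq l)) * cdot V (cvec a) - cdot (cvec a) (cvec (freq (l - p))) * cdot U V))
     has_sum cdot (fourier_coeff (convection u w) l + fourier_coeff (grad_transpose u w) l - fourier_coeff (convection u u) l) (cvec a)) UNIV"
proof -
  define U where "U = fourier_coeff u"
  define W where "W = fourier_coeff w"
  define k where "k p = cvec (freq p)" for p
  define b where "b = cvec a"
  have uL: "u \<in> L2" "w \<in> L2" using u w H_L2 by auto
  have 1: "((\<lambda>p. cdot ((\<i> * cdot (U p) (k (l - p))) *s W (l - p)) b) has_sum cdot (fourier_coeff (convection u w) l) b) UNIV"
    unfolding U_def W_def k_def by (rule has_sum_cdot) (use fourier_convection[OF uL(1) w] in simp)
  have 2: "((\<lambda>p. cdot ((\<i> * cdot (U p) (k (l - p))) *s U (l - p)) b) has_sum cdot (fourier_coeff (convection u u) l) b) UNIV"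
    unfolding U_def k_def by (rule has_sum_cdot) (use fourier_convection[OF uL(1) u] in simp)
  have 3: "((\<lambda>p. cdot ((\<i> * cdot (U p) (W (l - p))) *s k p) b) has_sum cdot (fourier_coeff (grad_transpose u w) l) b) UNIV"
    unfolding U_def W_def k_def by (rule has_sum_cdot) (use fourier_grad_transpose[OF u uL(2)] in \<open>simp add: mult_ac\<close>)
  have 4: "((\<lambda>p. cdot ((\<i> * cdot (U p) (U (l - p))) *s k p) b) has_sum cdot (fourier_coeff (grad_transpose u u) l) b) UNIV"
    unfolding U_def k_def by (rule has_sum_cdot) (use fourier_grad_transpose[OF u uL(1)] in \<open>simp add: mult_ac\<close>)
  have kl: "k p + k (l - p) = k l" for p
    by (simp add: k_def cvec_add[symmetric] freq_add[symmetric])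
  have kb: "cdot (k l) b = 0"
    using a by (simp add: k_def b_def cdot_cvec inner_commute)
  have kb': "cdot (k p) b = - cdot (k (l - p)) b" for p
    using kb unfolding kl[of p, symmetric] cdot_add_left by (simp add: add_eq_0_iff2)
  text \<open>The gradient part \<open>\<nabla>|u|\<^sup>2/2\<close> is antisymmetric under \<open>p \<mapsto> l - p\<close>.\<close>
  have "((\<lambda>p. cdot ((\<i> * cdot (U (l - p)) (U p)) *s k (l - p)) b) has_sum cdot (fourier_coeff (grad_transpose u u) l) b) UNIV"
    by (rule has_sum_reindex_bij_witness[where i="\<lambda>p. l - p" and j="\<lambda>p. l - p", THEN iffD1, OF _ _ _ _ _ _ 4]) auto
  moreover have "cdot ((\<i> * cdot (U (l - p)) (U p)) *s k (l - p)) b = - cdot ((\<i> * cdot (U p) (U (l - p))) *s k p) b" for p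
    unfolding cdot_scale_left kb'[of p] cdot_commute[of "U (l - p)" "U p"] by simp
  ultimately have "((\<lambda>p. - cdot ((\<i> * cdot (U p) (U (l - p))) *s k p) b) has_sum cdot (fourier_coeff (grad_transpose u u) l) b) UNIV"
    by simp
  then have "cdot (fourier_coeff (grad_transpose u u) l) b = - cdot (fourier_coeff (grad_transpose u u) l) b"
    using has_sum_unique has_sum_uminusI[OF 4] by blast
  then have G0: "cdot (fourier_coeff (grad_transpose u u) l) b = 0" by simp
  \<comment> \<open>The series of \<open>grad_transpose u u\<close>, just shown to have sum zero in
    this direction, is subtracted so that \<open>w\<close> occurs only through the difference
    \<open>w - u\<close>.\<close>
  have HS: "((\<lambda>p. cdot ((\<i> * cdot (U p) (k (l - p))) *s W (l - p)) b + cdot ((\<i> * cdot (U p) (W (l - p))) *s k p) b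
      - cdot ((\<i> * cdot (U p) (k (l - p))) *s U (l - p)) b - cdot ((\<i> * cdot (U p) (U (l - p))) *s k p) b)
     has_sum cdot (fourier_coeff (convection u w) l) b + cdot (fourier_coeff (grad_transpose u w) l) b
       - cdot (fourier_coeff (convection u u) l) b - cdot (fourier_coeff (grad_transpose u u) l) b) UNIV"
    by (intro has_sum_diff has_sum_add 1 2 3 4)
  have eq: "cdot ((\<i> * cdot (U p) (k (l - p))) *s W (l - p)) b + cdot ((\<i> * cdot (U p) (W (l - p))) *s k p) b
      - cdot ((\<i> * cdot (U p) (k (l - p))) *s U (l - p)) b - cdot ((\<i> * cdot (U p) (U (l - p))) *s k p) b
     = \<i> * (cdot (U p) (k l) * cdot (leray_part (W (l - p) - U (l - p)) (l - p)) b
         - cdot b (k (l - p)) * cdot (U p) (leray_part (W (l - p) - U (l - p)) (l - p)))" for p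
  proof -
    define D where "D = W (l - p) - U (l - p)"
    define z where "z = cdot D (k (l - p)) / of_real ((norm (freq (l - p)))\<^sup>2)"
    have lp: "leray_part D (l - p) = D - z *s k (l - p)" by (simp add: leray_part_def z_def k_def)
    \<comment> \<open>Since \<open>U p\<close> is orthogonal to \<open>freq p\<close>, the full
      frequency \<open>l\<close> may be replaced by \<open>l - p\<close>, the frequency carried by
      the Leray part.\<close>
    have Uk: "cdot (U p) (k l) = cdot (U p) (k (l - p))"
      unfolding kl[of p, symmetric] cdot_add_right using div[of p] by (simp add: U_def k_def)
    have W: "W (l - p) = U (l - p) + D" by (simp add: D_def)
    show ?thesis
      unfolding D_def[symmetric] lp unfolding W Uk kb'[of p] cdot_scale_left cdot_scale_right cdot_add_left cdot_add_right cdot_diff_left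
        cdot_diff_right cdot_commute[of b]
      by (simp add: algebra_simps)
  qed
  show ?thesis
    using HS[unfolded eq G0 diff_0_right] unfolding U_def W_def k_def b_def Let_def cdot_add_left cdot_diff_left .
qed

lemma norm_leray_part_le: "norm (leray_part z k) \<le> 2 * norm z"
proof (cases "k = 0")
  case True
  then show ?thesis by (simp add: leray_part_def)
next
  case False
  then have k: "0 < norm (freq k)" by (auto simp: vec_eq_iff)
  let ?z = "cdot z (cvec (freq k)) / of_real ((norm (freq k))\<^sup>2)"
  have "norm (?z *s cvec (freq k)) = cmod ?z * norm (freq k)"
    by (simp only: norm_cscale norm_cvec)
  also have "\<dots> = norm (cdot z (cvec (freq k))) / norm (freq k)"
    using k by (simp add: norm_divide norm_mult power2_eq_square)
  also have "\<dots> \<le> norm z"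
    using norm_cdot_le[of z "cvec (freq k)"] k by (simp add: divide_le_eq)
  finally show ?thesis
    unfolding leray_part_def using norm_triangle_ineq4[of z "?z *s cvec (freq k)"] by linarith
qed

text \<open>The \<open>i\<close>-th unit vector projected onto the orthogonal complement of
  \<open>freq k\<close>, and unchanged for \<open>k = 0\<close>. Pairing with these real directions
  reads off the components of a Leray part, and they are amplitudes of divergence-free
  modes.\<close>

definition pvec :: "int^3 \<Rightarrow> 3 \<Rightarrow> real^3" where
  "pvec k i = axis i 1 - (of_int (k $ i) / (norm (freq k))\<^sup>2) *\<^sub>R freq k"

lemma pvec_orth: "pvec k i \<bullet> freq k = 0"
proof (cases "k = 0")
  case False
  then have "freq k \<noteq> 0" by (auto simp: vec_eq_iff)
  then show ?thesis
    by (simp add: pvec_def inner_diff_left inner_axis' power2_norm_eq_inner)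
qed simp

lemma norm_pvec_le: "norm (pvec k i) \<le> 2"
proof (cases "k = 0")
  case True
  then show ?thesis by (simp add: pvec_def)
next
  case False
  then have k: "0 < norm (freq k)" by (auto simp: vec_eq_iff)
  have "norm ((of_int (k $ i) / (norm (freq k))\<^sup>2) *\<^sub>R freq k) = \<bar>freq k $ i\<bar> / norm (freq k)"
    using k by (simp add: power2_eq_square)
  also have "\<dots> \<le> 1" using component_le_norm_cart[of "freq k" i] k by (simp add: divide_le_eq)
  finally have "norm ((of_int (k $ i) / (norm (freq k))\<^sup>2) *\<^sub>R freq k) \<le> 1" .
  then show ?thesis
    unfolding pvec_def using norm_triangle_ineq4[of "axis i 1" "(of_int (k $ i) / (norm (freq k))\<^sup>2) *\<^sub>R freq k"] by simp
qed

lemma leray_part_nth: "leray_part z k $ i = cdot z (cvec (pvec k i))"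
proof -
  have "cvec (pvec k i) = axis i 1 - (of_int (k $ i) / of_real ((norm (freq k))\<^sup>2)) *s cvec (freq k)"
    by (simp add: vec_eq_iff pvec_def axis_def)
  moreover have "cdot z (axis i 1) = z $ i" by (simp add: cdot_def axis_def if_distrib cong: if_cong)
  ultimately show ?thesis
    by (simp add: leray_part_def cdot_diff_right cdot_scale_right)
qed


section \<open>Single-frequency fields as test functions\<close>

definition trig_field :: "int^3 \<Rightarrow> real \<Rightarrow> real^3 \<Rightarrow> field" where
  "trig_field k \<theta> a x = trig k \<theta> x *\<^sub>R a"

lemma L2_inner_trig_field:
  assumes "\<And>i. integrable torus (\<lambda>x. f x $ i)"
  shows "L2_inner f (trig_field k \<theta> a) = (\<Sum>i\<in>UNIV. a $ i * (\<integral>x. f x $ i * trig k \<theta> x \<partial>torus))"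
proof -
  have "L2_inner f (trig_field k \<theta> a) = (\<integral>x. (\<Sum>i\<in>UNIV. a $ i * (f x $ i * trig k \<theta> x)) \<partial>torus)"
    unfolding L2_inner_def trig_field_def inner_vec_def by (intro Bochner_Integration.integral_cong sum.cong) auto
  also have "\<dots> = (\<Sum>i\<in>UNIV. a $ i * (\<integral>x. f x $ i * trig k \<theta> x \<partial>torus))"
    by (subst Bochner_Integration.integral_sum) (auto intro!: integrable_mult_right integrable_times_trig assms)
  finally show ?thesis .
qed

text \<open>The dictionary between the weak formulations, which pair with real fields, and the
  complex coefficients.\<close>

lemma cdot_fourier_trig_field:
  assumes "\<And>i. integrable torus (\<lambda>x. f x $ i)"
  shows "cdot (fourier_coeff f k) (cvec a) = Complex (L2_inner f (trig_field k 0 a)) (L2_inner f (trig_field k (pi / 2) a)) / of_real vol"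
proof -
  have "fourier_coeff f k $ i = Complex (\<integral>x. f x $ i * trig k 0 x \<partial>torus) (\<integral>x. f x $ i * trig k (pi / 2) x \<partial>torus) / of_real vol" for i
    unfolding fourier_coeff_component component_def[abs_def] by (rule coef_real[OF assms])
  then show ?thesis
    unfolding L2_inner_trig_field[OF assms] cdot_def sum_3 by (simp add: complex_eq_iff algebra_simps add_divide_distrib)
qed

lemma trig_field_L2: "trig_field k \<theta> a \<in> L2"
proof (rule L2I)
  show "periodic (trig_field k \<theta> a)" using periodic_trig[of k \<theta>] by (simp add: periodic_def trig_field_def)
  show "(\<lambda>x. trig_field k \<theta> a x $ i) \<in> borel_measurable torus" for i
    unfolding trig_field_def by simp
  show "integrable torus (\<lambda>x. (trig_field k \<theta> a x $ i)\<^sup>2)" for i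
    unfolding trig_field_def by (intro torus_integrable_continuous) (auto intro!: continuous_intros trig_continuous)
qed

lemma pd_trig_field: "pd j (trig_field k \<theta> a) = trig_field k (\<theta> + pi / 2) (of_int (k $ j) *\<^sub>R a)"
proof
  fix x
  have "((\<lambda>x. trig k \<theta> x *\<^sub>R a) has_derivative (\<lambda>v. frechet_derivative (trig k \<theta>) (at x) v *\<^sub>R a)) (at x)"
    by (intro has_derivative_scaleR_left smooth_has_derivative smooth_trig)
  then have "pd j (trig_field k \<theta> a) x = pd j (trig k \<theta>) x *\<^sub>R a"
    unfolding trig_field_def[abs_def] by (subst pd_eqI) (auto simp: pd_def)
  then show "pd j (trig_field k \<theta> a) x = trig_field k (\<theta> + pi / 2) (of_int (k $ j) *\<^sub>R a) x"
    by (simp add: pd_trig trig_field_def mult.commute)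
qed

text \<open>The mode is an eigenfunction of the Laplacian: integration by parts and the two
  quarter-period shifts contribute signs that cancel, leaving the positive factor
  \<open>(norm (freq k))^2\<close>.\<close>

lemma grad_inner_trig_field:
  assumes f: "f \<in> H (3/2)"
  shows "grad_inner f (trig_field k \<theta> a) = (norm (freq k))\<^sup>2 * L2_inner f (trig_field k \<theta> a)"
proof -
  have fi: "integrable torus (\<lambda>x. f x $ i)" for i using L2_nth_integrable[OF H_L2[OF f]] .
  have "L2_inner (weak_pd j f) (pd j (trig_field k \<theta> a)) = (of_int (k $ j))\<^sup>2 * L2_inner f (trig_field k \<theta> a)" for j
  proof -
    have wi: "integrable torus (\<lambda>x. weak_pd j f x $ i)" for i
      using L2_nth_integrable[OF H32_weak_pd_L2[OF f]] .
    have "(\<integral>x. weak_pd j f x $ i * trig k (\<theta> + pi / 2) x \<partial>torus) = of_int (k $ j) * (\<integral>x. f x $ i * trig k \<theta> x \<partial>torus)" for i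
      unfolding has_weak_pd_trig[OF H_L2[OF f] H32_weak_pd[OF f]] trig_pi by simp
    then show ?thesis
      unfolding pd_trig_field L2_inner_trig_field[OF wi] L2_inner_trig_field[OF fi]
      by (simp add: sum_distrib_left power2_eq_square mult_ac)
  qed
  then show ?thesis
    unfolding grad_inner_def norm_vec_sq by (simp add: sum_distrib_right)
qed

text \<open>Real modes serve as potentials; their phases are chosen so that the gradients have the
  phases 0 and \<open>pi / 2\<close>, that is, detect real and imaginary part.\<close>

lemma L2_sigma_div:
  assumes f: "f \<in> L2_sigma"
  shows "cdot (fourier_coeff f k) (cvec (freq k)) = 0"
proof -
  have fi: "integrable torus (\<lambda>x. f x $ i)" for i
    using f by (intro L2_nth_integrable) (simp add: L2_sigma_def)
  have z: "L2_inner f (trig_field k (\<theta> + pi / 2) (freq k)) = 0" for \<theta>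
  proof -
    have "(\<integral>x. f x \<bullet> (\<chi> i. pd i (trig k \<theta>) x) \<partial>torus) = 0"
      using f smooth_trig periodic_trig by (auto simp: L2_sigma_def)
    moreover have "(\<chi> i. pd i (trig k \<theta>) x) = trig_field k (\<theta> + pi / 2) (freq k) x" for x
      by (simp add: vec_eq_iff pd_trig trig_field_def mult.commute)
    ultimately show ?thesis by (simp add: L2_inner_def)
  qed
  show ?thesis
    unfolding cdot_fourier_trig_field[OF fi] using z[of 0] z[of "- (pi / 2)"] by (simp add: complex_eq_iff)
qed

lemma trig_field_L2_sigma:
  assumes "a \<bullet> freq k = 0"
  shows "trig_field k \<theta> a \<in> L2_sigma"
  unfolding L2_sigma_def
proof (intro CollectI conjI trig_field_L2 allI impI)
  fix \<eta> :: "real^3 \<Rightarrow> real" assume \<eta>: "smooth \<eta> \<and> periodic \<eta>"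
  have "(\<integral>x. trig_field k \<theta> a x \<bullet> (\<chi> i. pd i \<eta> x) \<partial>torus) = (\<integral>x. (\<Sum>i\<in>UNIV. a $ i * (pd i \<eta> x * trig k \<theta> x)) \<partial>torus)"
    unfolding trig_field_def inner_vec_def by (intro Bochner_Integration.integral_cong sum.cong) auto
  also have "\<dots> = (\<Sum>i\<in>UNIV. a $ i * (\<integral>x. pd i \<eta> x * trig k \<theta> x \<partial>torus))"
    using \<eta> by (subst Bochner_Integration.integral_sum)
      (auto intro!: integrable_mult_right torus_integrable_continuous smooth_continuous smooth_mult smooth_pd smooth_trig)
  also have "\<dots> = (\<Sum>i\<in>UNIV. a $ i * (- of_int (k $ i) * (\<integral>x. \<eta> x * trig k (\<theta> + pi / 2) x \<partial>torus)))"
    using \<eta> by (intro sum.cong refl arg_cong2[where f="(*)"] integral_pd_trig) auto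
  also have "(\<Sum>i\<in>UNIV. a $ i * (- of_int (k $ i) * (\<integral>x. \<eta> x * trig k (\<theta> + pi / 2) x \<partial>torus)))
      = - (a \<bullet> freq k) * (\<integral>x. \<eta> x * trig k (\<theta> + pi / 2) x \<partial>torus)"
    unfolding inner_vec_def sum_3 by (simp add: algebra_simps)
  finally show "(\<integral>x. trig_field k \<theta> a x \<bullet> (\<chi> i. pd i \<eta> x) \<partial>torus) = 0" using assms by simp
qed

text \<open>A vanishing Leray part means that each coefficient of \<open>d\<close> is parallel to
  its frequency, while those of \<open>h\<close> are orthogonal to it; Parseval's identity then sums
  zeros. This leads back from coefficients to the relation \<open>leray\<close>.\<close>

lemma L2_inner_zero:
  assumes d: "d \<in> L2" and h: "h \<in> L2_sigma" and z: "\<And>k. leray_part (fourier_coeff d k) k = 0"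
  shows "L2_inner d h = 0"
proof -
  have hL: "h \<in> L2" using h by (simp add: L2_sigma_def)
  have "((\<lambda>k. \<Sum>i\<in>UNIV. coef (component d i) k * cnj (coef (component h i) k)) has_sum (\<Sum>i\<in>UNIV. cL2_inner (component d i) (component h i) / of_real vol)) UNIV"
    by (intro has_sum_sum3 parseval_cL2_inner L2_component d hL)
  moreover have "(\<Sum>i\<in>UNIV. coef (component d i) k * cnj (coef (component h i) k)) = 0" for k
  proof -
    obtain c where c: "fourier_coeff d k = c *s cvec (freq k)"
      using z[of k] unfolding leray_part_def by (metis eq_iff_diff_eq_0)
    have "(\<Sum>i\<in>UNIV. coef (component d i) k * cnj (coef (component h i) k)) = c * cnj (cdot (fourier_coeff h k) (cvec (freq k)))"
      unfolding fourier_coeff_component[symmetric] c by (simp add: cdot_def sum_distrib_left mult_ac)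
    then show ?thesis using L2_sigma_div[OF h] by simp
  qed
  ultimately have "((\<lambda>k::int^3. 0) has_sum (\<Sum>i\<in>UNIV. cL2_inner (component d i) (component h i) / of_real vol)) UNIV" by simp
  then have "(\<Sum>i\<in>UNIV. cL2_inner (component d i) (component h i) / of_real vol) = 0"
    by (rule has_sum_unique) (rule has_sum_0, simp)
  then have "(\<Sum>i\<in>UNIV. cL2_inner (component d i) (component h i)) = 0"
    by (simp add: sum_divide_distrib[symmetric])
  moreover have "cL2_inner (component d i) (component h i) = of_real (\<integral>x. d x $ i * h x $ i \<partial>torus)" for i
    unfolding cL2_inner_def component_def by (simp flip: integral_complex_of_real)
  ultimately have "(\<Sum>i\<in>UNIV. \<integral>x. d x $ i * h x $ i \<partial>torus) = 0"
    by (simp only: of_real_sum[symmetric] of_real_eq_0_iff)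
  moreover have "integrable torus (\<lambda>x. d x $ i * h x $ i)" for i
    using component_mult_integrable[OF d hL, of i i] unfolding component_def of_real_mult[symmetric] integrable_of_real_iff .
  ultimately show ?thesis
    by (simp add: L2_inner_def inner_vec_def)
qed

text \<open>Both terms of the series carry a factor \<open>freq (l - p)\<close> once the divergence
  condition has replaced \<open>l\<close>, so all derivatives sit on \<open>V\<close> and none on
  \<open>u\<close>. This is the distribution that the product estimate can handle.\<close>

lemma nonlinear_bound:
  assumes u: "u \<in> H (3/2)" and w: "w \<in> H (3/2)"
    and div: "\<And>k. cdot (fourier_coeff u k) (cvec (freq k)) = 0"
    and a: "a \<bullet> freq l = 0"
  defines "V \<equiv> \<lambda>q. leray_part (fourier_coeff w q - fourier_coeff u q) q"
  assumes sm: "(\<lambda>p. norm (fourier_coeff u p) * (norm (freq (l - p)) * norm (V (l - p)))) summable_on UNIV"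
  shows "norm (cdot (fourier_coeff (convection u w) l + fourier_coeff (grad_transpose u w) l - fourier_coeff (convection u u) l) (cvec a))
    \<le> 2 * norm a * (\<Sum>\<^sub>\<infinity>p. norm (fourier_coeff u p) * (norm (freq (l - p)) * norm (V (l - p))))"
proof -
  define U where "U = fourier_coeff u"
  define t where "t p = \<i> * (cdot (U p) (cvec (freq l)) * cdot (V (l - p)) (cvec a) - cdot (cvec a) (cvec (freq (l - p))) * cdot (U p) (V (l - p)))" for p
  have hs: "(t has_sum cdot (fourier_coeff (convection u w) l + fourier_coeff (grad_transpose u w) l - fourier_coeff (convection u u) l) (cvec a)) UNIV"
    using nonlinear_has_sum[OF u w div a] unfolding t_def V_def U_def Let_def .
  have b: "norm (t p) \<le> 2 * norm a * (norm (U p) * (norm (freq (l - p)) * norm (V (l - p))))" for p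
  proof -
    have "cvec (freq l) = cvec (freq p) + cvec (freq (l - p))" by (simp add: cvec_add[symmetric] freq_add[symmetric])
    then have "cdot (U p) (cvec (freq l)) = cdot (U p) (cvec (freq (l - p)))"
      using div[of p] by (simp add: cdot_add_right U_def)
    then have 1: "norm (cdot (U p) (cvec (freq l))) \<le> norm (U p) * norm (freq (l - p))"
      using norm_cdot_le[of "U p" "cvec (freq (l - p))"] by simp
    have "norm (cdot (U p) (cvec (freq l)) * cdot (V (l - p)) (cvec a))
        \<le> (norm (U p) * norm (freq (l - p))) * (norm (V (l - p)) * norm a)"
      unfolding norm_mult using norm_cdot_le[of "V (l - p)" "cvec a"] by (intro mult_mono 1) auto
    moreover have "norm (cdot (cvec a) (cvec (freq (l - p))) * cdot (U p) (V (l - p)))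
        \<le> (norm a * norm (freq (l - p))) * (norm (U p) * norm (V (l - p)))"
      unfolding norm_mult using norm_cdot_le[of "cvec a" "cvec (freq (l - p))"] norm_cdot_le[of "U p" "V (l - p)"]
      by (intro mult_mono) auto
    moreover have "norm (t p) \<le> norm (cdot (U p) (cvec (freq l)) * cdot (V (l - p)) (cvec a))
       + norm (cdot (cvec a) (cvec (freq (l - p))) * cdot (U p) (V (l - p)))"
      unfolding t_def norm_mult[of \<i>] by (simp add: norm_triangle_ineq4)
    ultimately show ?thesis by (simp add: mult_ac)
  qed
  have sm2: "(\<lambda>p. 2 * norm a * (norm (U p) * (norm (freq (l - p)) * norm (V (l - p))))) summable_on UNIV"
    using sm unfolding U_def by (rule summable_on_cmult_right)
  have st: "(\<lambda>p. norm (t p)) summable_on UNIV"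
    by (rule summable_on_comparison_test[OF sm2]) (use b in auto)
  have "norm (infsum t UNIV) \<le> (\<Sum>\<^sub>\<infinity>p. norm (t p))" by (rule norm_infsum_bound[OF st])
  also have "\<dots> \<le> (\<Sum>\<^sub>\<infinity>p. 2 * norm a * (norm (U p) * (norm (freq (l - p)) * norm (V (l - p)))))"
    by (intro infsum_mono st sm2 b)
  also have "\<dots> = 2 * norm a * (\<Sum>\<^sub>\<infinity>p. norm (U p) * (norm (freq (l - p)) * norm (V (l - p))))"
    by (rule infsum_cmult_right) (use sm in \<open>simp add: U_def\<close>)
  finally show ?thesis using infsumI[OF hs] by (simp add: U_def)
qed

subsection \<open>Measurability in time\<close>

text \<open>Rests on the completeness of Lebesgue measure.\<close>

lemma measurable_AE_eq:
  fixes f g :: "real \<Rightarrow> 'b::euclidean_space"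
  assumes g: "g \<in> borel_measurable (lebesgue_on S)" and S: "S \<in> sets lebesgue"
    and ae: "AE x in lebesgue_on S. g x = f x"
  shows "f \<in> borel_measurable (lebesgue_on S)"
proof -
  obtain N where N: "N \<in> null_sets (lebesgue_on S)" "\<And>x. x \<in> space (lebesgue_on S) - N \<Longrightarrow> g x = f x"
    using AE_E3[OF ae] by metis
  have "g \<in> borel_measurable (lebesgue_on (S - N))"
    using g borel_measurable_diff_null[OF N(1) S] by blast
  then have "f \<in> borel_measurable (lebesgue_on (S - N))"
    by (rule measurable_cong[THEN iffD1, rotated]) (use N(2) in simp)
  then show ?thesis using borel_measurable_diff_null[OF N(1) S] by blast
qed

lemma measurable_AE_lim:
  fixes f :: "nat \<Rightarrow> real \<Rightarrow> 'b::euclidean_space"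
  assumes "\<And>n. f n \<in> borel_measurable (lebesgue_on S)" "S \<in> sets lebesgue"
    and "AE x in lebesgue_on S. (\<lambda>n. f n x) \<longlonglongrightarrow> g x"
  shows "g \<in> borel_measurable (lebesgue_on S)"
proof (rule measurable_AE_eq)
  show "(\<lambda>x. lim (\<lambda>n. f n x)) \<in> borel_measurable (lebesgue_on S)"
    by (intro borel_measurable_lim_metric assms)
  show "AE x in lebesgue_on S. lim (\<lambda>n. f n x) = g x"
    using assms(3) by (rule AE_mp) (auto intro!: AE_I2 limI)
qed fact

lemma AE_lebesgue_on_ne: "S \<in> sets lebesgue \<Longrightarrow> AE x in lebesgue_on S. x \<noteq> (c::real)"
proof -
  have "AE s in lebesgue. s \<notin> {c}" by (intro AE_not_in) (simp add: negligible_iff_null_sets[symmetric])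
  then show "S \<in> sets lebesgue \<Longrightarrow> AE x in lebesgue_on S. x \<noteq> c"
    by (subst AE_restrict_space_iff) auto
qed

text \<open>The function spaces live on the open time interval, the weak identities on
  \<open>{0..t}\<close>; the endpoint 0 is a null set.\<close>

lemma AE_lebesgue_on_mono:
  assumes "AE x in lebesgue_on {0<..<T}. P x" "t < (T::real)"
  shows "AE x in lebesgue_on {0..t}. P x"
proof -
  have 1: "AE x in lebesgue. x \<in> {0<..<T} \<longrightarrow> P x"
    using assms(1) by (subst (asm) AE_restrict_space_iff) auto
  have "AE x in lebesgue. x \<notin> {0::real}"
    by (intro AE_not_in) (simp add: negligible_iff_null_sets[symmetric])
  then have 2: "AE x in lebesgue. x \<noteq> (0::real)" by simp
  have "AE x in lebesgue. x \<in> {0..t} \<longrightarrow> P x"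
    using 1 2 by eventually_elim (use assms(2) in auto)
  then show ?thesis by (subst AE_restrict_space_iff) auto
qed

lemma measurable_lebesgue_on_mono:
  fixes f :: "real \<Rightarrow> 'b::euclidean_space"
  assumes "f \<in> borel_measurable (lebesgue_on {0<..<T})" "t < T"
  shows "f \<in> borel_measurable (lebesgue_on {0..t})"
proof -
  have "{0..t} - {0} \<subseteq> {0<..<T}" using assms(2) by auto
  then have "f \<in> borel_measurable (lebesgue_on ({0..t} - {0}))"
    by (rule measurable_restrict_mono[OF assms(1)])
  moreover have "{0} \<in> null_sets (lebesgue_on {0..t})" if "0 \<le> t"
    using that by (subst null_sets_restrict_space) (auto simp: negligible_iff_null_sets[symmetric])
  ultimately show ?thesis
    using borel_measurable_diff_null[of "{0}" "{0..t}" f] by (cases "0 \<le> t") auto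
qed

lemma integrable_lebesgue_on_mono:
  fixes f :: "real \<Rightarrow> 'b::euclidean_space"
  assumes "integrable (lebesgue_on {0<..<T}) f" "t < T"
  shows "integrable (lebesgue_on {0..t}) f"
proof (rule integrable_cong_AE_imp)
  have "integrable lebesgue (\<lambda>x. indicator {0<..<T} x *\<^sub>R f x)"
    using assms(1) by (subst (asm) integrable_restrict_space) auto
  then have "integrable lebesgue (\<lambda>x. indicator {0..t} x *\<^sub>R (indicator {0<..<T} x *\<^sub>R f x))"
    by (intro integrable_mult_indicator[of "{0..t}"]) auto
  then show "integrable (lebesgue_on {0..t}) (\<lambda>x. indicator {0<..<T} x *\<^sub>R f x)"
    by (subst integrable_restrict_space) auto
  show "f \<in> borel_measurable (lebesgue_on {0..t})"
    using assms by (intro measurable_lebesgue_on_mono) auto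
  show "AE x in lebesgue_on {0..t}. indicator {0<..<T} x *\<^sub>R f x = f x"
    using AE_lebesgue_on_ne[of "{0..t}" 0] by (rule AE_mp) (use assms(2) in \<open>auto intro!: AE_I2\<close>)
qed

lemma set_lebesgue_integral_restrict:
  fixes f :: "real \<Rightarrow> 'b::euclidean_space"
  shows "(LINT s:{0..t}|lebesgue. f s) = (\<integral>s. f s \<partial>lebesgue_on {0..t})"
  unfolding set_lebesgue_integral_def by (subst integral_restrict_space) auto

text \<open>Cubes of frequencies exhaust the lattice, so an unordered sum becomes the limit of a
  sequence, the form required for measurability and for dominated convergence.\<close>

lemma has_sum_freq_sup_lim:
  fixes f :: "int^3 \<Rightarrow> 'b::{comm_monoid_add, topological_space}"
  assumes "(f has_sum s) UNIV"
  shows "(\<lambda>n. \<Sum>k | freq_sup k \<le> n. f k) \<longlonglongrightarrow> s"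
proof -
  have "filterlim (\<lambda>n. {k. freq_sup k \<le> n}) (finite_subsets_at_top UNIV) sequentially"
    unfolding filterlim_finite_subsets_at_top
  proof (intro allI impI)
    fix X :: "(int^3) set" assume "finite X \<and> X \<subseteq> UNIV"
    then have X: "finite X" by simp
    show "eventually (\<lambda>n. finite {k. freq_sup k \<le> n} \<and> X \<subseteq> {k. freq_sup k \<le> n} \<and> {k. freq_sup k \<le> n} \<subseteq> UNIV) sequentially"
    proof (rule eventually_sequentiallyI[of "Max (freq_sup ` X)"])
      fix n assume n: "Max (freq_sup ` X) \<le> n"
      have "freq_sup k \<le> n" if "k \<in> X" for k
      proof -
        have "freq_sup k \<le> Max (freq_sup ` X)" using X that by (intro Max_ge) auto
        then show ?thesis using n by linarith
      qed
      then show "finite {k. freq_sup k \<le> n} \<and> X \<subseteq> {k. freq_sup k \<le> n} \<and> {k. freq_sup k \<le> n} \<subseteq> UNIV"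
        using freq_sup_ball(1) by auto
    qed
  qed
  then show ?thesis
    using assms unfolding has_sum_def by (rule filterlim_compose[rotated])
qed

lemma L2_diff:
  assumes "f \<in> L2" "g \<in> L2"
  shows "(\<lambda>x. f x - g x) \<in> L2"
proof (rule L2I)
  show "periodic (\<lambda>x. f x - g x)" using assms by (simp add: L2_def periodic_def)
  have m: "(\<lambda>x. f x $ i) \<in> borel_measurable torus" "(\<lambda>x. g x $ i) \<in> borel_measurable torus" for i
    using L2_nth_integrable[OF assms(1)] L2_nth_integrable[OF assms(2)] by auto
  then show "(\<lambda>x. (f x - g x) $ i) \<in> borel_measurable torus" for i by simp
  show "integrable torus (\<lambda>x. ((f x - g x) $ i)\<^sup>2)" for i
    using cL2_norm_sq_integrable[OF cL2_diff[OF L2_component[OF assms(1)] L2_component[OF assms(2)]], of i i]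
    by (simp add: component_def flip: of_real_diff)
qed

lemma fourier_coeff_diff:
  assumes "f \<in> L2" "g \<in> L2"
  shows "fourier_coeff (\<lambda>x. f x - g x) k = fourier_coeff f k - fourier_coeff g k"
proof (rule vec_eq_iff[THEN iffD2], rule allI)
  fix i
  have "coef (component (\<lambda>x. f x - g x) i) k = coef (\<lambda>x. component f i x - component g i x) k"
    by (simp add: component_def[abs_def])
  then show "fourier_coeff (\<lambda>x. f x - g x) k $ i = (fourier_coeff f k - fourier_coeff g k) $ i"
    by (simp add: fourier_coeff_component coef_diff L2_component assms)
qed

lemma norm_diff_sq_le: "(norm (a - b :: 'a::real_normed_vector))\<^sup>2 \<le> 2 * (norm a)\<^sup>2 + 2 * (norm b)\<^sup>2"
proof -
  have "(norm (a - b))\<^sup>2 \<le> (norm a + norm b)\<^sup>2" by (intro power_mono norm_triangle_ineq4) auto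
  then show ?thesis using square_sum2_le[of "norm a" "norm b"] by linarith
qed

lemma H_diff:
  assumes "f \<in> H s" "g \<in> H s"
  shows "(\<lambda>x. f x - g x) \<in> H s"
proof -
  have L: "f \<in> L2" "g \<in> L2" using assms H_L2 by auto
  have "H_weight s (\<lambda>x. f x - g x) summable_on UNIV"
  proof (rule summable_on_comparison_test)
    show "(\<lambda>k. 2 * H_weight s f k + 2 * H_weight s g k) summable_on UNIV"
      using assms by (intro summable_on_add summable_on_cmult_right) (auto simp: H_def)
    fix k
    have "H_weight s (\<lambda>x. f x - g x) k
       \<le> (1 + norm (freq k) powr (2 * s)) * (2 * (norm (fourier_coeff f k))\<^sup>2 + 2 * (norm (fourier_coeff g k))\<^sup>2)"
      unfolding H_weight_def fourier_coeff_diff[OF L] by (intro mult_left_mono norm_diff_sq_le) simp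
    then show "H_weight s (\<lambda>x. f x - g x) k \<le> 2 * H_weight s f k + 2 * H_weight s g k"
      by (simp add: H_weight_def algebra_simps)
  qed (simp add: H_weight_nonneg)
  then show ?thesis using L2_diff[OF L] by (simp add: H_def)
qed

lemma fourier_coeff_le_H_norm:
  assumes "f \<in> H s"
  shows "norm (fourier_coeff f k) \<le> H_norm s f"
proof -
  have "(norm (fourier_coeff f k))\<^sup>2 \<le> (H_norm s f)\<^sup>2"
    using H_sum_le'[OF assms, of "{k}" 1 "\<lambda>_. 1"] by simp
  moreover have "0 \<le> H_norm s f"
    by (simp add: H_norm_def infsum_nonneg H_weight_nonneg)
  ultimately show ?thesis by (rule power2_le_imp_le)
qed

text \<open>A single Fourier coefficient is continuous in the Sobolev norm, so it converges along
  the approximating simple functions.\<close>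

lemma strongly_measurable_fourier:
  assumes "strongly_measurable T (H s) (H_norm s) v"
  shows "(\<lambda>t. fourier_coeff (v t) k $ i) \<in> borel_measurable (lebesgue_on {0<..<T})"
proof -
  obtain \<sigma> where v: "AE t in lebesgue_on {0<..<T}. v t \<in> H s"
    and s: "\<And>n::nat. simple_function (lebesgue_on {0<..<T}) (\<sigma> n)" "\<And>n t. t \<in> {0<..<T} \<Longrightarrow> \<sigma> n t \<in> H s"
    and l: "AE t in lebesgue_on {0<..<T}. (\<lambda>n. H_norm s (\<lambda>x. \<sigma> n t x - v t x)) \<longlonglongrightarrow> 0"
    using assms unfolding strongly_measurable_def by blast
  show ?thesis
  proof (rule measurable_AE_lim)
    show "(\<lambda>t. fourier_coeff (\<sigma> n t) k $ i) \<in> borel_measurable (lebesgue_on {0<..<T})" for n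
      by (rule borel_measurable_simple_function[OF simple_function_compose1[OF s(1)]])
    show "AE t in lebesgue_on {0<..<T}. (\<lambda>n. fourier_coeff (\<sigma> n t) k $ i) \<longlonglongrightarrow> fourier_coeff (v t) k $ i"
      using v l AE_space
    proof eventually_elim
      case (elim t)
      have t: "t \<in> {0<..<T}" using elim(3) by simp
      have b: "norm (fourier_coeff (\<sigma> n t) k $ i - fourier_coeff (v t) k $ i) \<le> H_norm s (\<lambda>x. \<sigma> n t x - v t x)" for n
      proof -
        have "norm ((fourier_coeff (\<sigma> n t) k - fourier_coeff (v t) k) $ i) \<le> norm (fourier_coeff (\<sigma> n t) k - fourier_coeff (v t) k)"
          by (rule Finite_Cartesian_Product.norm_nth_le)
        also have "\<dots> = norm (fourier_coeff (\<lambda>x. \<sigma> n t x - v t x) k)"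
          using fourier_coeff_diff[OF H_L2[OF s(2)[OF t]] H_L2[OF elim(1)]] by simp
        also have "\<dots> \<le> H_norm s (\<lambda>x. \<sigma> n t x - v t x)"
          by (intro fourier_coeff_le_H_norm H_diff s t elim)
        finally show ?thesis by simp
      qed
      have "(\<lambda>n. fourier_coeff (\<sigma> n t) k $ i - fourier_coeff (v t) k $ i) \<longlonglongrightarrow> 0"
        by (rule Lim_null_comparison[OF _ elim(2)]) (use b in simp)
      then show ?case by (rule LIM_zero_cancel)
    qed
  qed simp
qed

text \<open>A test field that is constant in time up to \<open>t\<close>: its time derivative drops
  out of the weak identities, which then become integral equations for one Fourier mode.\<close>

lemma trig_field_test_field:
  assumes "t < T"
  obtains \<phi> where "test_field T \<phi>" "\<And>s. s \<le> t \<Longrightarrow> \<phi> s = trig_field k \<theta> a" "\<And>s x. s \<le> t \<Longrightarrow> time_deriv \<phi> s x = 0"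
    "a \<bullet> freq k = 0 \<Longrightarrow> div_free_test_field T \<phi>"
proof -
  \<comment> \<open>The plateau extends beyond \<open>t\<close>, so that the time derivative
    vanishes at \<open>t\<close> itself.\<close>
  define p where "p = t + (T - t) / 3"
  define q where "q = t + 2 * (T - t) / 3"
  have pq: "t < p" "p < q" "q < T" using assms by (auto simp: p_def q_def field_simps)
  obtain c :: "real \<Rightarrow> real" where c: "smooth c" "\<And>x. x \<le> p \<Longrightarrow> c x = 1" "\<And>x. x \<ge> q \<Longrightarrow> c x = 0"
    using smooth_cutoff[OF pq(2)] by blast
  define \<phi> :: "real \<Rightarrow> field" where "\<phi> s x = (c s * trig k \<theta> x) *\<^sub>R a" for s x
  have eq: "\<phi> s = trig_field k \<theta> a" if "s \<le> p" for s
    using c(2)[OF that] by (auto simp: \<phi>_def trig_field_def)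
  have "smooth (\<lambda>(s, x). \<phi> s x)"
  proof -
    have 1: "Ck n (\<lambda>z :: real \<times> (real^3). c (fst z))" for n
      by (rule Ck_comp_bounded_linear[OF bounded_linear_fst]) (use c(1) in \<open>simp add: smooth_def\<close>)
    have 2: "Ck n (\<lambda>z :: real \<times> (real^3). trig k \<theta> (snd z))" for n
      by (rule Ck_comp_bounded_linear[OF bounded_linear_snd Ck_trig])
    have "Ck n (\<lambda>z :: real \<times> (real^3). (c (fst z) * trig k \<theta> (snd z)) *\<^sub>R a)" for n
      by (rule Ck_bounded_linear_comp[OF bounded_linear_scaleR_left Ck_mult[OF 1 2]])
    then show ?thesis by (simp add: smooth_def \<phi>_def case_prod_unfold)
  qed
  moreover have "periodic (\<phi> s)" for s
    using periodic_trig[of k \<theta>] by (simp add: periodic_def \<phi>_def)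
  moreover have "\<exists>T'<T. \<forall>t\<ge>T'. \<forall>x. \<phi> t x = 0"
    using pq c(3) by (intro exI[of _ q]) (simp add: \<phi>_def)
  ultimately have tf: "test_field T \<phi>" by (simp add: test_field_def)
  have td: "time_deriv \<phi> s x = 0" if "s \<le> t" for s x
  proof -
    have "((\<lambda>r. \<phi> r x) has_vector_derivative 0) (at s)"
    proof (rule has_vector_derivative_transform_within_open)
      show "((\<lambda>r. trig_field k \<theta> a x) has_vector_derivative 0) (at s)" by simp
      show "s \<in> {..<p}" using that pq by simp
      show "trig_field k \<theta> a x = \<phi> r x" if "r \<in> {..<p}" for r using eq[of r] that by simp
    qed simp
    then show ?thesis unfolding time_deriv_def by (rule vector_derivative_at)
  qed
  have "div_free_test_field T \<phi>" if "a \<bullet> freq k = 0"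
    unfolding div_free_test_field_def
  proof (intro conjI tf ballI allI)
    fix s x
    have "\<phi> s = trig_field k \<theta> (c s *\<^sub>R a)" by (auto simp: \<phi>_def trig_field_def)
    then have "(\<Sum>i\<in>UNIV. pd i (\<phi> s) x $ i) = c s * trig k (\<theta> + pi / 2) x * (a \<bullet> freq k)"
      by (simp add: pd_trig_field trig_field_def inner_vec_def sum_distrib_left mult_ac)
    then show "(\<Sum>i\<in>UNIV. pd i (\<phi> s) x $ i) = 0" using that by simp
  qed
  then show ?thesis using that tf eq td pq by (metis less_imp_le order_trans)
qed

section \<open>Bounds for convolutions and for the nonlinear terms\<close>

lemma fourier_L2_sum_le:
  assumes "f \<in> L2" "finite F"
  shows "(\<Sum>k\<in>F. (norm (fourier_coeff f k))\<^sup>2) \<le> (\<Sum>i\<in>UNIV. cL2_sqnorm (component f i) / vol)"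
proof -
  have "(norm (fourier_coeff f k))\<^sup>2 = (\<Sum>i\<in>UNIV. (cmod (coef (component f i) k))\<^sup>2)" for k
    by (simp add: norm_vec_def L2_set_def sum_nonneg fourier_coeff_component)
  then have "(\<Sum>k\<in>F. (norm (fourier_coeff f k))\<^sup>2) = (\<Sum>i\<in>UNIV. \<Sum>k\<in>F. (cmod (coef (component f i) k))\<^sup>2)"
    by (simp add: sum.swap[of _ F])
  also have "\<dots> \<le> (\<Sum>i\<in>UNIV. cL2_sqnorm (component f i) / vol)"
    using bessel[OF assms(2) L2_component[OF assms(1)]] by (intro sum_mono) (simp add: field_simps)
  finally show ?thesis .
qed

lemma has_sum_norm_le:
  fixes f :: "int^3 \<Rightarrow> complex"
  assumes "(f has_sum s) UNIV" "\<And>F. finite F \<Longrightarrow> (\<Sum>k\<in>F. norm (f k)) \<le> B"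
  shows "norm s \<le> B"
proof (rule LIMSEQ_le_const2)
  show "(\<lambda>n. norm (\<Sum>k | freq_sup k \<le> n. f k)) \<longlonglongrightarrow> norm s"
    by (intro tendsto_norm has_sum_freq_sup_lim assms)
  show "\<exists>N. \<forall>n\<ge>N. norm (\<Sum>k | freq_sup k \<le> n. f k) \<le> B"
    by (intro exI allI impI order_trans[OF norm_sum]) (rule assms(2)[OF freq_sup_ball(1)])
qed

text \<open>A crude bound by \<open>x * y \<le> x^2 + y^2\<close>, used for summability and for
  integrability in time; the quantitative estimate comes from
  \<open>trilinear_finite\<close>.\<close>

lemma sum_convolution_le:
  fixes a b :: "int^3 \<Rightarrow> real"
  assumes "finite F" "\<And>G. finite G \<Longrightarrow> (\<Sum>p\<in>G. (a p)\<^sup>2) \<le> A" "\<And>G. finite G \<Longrightarrow> (\<Sum>p\<in>G. (b p)\<^sup>2) \<le> B"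
    "\<And>p. 0 \<le> a p" "\<And>p. 0 \<le> b p"
  shows "(\<Sum>p\<in>F. a p * b (l - p)) \<le> A + B"
proof -
  have "(\<Sum>p\<in>F. a p * b (l - p)) \<le> (\<Sum>p\<in>F. (a p)\<^sup>2 + (b (l - p))\<^sup>2)"
  proof (rule sum_mono)
    fix p
    have "2 * (a p * b (l - p)) \<le> (a p)\<^sup>2 + (b (l - p))\<^sup>2"
      using sum_squares_bound[of "a p" "b (l - p)"] by simp
    moreover have "0 \<le> a p * b (l - p)" using assms by simp
    ultimately show "a p * b (l - p) \<le> (a p)\<^sup>2 + (b (l - p))\<^sup>2" by linarith
  qed
  also have "\<dots> = (\<Sum>p\<in>F. (a p)\<^sup>2) + (\<Sum>p\<in>F. (b (l - p))\<^sup>2)" by (rule sum.distrib)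
  also have "(\<Sum>p\<in>F. (b (l - p))\<^sup>2) = (\<Sum>q\<in>(\<lambda>p. l - p) ` F. (b q)\<^sup>2)"
    by (subst sum.reindex) (auto simp: inj_on_def)
  also have "(\<Sum>p\<in>F. (a p)\<^sup>2) + (\<Sum>q\<in>(\<lambda>p. l - p) ` F. (b q)\<^sup>2) \<le> A + B"
    using assms by (intro add_mono) auto
  finally show ?thesis .
qed

text \<open>The right-hand side is integrable in time for fields in \<open>Hhalf_class\<close>,
  which is the purpose of the bound.\<close>

lemma fourier_convection_le:
  assumes u: "u \<in> H (3/2)" and w: "w \<in> H (3/2)"
  shows "norm (fourier_coeff (convection u w) l $ i) \<le> (H_norm (3/2) u)\<^sup>2 + (H_norm (3/2) w)\<^sup>2"
proof (rule has_sum_norm_le[OF fourier_convection[OF H_L2[OF u] w]])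
  fix F :: "(int^3) set" assume F: "finite F"
  have "(\<Sum>p\<in>F. norm (\<i> * cdot (fourier_coeff u p) (cvec (freq (l - p))) * fourier_coeff w (l - p) $ i))
     \<le> (\<Sum>p\<in>F. norm (fourier_coeff u p) * (norm (freq (l - p)) * norm (fourier_coeff w (l - p))))"
  proof (rule sum_mono)
    fix p
    have "norm (cdot (fourier_coeff u p) (cvec (freq (l - p))) * fourier_coeff w (l - p) $ i)
      \<le> (norm (fourier_coeff u p) * norm (freq (l - p))) * norm (fourier_coeff w (l - p))"
      unfolding norm_mult using norm_cdot_le[of "fourier_coeff u p" "cvec (freq (l - p))"]
      by (intro mult_mono Finite_Cartesian_Product.norm_nth_le) auto
    then show "norm (\<i> * cdot (fourier_coeff u p) (cvec (freq (l - p))) * fourier_coeff w (l - p) $ i)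
      \<le> norm (fourier_coeff u p) * (norm (freq (l - p)) * norm (fourier_coeff w (l - p)))"
      by (simp add: norm_mult mult.assoc)
  qed
  also have "\<dots> \<le> (H_norm (3/2) u)\<^sup>2 + (H_norm (3/2) w)\<^sup>2"
    by (rule sum_convolution_le[where b="\<lambda>q. norm (freq q) * norm (fourier_coeff w q)"])
      (use F H32_sum0[OF u] H32_sum1[OF w] in \<open>auto simp: power_mult_distrib\<close>)
  finally show "(\<Sum>p\<in>F. norm (\<i> * cdot (fourier_coeff u p) (cvec (freq (l - p))) * fourier_coeff w (l - p) $ i))
     \<le> (H_norm (3/2) u)\<^sup>2 + (H_norm (3/2) w)\<^sup>2" .
qed

lemma fourier_grad_transpose_le:
  assumes u: "u \<in> H (3/2)" and w: "w \<in> H (3/2)"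
  shows "norm (fourier_coeff (grad_transpose u w) l $ i) \<le> (H_norm (3/2) u)\<^sup>2 + (H_norm (3/2) w)\<^sup>2"
proof (rule has_sum_norm_le[OF fourier_grad_transpose[OF u H_L2[OF w]]])
  fix F :: "(int^3) set" assume F: "finite F"
  have "(\<Sum>p\<in>F. norm (\<i> * of_int (p $ i) * cdot (fourier_coeff u p) (fourier_coeff w (l - p))))
     \<le> (\<Sum>p\<in>F. (norm (freq p) * norm (fourier_coeff u p)) * norm (fourier_coeff w (l - p)))"
  proof (rule sum_mono)
    fix p
    have "norm (complex_of_int (p $ i)) \<le> norm (freq p)"
      using component_le_norm_cart[of "freq p" i] by simp
    then have "norm (complex_of_int (p $ i) * cdot (fourier_coeff u p) (fourier_coeff w (l - p)))
      \<le> norm (freq p) * (norm (fourier_coeff u p) * norm (fourier_coeff w (l - p)))"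
      unfolding norm_mult by (intro mult_mono norm_cdot_le) auto
    then show "norm (\<i> * of_int (p $ i) * cdot (fourier_coeff u p) (fourier_coeff w (l - p)))
      \<le> (norm (freq p) * norm (fourier_coeff u p)) * norm (fourier_coeff w (l - p))"
      by (simp add: norm_mult mult.assoc)
  qed
  also have "\<dots> \<le> (H_norm (3/2) u)\<^sup>2 + (H_norm (3/2) w)\<^sup>2"
    by (rule sum_convolution_le[where a="\<lambda>q. norm (freq q) * norm (fourier_coeff u q)" and b="\<lambda>q. norm (fourier_coeff w q)"])
      (use F H32_sum1[OF u] H32_sum0[OF w] in \<open>auto simp: power_mult_distrib\<close>)
  finally show "(\<Sum>p\<in>F. norm (\<i> * of_int (p $ i) * cdot (fourier_coeff u p) (fourier_coeff w (l - p))))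
     \<le> (H_norm (3/2) u)\<^sup>2 + (H_norm (3/2) w)\<^sup>2" .
qed

text \<open>Extends \<open>trilinear_finite\<close> to the sum over all \<open>p\<close>; the outer
  sum over \<open>k\<close> stays finite, as in the truncated energy identity.\<close>

lemma convolution_sum_le:
  fixes a b c :: "int^3 \<Rightarrow> real"
  assumes F: "finite F"
    and A: "\<And>S. finite S \<Longrightarrow> (\<Sum>p\<in>S. (bracket p)\<^sup>2 * (a p)\<^sup>2) \<le> A"
    and B: "\<And>S. finite S \<Longrightarrow> (\<Sum>p\<in>S. (b p)\<^sup>2) \<le> B"
    and C: "\<And>S. finite S \<Longrightarrow> (\<Sum>k\<in>S. bracket k * (c k)\<^sup>2) \<le> C"
    and nn: "\<And>p. 0 \<le> a p" "\<And>p. 0 \<le> b p" "\<And>p. 0 \<le> c p"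
  shows "(\<lambda>p. a p * b (k - p)) summable_on UNIV"
    and "(\<Sum>k\<in>F. c k * (\<Sum>\<^sub>\<infinity>p. a p * b (k - p)))\<^sup>2 \<le> 260 * A * B * C"
proof -
  have A0: "(\<Sum>p\<in>S. (a p)\<^sup>2) \<le> A" if "finite S" for S
  proof -
    have "(\<Sum>p\<in>S. (a p)\<^sup>2) \<le> (\<Sum>p\<in>S. (bracket p)\<^sup>2 * (a p)\<^sup>2)"
      by (intro sum_mono) (use one_le_power[OF bracket_ge1] mult_right_mono[of 1 "(bracket _)\<^sup>2"] in force)
    then show ?thesis using A[OF that] by linarith
  qed
  have sm: "(\<lambda>p. a p * b (k - p)) summable_on UNIV" for k
  proof (rule nonneg_bounded_partial_sums_imp_summable_on[where C="A + B"])
    show "eventually (\<lambda>F. (\<Sum>p\<in>F. a p * b (k - p)) \<le> A + B) (finite_subsets_at_top UNIV)"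
      by (rule eventually_finite_subsets_at_top_weakI) (intro sum_convolution_le A0 B nn)
  qed (use nn in simp)
  then show "(\<lambda>p. a p * b (k - p)) summable_on UNIV" .
  have pos: "0 \<le> A" "0 \<le> B" "0 \<le> C" using A[of "{}"] B[of "{}"] C[of "{}"] by auto
  have fin: "(\<Sum>p\<in>G. \<Sum>k\<in>F. c k * (a p * b (k - p))) \<le> sqrt (260 * A * B * C)" if "finite G" for G
  proof (rule real_le_rsqrt)
    have "(\<Sum>p\<in>G. \<Sum>k\<in>F. c k * (a p * b (k - p))) = (\<Sum>k\<in>F. \<Sum>p\<in>G. a p * b (k - p) * c k)"
      by (subst sum.swap) (simp add: mult_ac)
    then show "(\<Sum>p\<in>G. \<Sum>k\<in>F. c k * (a p * b (k - p)))\<^sup>2 \<le> 260 * A * B * C"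
      using trilinear_finite[OF F that A B C] by simp
  qed
  have hs: "((\<lambda>p. \<Sum>k\<in>F. c k * (a p * b (k - p))) has_sum (\<Sum>k\<in>F. c k * (\<Sum>\<^sub>\<infinity>p. a p * b (k - p)))) UNIV"
    using F
  proof (induction F rule: finite_induct)
    case (insert k F)
    then show ?case using sm[of k] by (simp add: has_sum_add has_sum_cmult_right)
  qed simp
  have "(\<Sum>k\<in>F. c k * (\<Sum>\<^sub>\<infinity>p. a p * b (k - p))) \<le> sqrt (260 * A * B * C)"
    using infsum_le_finite_sums[OF has_sum_imp_summable[OF hs] fin] infsumI[OF hs] by simp
  moreover have "0 \<le> (\<Sum>k\<in>F. c k * (\<Sum>\<^sub>\<infinity>p. a p * b (k - p)))"
    using nn by (intro sum_nonneg mult_nonneg_nonneg infsum_nonneg) auto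
  ultimately have "(\<Sum>k\<in>F. c k * (\<Sum>\<^sub>\<infinity>p. a p * b (k - p)))\<^sup>2 \<le> (sqrt (260 * A * B * C))\<^sup>2"
    by (rule power_mono)
  then show "(\<Sum>k\<in>F. c k * (\<Sum>\<^sub>\<infinity>p. a p * b (k - p)))\<^sup>2 \<le> 260 * A * B * C"
    using pos by simp
qed

text \<open>\<open>24 = 2 * 3 * 4\<close> is the factor of the convolution sum in the energy
  estimate: 2 from the derivative of a square, 3 components, and 4 from
  \<open>nonlinear_bound\<close> together with \<open>norm_pvec_le\<close>. It enters with the
  fourth power because of Young's inequality. The factor 260 comes from
  \<open>trilinear_finite\<close>, and \<open>8 = 4 * 2\<close> from the two interpolation
  bounds.\<close>

definition energy_const :: real where "energy_const = 24 ^ 4 * 260 ^ 2 * 8"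

lemma energy_convolution_bound:
  fixes a c :: "int^3 \<Rightarrow> real"
  assumes F: "finite F"
    and a1: "\<And>S. finite S \<Longrightarrow> (\<Sum>p\<in>S. bracket p * (a p)\<^sup>2) \<le> C"
    and a3: "\<And>S. finite S \<Longrightarrow> (\<Sum>p\<in>S. (bracket p) ^ 3 * (a p)\<^sup>2) \<le> 4 * n"
    and Y: "\<And>S. finite S \<Longrightarrow> (\<Sum>p\<in>S. (c p)\<^sup>2) \<le> Y"
    and Z: "\<And>S. finite S \<Longrightarrow> (\<Sum>p\<in>S. (norm (freq p) * c p)\<^sup>2) \<le> Z"
    and nn: "\<And>p. 0 \<le> a p" "\<And>p. 0 \<le> c p"
  shows "(\<lambda>p. a p * (norm (freq (k - p)) * c (k - p))) summable_on UNIV"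
    and "24 * (\<Sum>k\<in>F. c k * (\<Sum>\<^sub>\<infinity>p. a p * (norm (freq (k - p)) * c (k - p)))) \<le> Z + (1 + energy_const * C * n) * Y"
proof -
  have pos: "0 \<le> C" "0 \<le> n" "0 \<le> Y" "0 \<le> Z" using a1[of "{}"] a3[of "{}"] Y[of "{}"] Z[of "{}"] by auto
  \<comment> \<open>Interpolation between the weights \<open>bracket\<close> and
    \<open>bracket^3\<close>: Cauchy-Schwarz for the splitting
    \<open>bracket^2 = bracket^(1/2) * bracket^(3/2)\<close>.\<close>
  have A: "(\<Sum>p\<in>S. (bracket p)\<^sup>2 * (a p)\<^sup>2) \<le> sqrt (4 * C * n)" if H: "finite S" for S
  proof (rule real_le_rsqrt)
    have "(\<Sum>p\<in>S. (bracket p)\<^sup>2 * (a p)\<^sup>2) = (\<Sum>p\<in>S. (sqrt (bracket p) * a p) * (bracket p * sqrt (bracket p) * a p))"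
      by (intro sum.cong refl) (simp add: power2_eq_square bracket_pos less_imp_le mult_ac)
    also have "\<dots>\<^sup>2 \<le> (\<Sum>p\<in>S. (sqrt (bracket p) * a p)\<^sup>2) * (\<Sum>p\<in>S. (bracket p * sqrt (bracket p) * a p)\<^sup>2)"
      by (rule Cauchy_Schwarz_ineq_sum)
    also have "\<dots> = (\<Sum>p\<in>S. bracket p * (a p)\<^sup>2) * (\<Sum>p\<in>S. (bracket p) ^ 3 * (a p)\<^sup>2)"
      by (simp add: power_mult_distrib bracket_pos less_imp_le eval_nat_numeral mult_ac)
    also have "\<dots> \<le> C * (4 * n)"
      by (intro mult_mono a1 a3 H pos sum_nonneg mult_nonneg_nonneg zero_le_power) (auto simp: bracket_pos less_imp_le nn)
    finally show "(\<Sum>p\<in>S. (bracket p)\<^sup>2 * (a p)\<^sup>2)\<^sup>2 \<le> 4 * C * n" by (simp add: mult_ac)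
  qed
  \<comment> \<open>Likewise between the weights 1 and \<open>bracket^2\<close>, using
    \<open>(bracket k)^2 \<le> 2 * (1 + (norm (freq k))^2)\<close>.\<close>
  have Cc: "(\<Sum>k\<in>S. bracket k * (c k)\<^sup>2) \<le> sqrt (2 * Y * (Y + Z))" if H: "finite S" for S
  proof (rule real_le_rsqrt)
    have "(\<Sum>k\<in>S. bracket k * (c k)\<^sup>2) = (\<Sum>k\<in>S. c k * (bracket k * c k))"
      by (simp add: power2_eq_square mult_ac)
    also have "\<dots>\<^sup>2 \<le> (\<Sum>k\<in>S. (c k)\<^sup>2) * (\<Sum>k\<in>S. (bracket k * c k)\<^sup>2)"
      by (rule Cauchy_Schwarz_ineq_sum)
    also have "\<dots> \<le> Y * (2 * (Y + Z))"
    proof (intro mult_mono Y H pos sum_nonneg)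
      have "(\<Sum>k\<in>S. (bracket k * c k)\<^sup>2) \<le> (\<Sum>k\<in>S. 2 * ((c k)\<^sup>2 + (norm (freq k) * c k)\<^sup>2))"
      proof (rule sum_mono)
        fix k
        have "(bracket k)\<^sup>2 \<le> 2 * (1 + (real (freq_sup k))\<^sup>2)"
          using square_sum2_le[of 1 "real (freq_sup k)"] by (simp add: bracket_def)
        also have "\<dots> \<le> 2 * (1 + (norm (freq k))\<^sup>2)" using freq_sup_le_norm by (simp add: power_mono)
        finally have "(bracket k)\<^sup>2 * (c k)\<^sup>2 \<le> 2 * (1 + (norm (freq k))\<^sup>2) * (c k)\<^sup>2" by (rule mult_right_mono) simp
        then show "(bracket k * c k)\<^sup>2 \<le> 2 * ((c k)\<^sup>2 + (norm (freq k) * c k)\<^sup>2)"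
          by (simp add: power_mult_distrib algebra_simps)
      qed
      also have "\<dots> = 2 * ((\<Sum>k\<in>S. (c k)\<^sup>2) + (\<Sum>k\<in>S. (norm (freq k) * c k)\<^sup>2))"
        by (simp add: sum_distrib_left sum.distrib)
      also have "\<dots> \<le> 2 * (Y + Z)" by (intro mult_left_mono add_mono Y Z H) simp
      finally show "(\<Sum>k\<in>S. (bracket k * c k)\<^sup>2) \<le> 2 * (Y + Z)" .
    qed simp
    finally show "(\<Sum>k\<in>S. bracket k * (c k)\<^sup>2)\<^sup>2 \<le> 2 * Y * (Y + Z)" by (simp add: mult_ac)
  qed
  define b where "b p = norm (freq p) * c p" for p
  have bnn: "0 \<le> b p" for p using nn by (simp add: b_def)
  have B: "(\<Sum>p\<in>S. (b p)\<^sup>2) \<le> Z" if "finite S" for S using Z[OF that] by (simp add: b_def)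
  note conv = convolution_sum_le[where a=a and b=b and c=c, OF F A B Cc nn(1) bnn nn(2)]
  show "(\<lambda>p. a p * (norm (freq (k - p)) * c (k - p))) summable_on UNIV"
    using conv(1)[of k] by (simp add: b_def)
  define \<tau> where "\<tau> = (\<Sum>k\<in>F. c k * (\<Sum>\<^sub>\<infinity>p. a p * b (k - p)))"
  have "\<tau>\<^sup>2 \<le> 260 * sqrt (4 * C * n) * Z * sqrt (2 * Y * (Y + Z))"
    using conv(2) by (simp add: \<tau>_def)
  then have "(\<tau>\<^sup>2)\<^sup>2 \<le> (260 * sqrt (4 * C * n) * Z * sqrt (2 * Y * (Y + Z)))\<^sup>2"
    by (rule power_mono) simp
  also have "\<dots> = 260 ^ 2 * (4 * C * n) * Z\<^sup>2 * (2 * Y * (Y + Z))"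
  proof -
    have "(sqrt (4 * C * n))\<^sup>2 = 4 * C * n" "(sqrt (2 * Y * (Y + Z)))\<^sup>2 = 2 * Y * (Y + Z)"
      using pos by auto
    then show ?thesis by (simp only: power_mult_distrib)
  qed
  \<comment> \<open>Enlarging \<open>Z\<close> to \<open>Y + Z\<close> produces a pure cube, so that
    \<open>fourth_power_bound\<close> applies with \<open>X = Y + Z\<close> and
    \<open>B = energy_const * C * n * Y\<close>. Its conclusion has the coefficient 1 in front of
    \<open>Z\<close>, half of the dissipation available.\<close>
  also have "\<dots> \<le> 260 ^ 2 * (4 * C * n) * (Y + Z)\<^sup>2 * (2 * Y * (Y + Z))"
    using pos by (intro mult_right_mono mult_left_mono power_mono) auto
  finally have q: "(\<tau>\<^sup>2)\<^sup>2 \<le> 260 ^ 2 * (4 * C * n) * (Y + Z)\<^sup>2 * (2 * Y * (Y + Z))" .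
  have "(24 * \<tau>) ^ 4 = 24 ^ 4 * (\<tau>\<^sup>2)\<^sup>2" by (simp add: power_mult_distrib flip: power_mult)
  also have "\<dots> \<le> 24 ^ 4 * (260 ^ 2 * (4 * C * n) * (Y + Z)\<^sup>2 * (2 * Y * (Y + Z)))"
    by (intro mult_left_mono q) simp
  also have "\<dots> = (energy_const * C * n * Y) * (Y + Z) ^ 3"
    by (simp add: energy_const_def power2_eq_square power3_eq_cube)
  finally have "24 * \<tau> \<le> (Y + Z) + energy_const * C * n * Y"
    using pos by (intro fourth_power_bound) (auto simp: energy_const_def)
  then show "24 * (\<Sum>k\<in>F. c k * (\<Sum>\<^sub>\<infinity>p. a p * (norm (freq (k - p)) * c (k - p)))) \<le> Z + (1 + energy_const * C * n) * Y"
    by (simp add: \<tau>_def b_def algebra_simps)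
qed

lemma norm_vec3_sq: "(norm (v :: complex^3))\<^sup>2 = (\<Sum>i\<in>UNIV. (norm (v $ i))\<^sup>2)"
  by (simp add: norm_vec_def L2_set_def sum_nonneg)

text \<open>The factor 8 is the square of the constant in \<open>norm_leray_part_le\<close> times
  the factor 2 of \<open>norm_diff_sq_le\<close>.\<close>

lemma sum_leray_part_le:
  assumes "\<And>S. finite S \<Longrightarrow> (\<Sum>p\<in>S. g p * (norm (x p))\<^sup>2) \<le> X" "\<And>S. finite S \<Longrightarrow> (\<Sum>p\<in>S. g p * (norm (y p))\<^sup>2) \<le> Y"
    and "finite S" "\<And>p. 0 \<le> g p"
  shows "(\<Sum>p\<in>S. g p * (norm (leray_part (x p - y p) p))\<^sup>2) \<le> 8 * (X + Y)"
proof -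
  have "(\<Sum>p\<in>S. g p * (norm (leray_part (x p - y p) p))\<^sup>2) \<le> (\<Sum>p\<in>S. 8 * (g p * (norm (x p))\<^sup>2 + g p * (norm (y p))\<^sup>2))"
  proof (rule sum_mono)
    fix p
    have "(norm (leray_part (x p - y p) p))\<^sup>2 \<le> (2 * norm (x p - y p))\<^sup>2"
      by (intro power_mono norm_leray_part_le) simp
    also have "\<dots> \<le> 8 * ((norm (x p))\<^sup>2 + (norm (y p))\<^sup>2)"
      using norm_diff_sq_le[of "x p" "y p"] by (simp add: power_mult_distrib)
    finally have "g p * (norm (leray_part (x p - y p) p))\<^sup>2 \<le> g p * (8 * ((norm (x p))\<^sup>2 + (norm (y p))\<^sup>2))"
      by (intro mult_left_mono assms)
    then show "g p * (norm (leray_part (x p - y p) p))\<^sup>2 \<le> 8 * (g p * (norm (x p))\<^sup>2 + g p * (norm (y p))\<^sup>2)"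
      by (simp add: algebra_simps)
  qed
  also have "\<dots> = 8 * ((\<Sum>p\<in>S. g p * (norm (x p))\<^sup>2) + (\<Sum>p\<in>S. g p * (norm (y p))\<^sup>2))"
    by (simp add: sum_distrib_left sum.distrib)
  also have "\<dots> \<le> 8 * (X + Y)" using assms by (intro mult_left_mono add_mono) auto
  finally show ?thesis .
qed

text \<open>Difference of the nonlinear terms of the two equations. No pressure appears, since the
  equations are compared only in directions orthogonal to \<open>freq l\<close>.\<close>

definition nonlinearity :: "field \<Rightarrow> field \<Rightarrow> int^3 \<Rightarrow> complex^3" where
  "nonlinearity u w l = fourier_coeff (convection u w) l + fourier_coeff (grad_transpose u w) l - fourier_coeff (convection u u) l"

lemma bounded_summable:
  fixes f :: "'a \<Rightarrow> real"
  assumes "\<And>S. finite S \<Longrightarrow> sum f S \<le> B" "\<And>p. 0 \<le> f p"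
  shows "f summable_on UNIV"
  by (rule nonneg_bounded_partial_sums_imp_summable_on[where C=B]) 
    (use assms in \<open>auto intro: eventually_finite_subsets_at_top_weakI\<close>)

text \<open>The left side runs over the finite set \<open>F\<close>, but the convolution brings in
  \<open>V\<close> at all frequencies; hence the full sums on the right.\<close>

lemma nonlinear_energy_bound:
  assumes u: "u \<in> H (3/2)" "u \<in> H (1/2)" and w: "w \<in> H (3/2)"
    and div: "\<And>k. cdot (fourier_coeff u k) (cvec (freq k)) = 0"
    and F: "finite F" and C: "H_norm (1/2) u \<le> C"
  defines "V \<equiv> \<lambda>q. leray_part (fourier_coeff w q - fourier_coeff u q) q"
  shows "(\<Sum>k\<in>F. \<Sum>i\<in>UNIV. 2 * (norm (V k $ i) * norm (cdot (nonlinearity u w k) (cvec (pvec k i)))))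
    \<le> (\<Sum>\<^sub>\<infinity>k. (norm (freq k))\<^sup>2 * (norm (V k))\<^sup>2)
      + (1 + energy_const * C\<^sup>2 * (H_norm (3/2) u)\<^sup>2) * (\<Sum>\<^sub>\<infinity>k. (norm (V k))\<^sup>2)"
proof -
  let ?Z = "\<Sum>\<^sub>\<infinity>k. (norm (freq k))\<^sup>2 * (norm (V k))\<^sup>2"
  let ?Y = "\<Sum>\<^sub>\<infinity>k. (norm (V k))\<^sup>2"
  define a where "a p = norm (fourier_coeff u p)" for p
  define c where "c p = norm (V p)" for p
  define R where "R k = (\<Sum>\<^sub>\<infinity>p. a p * (norm (freq (k - p)) * c (k - p)))" for k
  have sY: "(\<lambda>k. (norm (V k))\<^sup>2) summable_on UNIV"
    by (rule bounded_summable[where B="8 * ((H_norm (3/2) w)\<^sup>2 + (H_norm (3/2) u)\<^sup>2)"])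
      (use sum_leray_part_le[of "\<lambda>_. 1" "fourier_coeff w" _ "fourier_coeff u"] H32_sum0 u w in \<open>simp_all add: V_def\<close>)
  have sZ: "(\<lambda>k. (norm (freq k))\<^sup>2 * (norm (V k))\<^sup>2) summable_on UNIV"
    by (rule bounded_summable[where B="8 * ((H_norm (3/2) w)\<^sup>2 + (H_norm (3/2) u)\<^sup>2)"])
      (use sum_leray_part_le[of "\<lambda>k. (norm (freq k))\<^sup>2" "fourier_coeff w" _ "fourier_coeff u"] H32_sum1 u w in \<open>simp_all add: V_def\<close>)
  have H0: "0 \<le> H_norm (1/2) u" by (simp add: H_norm_def infsum_nonneg H_weight_nonneg)
  have a1: "(\<Sum>p\<in>S. bracket p * (a p)\<^sup>2) \<le> C\<^sup>2" if "finite S" for S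
    using H12_sum_bracket[OF u(2) that] power_mono[OF C H0, of 2] by (simp add: a_def)
  have a3: "(\<Sum>p\<in>S. (bracket p) ^ 3 * (a p)\<^sup>2) \<le> 4 * (H_norm (3/2) u)\<^sup>2" if "finite S" for S
    using H32_sum_jap3[OF u(1) that] by (simp add: a_def)
  have cY: "(\<Sum>p\<in>S. (c p)\<^sup>2) \<le> ?Y" if "finite S" for S
    unfolding c_def by (rule finite_sum_le_infsum[OF sY that]) auto
  have cZ: "(\<Sum>p\<in>S. (norm (freq p) * c p)\<^sup>2) \<le> ?Z" if "finite S" for S
    unfolding c_def power_mult_distrib by (rule finite_sum_le_infsum[OF sZ that]) auto
  have ann: "0 \<le> a p" "0 \<le> c p" for p by (auto simp: a_def c_def)
  note ecb = energy_convolution_bound[OF F a1 a3 cY cZ ann]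
  have Rnn: "0 \<le> R k" for k unfolding R_def using ann by (intro infsum_nonneg) simp
  have N: "norm (cdot (nonlinearity u w k) (cvec (pvec k i))) \<le> 4 * R k" for k i
  proof -
    have sm: "(\<lambda>p. norm (fourier_coeff u p) * (norm (freq (k - p)) * norm (leray_part (fourier_coeff w (k - p) - fourier_coeff u (k - p)) (k - p)))) summable_on UNIV"
      using ecb(1)[of k] by (simp add: a_def c_def V_def)
    have "norm (cdot (nonlinearity u w k) (cvec (pvec k i))) \<le> 2 * norm (pvec k i) * R k"
      using nonlinear_bound[OF u(1) w div pvec_orth sm] unfolding nonlinearity_def R_def a_def c_def V_def .
    also have "\<dots> \<le> (2 * 2) * R k"
      using norm_pvec_le[of k i] Rnn by (intro mult_right_mono mult_left_mono) auto
    finally show ?thesis by simp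
  qed
  have "(\<Sum>k\<in>F. \<Sum>i\<in>UNIV. 2 * (norm (V k $ i) * norm (cdot (nonlinearity u w k) (cvec (pvec k i)))))
    \<le> (\<Sum>k\<in>F. \<Sum>i\<in>(UNIV::3 set). 2 * (c k * (4 * R k)))"
    unfolding c_def by (intro sum_mono mult_left_mono mult_mono N Finite_Cartesian_Product.norm_nth_le) auto
  also have "\<dots> = 24 * (\<Sum>k\<in>F. c k * R k)" by (simp add: sum_distrib_left mult_ac)
  also have "\<dots> \<le> ?Z + (1 + energy_const * C\<^sup>2 * (H_norm (3/2) u)\<^sup>2) * ?Y"
    unfolding R_def by (rule ecb(2))
  finally show ?thesis .
qed

text \<open>Real and imaginary parts are treated separately. The almost everywhere bound on
  \<open>y\<close> makes its product with the merely integrable \<open>G\<close> integrable.\<close>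

lemma integral_square_identity_complex:
  fixes y G :: "real \<Rightarrow> complex"
  assumes t: "0 \<le> t" and G: "integrable (lebesgue_on {0..t}) G"
    and y: "\<And>s. s \<in> {0..t} \<Longrightarrow> y s = - (\<integral>r. G r \<partial>lebesgue_on {0..s})"
    and ym: "y \<in> borel_measurable (lebesgue_on {0..t})" and B: "AE s in lebesgue_on {0..t}. norm (y s) \<le> B"
  shows "integrable (lebesgue_on {0..t}) (\<lambda>s. Re (cnj (y s) * G s))"
    and "(norm (y t))\<^sup>2 = - 2 * (\<integral>s. Re (cnj (y s) * G s) \<partial>lebesgue_on {0..t})"
proof -
  let ?N = "lebesgue_on {0..t}"
  have res: "(\<integral>r. indicator {..s} r * g r \<partial>?N) = (\<integral>r. g r \<partial>lebesgue_on {0..s})" if "s \<in> {0..t}" for s and g :: "real \<Rightarrow> real"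
  proof -
    have e: "indicator {0..t} r *\<^sub>R (indicator {..s} r * g r) = indicator {0..s} r *\<^sub>R g r" for r
      using that by (auto simp: indicator_def)
    have "(\<integral>r. indicator {..s} r * g r \<partial>?N) = (\<integral>r. indicator {0..t} r *\<^sub>R (indicator {..s} r * g r) \<partial>lebesgue)"
      by (subst integral_restrict_space) auto
    also have "\<dots> = (\<integral>r. g r \<partial>lebesgue_on {0..s})"
      unfolding e by (subst integral_restrict_space) auto
    finally show ?thesis .
  qed
  have Gs: "integrable (lebesgue_on {0..s}) G" if "s \<in> {0..t}" for s
  proof -
    have "integrable lebesgue (\<lambda>x. indicator {0..t} x *\<^sub>R G x)"
      using G by (subst (asm) integrable_restrict_space) auto
    then have 1: "integrable lebesgue (\<lambda>x. indicator {0..s} x *\<^sub>R (indicator {0..t} x *\<^sub>R G x))"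
      by (intro integrable_mult_indicator[of "{0..s}"]) auto
    have e: "indicator {0..s} x *\<^sub>R (indicator {0..t} x *\<^sub>R G x) = indicator {0..s} x *\<^sub>R G x" for x
      using that by (auto simp: indicator_def)
    show ?thesis using 1 unfolding e by (subst integrable_restrict_space) auto
  qed
  have i: "integrable ?N (\<lambda>s. Re (G s))" "integrable ?N (\<lambda>s. Im (G s))"
    using G by auto
  have yr: "Re (y s) = (\<integral>r. indicator {..s} r * (- Re (G r)) \<partial>?N)"
    "Im (y s) = (\<integral>r. indicator {..s} r * (- Im (G r)) \<partial>?N)" if "s \<in> {0..t}" for s
    unfolding res[OF that] y[OF that] using Gs[OF that] by simp_all
  have cL2_sqnorm: "(Re (y t))\<^sup>2 = 2 * (\<integral>s. Re (y s) * (- Re (G s)) \<partial>?N)" "(Im (y t))\<^sup>2 = 2 * (\<integral>s. Im (y s) * (- Im (G s)) \<partial>?N)"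
    by (rule integral_square_identity_real[OF t _ yr(1)], use i in simp, assumption)
      (rule integral_square_identity_real[OF t _ yr(2)], use i in simp, assumption)
  have cL2_inner: "integrable ?N (\<lambda>s. Re (y s) * Re (G s))" "integrable ?N (\<lambda>s. Im (y s) * Im (G s))"
  proof -
    have "integrable ?N (\<lambda>s. B * norm (G s))" using G by simp
    then show "integrable ?N (\<lambda>s. Re (y s) * Re (G s))"
    proof (rule Bochner_Integration.integrable_bound)
      show "(\<lambda>s. Re (y s) * Re (G s)) \<in> borel_measurable ?N" using ym G by simp
      show "AE s in ?N. norm (Re (y s) * Re (G s)) \<le> norm (B * norm (G s))"
        using B
      proof eventually_elim
        case (elim s)
        have "\<bar>Re (y s)\<bar> \<le> \<bar>B\<bar>" using abs_Re_le_cmod[of "y s"] elim by linarith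
        then have "\<bar>Re (y s)\<bar> * \<bar>Re (G s)\<bar> \<le> \<bar>B\<bar> * norm (G s)"
          by (intro mult_mono abs_Re_le_cmod) auto
        then show ?case by (simp add: abs_mult)
      qed
    qed
    have "integrable ?N (\<lambda>s. B * norm (G s))" using G by simp
    then show "integrable ?N (\<lambda>s. Im (y s) * Im (G s))"
    proof (rule Bochner_Integration.integrable_bound)
      show "(\<lambda>s. Im (y s) * Im (G s)) \<in> borel_measurable ?N" using ym G by simp
      show "AE s in ?N. norm (Im (y s) * Im (G s)) \<le> norm (B * norm (G s))"
        using B
      proof eventually_elim
        case (elim s)
        have "\<bar>Im (y s)\<bar> \<le> \<bar>B\<bar>" using abs_Im_le_cmod[of "y s"] elim by linarith
        then have "\<bar>Im (y s)\<bar> * \<bar>Im (G s)\<bar> \<le> \<bar>B\<bar> * norm (G s)"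
          by (intro mult_mono abs_Im_le_cmod) auto
        then show ?case by (simp add: abs_mult)
      qed
    qed
  qed
  have e: "Re (cnj (y s) * G s) = Re (y s) * Re (G s) + Im (y s) * Im (G s)" for s by simp
  show "integrable ?N (\<lambda>s. Re (cnj (y s) * G s))" unfolding e by (intro Bochner_Integration.integrable_add cL2_inner)
  have "(norm (y t))\<^sup>2 = (Re (y t))\<^sup>2 + (Im (y t))\<^sup>2" by (simp add: cmod_power2)
  also have "\<dots> = - 2 * ((\<integral>s. Re (y s) * Re (G s) \<partial>?N) + (\<integral>s. Im (y s) * Im (G s) \<partial>?N))"
    unfolding cL2_sqnorm by simp
  also have "(\<integral>s. Re (y s) * Re (G s) \<partial>?N) + (\<integral>s. Im (y s) * Im (G s) \<partial>?N) = (\<integral>s. Re (cnj (y s) * G s) \<partial>?N)"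
    unfolding e by (intro Bochner_Integration.integral_add[symmetric] cL2_inner)
  finally show "(norm (y t))\<^sup>2 = - 2 * (\<integral>s. Re (cnj (y s) * G s) \<partial>?N)" .
qed

lemma integrable_AE_eq:
  fixes f g :: "real \<Rightarrow> 'b::euclidean_space"
  assumes "integrable (lebesgue_on {0..t}) g" "AE s in lebesgue_on {0..t}. g s = f s"
  shows "integrable (lebesgue_on {0..t}) f" "(\<integral>s. f s \<partial>lebesgue_on {0..t}) = (\<integral>s. g s \<partial>lebesgue_on {0..t})"
proof -
  have m: "f \<in> borel_measurable (lebesgue_on {0..t})"
    by (rule measurable_AE_eq[OF borel_measurable_integrable[OF assms(1)] _ assms(2)]) simp
  show "integrable (lebesgue_on {0..t}) f" using integrable_cong_AE_imp[OF assms(1) m assms(2)] .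
  show "(\<integral>s. f s \<partial>lebesgue_on {0..t}) = (\<integral>s. g s \<partial>lebesgue_on {0..t})"
    using integral_cong_AE[OF borel_measurable_integrable[OF assms(1)] m assms(2)] by (rule sym)
qed

lemma Hhalf_class_facts:
  assumes "v \<in> Hhalf_class T"
  shows "AE t in lebesgue_on {0<..<T}. v t \<in> H (3/2)" "AE t in lebesgue_on {0<..<T}. v t \<in> H (1/2)"
    "\<exists>C. AE t in lebesgue_on {0<..<T}. H_norm (1/2) (v t) \<le> C"
    "integrable (lebesgue_on {0<..<T}) (\<lambda>t. (H_norm (3/2) (v t))\<^sup>2)"
    "(\<lambda>t. fourier_coeff (v t) k $ i) \<in> borel_measurable (lebesgue_on {0<..<T})"
proof -
  have sm: "strongly_measurable T (H (3/2)) (H_norm (3/2)) v" "strongly_measurable T (H (1/2)) (H_norm (1/2)) v"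
    using assms by (auto simp: Hhalf_class_def Linf_time_def L2_time_def)
  show "AE t in lebesgue_on {0<..<T}. v t \<in> H (3/2)" "AE t in lebesgue_on {0<..<T}. v t \<in> H (1/2)"
    using sm by (auto simp: strongly_measurable_def)
  show "\<exists>C. AE t in lebesgue_on {0<..<T}. H_norm (1/2) (v t) \<le> C"
    using assms by (simp add: Hhalf_class_def Linf_time_def)
  show "integrable (lebesgue_on {0<..<T}) (\<lambda>t. (H_norm (3/2) (v t))\<^sup>2)"
    using assms by (simp add: Hhalf_class_def L2_time_def)
  show "(\<lambda>t. fourier_coeff (v t) k $ i) \<in> borel_measurable (lebesgue_on {0<..<T})"
    by (rule strongly_measurable_fourier[OF sm(1)])
qed

text \<open>\<open>weak_pd\<close> chooses a representative separately at each time, so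
  measurability in time is obtained from the convolution series instead: its partial sums are
  polynomials in measurable coefficients.\<close>

lemma convection_time_integrable:
  assumes a: "a \<in> Hhalf_class T" and b: "b \<in> Hhalf_class T"
  shows "integrable (lebesgue_on {0<..<T}) (\<lambda>t. fourier_coeff (convection (a t) (b t)) l $ i)"
proof (rule Bochner_Integration.integrable_bound)
  let ?M = "lebesgue_on {0<..<T}"
  note fa = Hhalf_class_facts[OF a] and fb = Hhalf_class_facts[OF b]
  show "integrable ?M (\<lambda>t. (H_norm (3/2) (a t))\<^sup>2 + (H_norm (3/2) (b t))\<^sup>2)"
    by (intro Bochner_Integration.integrable_add fa fb)
  show "AE t in ?M. norm (fourier_coeff (convection (a t) (b t)) l $ i) \<le> norm ((H_norm (3/2) (a t))\<^sup>2 + (H_norm (3/2) (b t))\<^sup>2)"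
    using fa(1) fb(1) by eventually_elim (use fourier_convection_le in auto)
  show "(\<lambda>t. fourier_coeff (convection (a t) (b t)) l $ i) \<in> borel_measurable ?M"
  proof (rule measurable_AE_lim)
    show "AE t in ?M. (\<lambda>n. \<Sum>p | freq_sup p \<le> n. \<i> * cdot (fourier_coeff (a t) p) (cvec (freq (l - p))) * fourier_coeff (b t) (l - p) $ i)
        \<longlonglongrightarrow> fourier_coeff (convection (a t) (b t)) l $ i"
      using fa(1) fb(1) by eventually_elim (intro has_sum_freq_sup_lim fourier_convection H_L2)
    show "(\<lambda>t. \<Sum>p | freq_sup p \<le> n. \<i> * cdot (fourier_coeff (a t) p) (cvec (freq (l - p))) * fourier_coeff (b t) (l - p) $ i) \<in> borel_measurable ?M" for n
      unfolding cdot_def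
      by (intro borel_measurable_sum borel_measurable_times borel_measurable_const fa(5) fb(5))
  qed simp
qed

lemma grad_transpose_time_integrable:
  assumes a: "a \<in> Hhalf_class T" and b: "b \<in> Hhalf_class T"
  shows "integrable (lebesgue_on {0<..<T}) (\<lambda>t. fourier_coeff (grad_transpose (a t) (b t)) l $ i)"
proof (rule Bochner_Integration.integrable_bound)
  let ?M = "lebesgue_on {0<..<T}"
  note fa = Hhalf_class_facts[OF a] and fb = Hhalf_class_facts[OF b]
  show "integrable ?M (\<lambda>t. (H_norm (3/2) (a t))\<^sup>2 + (H_norm (3/2) (b t))\<^sup>2)"
    by (intro Bochner_Integration.integrable_add fa fb)
  show "AE t in ?M. norm (fourier_coeff (grad_transpose (a t) (b t)) l $ i) \<le> norm ((H_norm (3/2) (a t))\<^sup>2 + (H_norm (3/2) (b t))\<^sup>2)"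
    using fa(1) fb(1) by eventually_elim (use fourier_grad_transpose_le in auto)
  show "(\<lambda>t. fourier_coeff (grad_transpose (a t) (b t)) l $ i) \<in> borel_measurable ?M"
  proof (rule measurable_AE_lim)
    show "AE t in ?M. (\<lambda>n. \<Sum>p | freq_sup p \<le> n. \<i> * of_int (p $ i) * cdot (fourier_coeff (a t) p) (fourier_coeff (b t) (l - p)))
        \<longlonglongrightarrow> fourier_coeff (grad_transpose (a t) (b t)) l $ i"
      using fa(1) fb(1) by eventually_elim (intro has_sum_freq_sup_lim fourier_grad_transpose H_L2)
    show "(\<lambda>t. \<Sum>p | freq_sup p \<le> n. \<i> * of_int (p $ i) * cdot (fourier_coeff (a t) p) (fourier_coeff (b t) (l - p))) \<in> borel_measurable ?M" for n
      unfolding cdot_def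
      by (intro borel_measurable_sum borel_measurable_times borel_measurable_const fa(5) fb(5))
  qed simp
qed

subsection \<open>The energy estimate\<close>

text \<open>The part of a coefficient seen by a test mode: phase 0 detects the real part and phase
  \<open>pi / 2\<close> the imaginary part, as in \<open>coef_real\<close>.\<close>

definition cpart :: "real \<Rightarrow> complex \<Rightarrow> real" where
  "cpart \<theta> z = (if \<theta> = 0 then Re z else Im z)"

lemma bounded_linear_cpart: "bounded_linear (cpart \<theta>)"
  unfolding cpart_def[abs_def] by (cases "\<theta> = 0") (simp_all add: bounded_linear_Re bounded_linear_Im)

lemma cpart_linear:
  "cpart \<theta> (x + y) = cpart \<theta> x + cpart \<theta> y" "cpart \<theta> (x - y) = cpart \<theta> x - cpart \<theta> y"
  "cpart \<theta> (of_real r * x) = r * cpart \<theta> x"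
  by (simp_all add: cpart_def)

lemma L2_inner_trig_field_cpart:
  assumes "\<And>i. integrable torus (\<lambda>x. f x $ i)" "\<theta> = 0 \<or> \<theta> = pi / 2"
  shows "L2_inner f (trig_field k \<theta> a) = vol * cpart \<theta> (cdot (fourier_coeff f k) (cvec a))"
  unfolding cdot_fourier_trig_field[OF assms(1)] cpart_def by (rule disjE[OF assms(2)]; hypsubst; simp)

lemma integrable_cdot_fourier:
  assumes v: "v \<in> Hhalf_class T" and C: "AE t in lebesgue_on {0<..<T}. H_norm (1/2) (v t) \<le> C"
  shows "integrable (lebesgue_on {0<..<T}) (\<lambda>t. cdot (fourier_coeff (v t) k) (cvec a))"
proof -
  note fv = Hhalf_class_facts[OF v]
  interpret M: finite_measure "lebesgue_on {0<..<T}"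
    by (rule finite_measure_lebesgue_on) (simp add: bounded_set_imp_lmeasurable)
  show ?thesis
  proof (rule M.integrable_const_bound[where B="C * norm a"])
    show "(\<lambda>t. cdot (fourier_coeff (v t) k) (cvec a)) \<in> borel_measurable (lebesgue_on {0<..<T})"
      unfolding cdot_def by (intro borel_measurable_sum borel_measurable_times borel_measurable_const fv(5))
    show "AE t in lebesgue_on {0<..<T}. norm (cdot (fourier_coeff (v t) k) (cvec a)) \<le> C * norm a"
      using C fv(2)
    proof eventually_elim
      case (elim t)
      have "norm (fourier_coeff (v t) k) \<le> C"
        using fourier_coeff_le_H_norm[OF elim(2), of k] elim(1) by linarith
      then have "norm (fourier_coeff (v t) k) * norm (cvec a) \<le> C * norm a"
        by (simp add: mult_right_mono)
      then show ?case using norm_cdot_le[of "fourier_coeff (v t) k" "cvec a"] by linarith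
    qed
  qed
qed

locale linearised_solution =
  fixes T :: real and u w :: "real \<Rightarrow> field" and u0 w0 :: field
  assumes uC: "u \<in> Hhalf_class T"
    and ns: "NS_weak_solution T u0 u"
    and lr: "leray w0 u0"
    and sol: "Hhalf_solution T u w0 w"
begin

lemma wC: "w \<in> Hhalf_class T" using sol by (simp add: Hhalf_solution_def)

lemma uS: "t \<in> {0..<T} \<Longrightarrow> u t \<in> L2_sigma" using ns by (simp add: NS_weak_solution_def)
lemma uL: "t \<in> {0..<T} \<Longrightarrow> u t \<in> L2" using uS by (simp add: L2_sigma_def)
lemma wL: "t \<in> {0..<T} \<Longrightarrow> w t \<in> L2" using sol by (simp add: Hhalf_solution_def)

definition D :: "real \<Rightarrow> int^3 \<Rightarrow> complex^3" where
  "D t k = fourier_coeff (w t) k - fourier_coeff (u t) k"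

definition V :: "real \<Rightarrow> int^3 \<Rightarrow> complex^3" where
  "V t k = leray_part (D t k) k"

definition z :: "int^3 \<Rightarrow> real^3 \<Rightarrow> real \<Rightarrow> complex" where
  "z k a t = cdot (D t k) (cvec a)"

definition N :: "int^3 \<Rightarrow> real^3 \<Rightarrow> real \<Rightarrow> complex" where
  "N k a t = cdot (nonlinearity (u t) (w t) k) (cvec a)"

text \<open>For \<open>a\<close> orthogonal to \<open>freq k\<close> this is minus the time
  derivative of \<open>z k a\<close>, in integrated form; the Laplacian acts as multiplication by
  the squared frequency.\<close>

definition G :: "int^3 \<Rightarrow> real^3 \<Rightarrow> real \<Rightarrow> complex" where
  "G k a t = N k a t + of_real ((norm (freq k))\<^sup>2) * z k a t"

text \<open>Gathers into one exceptional null set what the energy estimate uses at a single time;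
  the bound \<open>C\<close> is uniform in time.\<close>

definition good :: "real \<Rightarrow> real \<Rightarrow> bool" where
  "good C t \<longleftrightarrow> u t \<in> H (3/2) \<and> u t \<in> H (1/2) \<and> w t \<in> H (3/2) \<and> w t \<in> H (1/2)
     \<and> H_norm (1/2) (u t) \<le> C \<and> H_norm (1/2) (w t) \<le> C
     \<and> (\<forall>k. cdot (fourier_coeff (u t) k) (cvec (freq k)) = 0)"

lemma good_exists:
  obtains C where "0 \<le> C" "AE t in lebesgue_on {0<..<T}. good C t"
proof -
  note fu = Hhalf_class_facts[OF uC] and fw = Hhalf_class_facts[OF wC]
  obtain Cu Cw where C: "AE t in lebesgue_on {0<..<T}. H_norm (1/2) (u t) \<le> Cu"
     "AE t in lebesgue_on {0<..<T}. H_norm (1/2) (w t) \<le> Cw"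
    using fu(3) fw(3) by blast
  have "AE t in lebesgue_on {0<..<T}. good (max 0 (max Cu Cw)) t"
    using fu(1,2) fw(1,2) C AE_space
  proof eventually_elim
    case (elim t)
    then have "u t \<in> L2_sigma" by (intro uS) simp
    then show ?case using elim L2_sigma_div by (auto simp: good_def)
  qed
  then show ?thesis using that[of "max 0 (max Cu Cw)"] by simp
qed

context
  fixes C :: real
  assumes C0: "0 \<le> C" and Cg: "AE t in lebesgue_on {0<..<T}. good C t"
begin

lemma good_AE: "t < T \<Longrightarrow> AE s in lebesgue_on {0..t}. good C s"
  by (rule AE_lebesgue_on_mono[OF Cg])

section \<open>Integral equations for the single modes\<close>

lemma int_cdot_u: "integrable (lebesgue_on {0<..<T}) (\<lambda>t. cdot (fourier_coeff (u t) k) (cvec a))"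
proof (rule integrable_cdot_fourier[OF uC])
  show "AE t in lebesgue_on {0<..<T}. H_norm (1/2) (u t) \<le> C"
    using Cg by eventually_elim (simp add: good_def)
qed

lemma int_cdot_w: "integrable (lebesgue_on {0<..<T}) (\<lambda>t. cdot (fourier_coeff (w t) k) (cvec a))"
proof (rule integrable_cdot_fourier[OF wC])
  show "AE t in lebesgue_on {0<..<T}. H_norm (1/2) (w t) \<le> C"
    using Cg by eventually_elim (simp add: good_def)
qed

lemma int_conv_gt: "integrable (lebesgue_on {0<..<T})
    (\<lambda>t. cdot (fourier_coeff (convection (u t) (w t)) k + fourier_coeff (grad_transpose (u t) (w t)) k) (cvec a))"
  unfolding cdot_def vector_add_component
  by (intro Bochner_Integration.integrable_sum integrable_mult_left Bochner_Integration.integrable_add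
      convection_time_integrable grad_transpose_time_integrable uC wC)

lemma int_conv: "integrable (lebesgue_on {0<..<T}) (\<lambda>t. cdot (fourier_coeff (convection (u t) (u t)) k) (cvec a))"
  unfolding cdot_def
  by (intro Bochner_Integration.integrable_sum integrable_mult_left convection_time_integrable uC)

lemma z_eq: "z k a t = cdot (fourier_coeff (w t) k) (cvec a) - cdot (fourier_coeff (u t) k) (cvec a)"
  by (simp add: z_def D_def cdot_diff_left)

lemma N_eq: "N k a t = cdot (fourier_coeff (convection (u t) (w t)) k + fourier_coeff (grad_transpose (u t) (w t)) k) (cvec a)
    - cdot (fourier_coeff (convection (u t) (u t)) k) (cvec a)"
  by (simp add: N_def nonlinearity_def cdot_diff_left)

lemma int_z: "integrable (lebesgue_on {0<..<T}) (z k a)"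
  unfolding z_eq[abs_def] by (intro Bochner_Integration.integrable_diff int_cdot_u int_cdot_w)

lemma int_N: "integrable (lebesgue_on {0<..<T}) (N k a)"
  unfolding N_eq[abs_def] by (intro Bochner_Integration.integrable_diff int_conv_gt int_conv)

lemma int_G: "integrable (lebesgue_on {0<..<T}) (G k a)"
  unfolding G_def[abs_def] by (intro Bochner_Integration.integrable_add integrable_mult_right int_z int_N)

text \<open>Both weak identities are tested with the same frozen mode, which is divergence free
  because \<open>a\<close> is orthogonal to \<open>freq k\<close>, and are subtracted. The initial
  values cancel since \<open>w0 - u0\<close> is orthogonal to \<open>L2_sigma\<close>.\<close>

lemma mode_equation_part:
  assumes t: "t \<in> {0..<T}" and a: "a \<bullet> freq k = 0" and \<theta>: "\<theta> = 0 \<or> \<theta> = pi / 2"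
  shows "cpart \<theta> (z k a t) = - (\<integral>s. cpart \<theta> (G k a s) \<partial>lebesgue_on {0..t})"
proof -
  let ?N = "lebesgue_on {0..t}" and ?\<psi> = "trig_field k \<theta> a"
  have tT: "t < T" using t by simp
  define \<kappa> where "\<kappa> = (norm (freq k))\<^sup>2"
  obtain \<phi> where \<phi>: "test_field T \<phi>" "\<And>s. s \<le> t \<Longrightarrow> \<phi> s = ?\<psi>" "\<And>s x. s \<le> t \<Longrightarrow> time_deriv \<phi> s x = 0"
    "div_free_test_field T \<phi>"
    using trig_field_test_field[OF tT, of k \<theta> a] a by metis
  have td: "L2_inner v (time_deriv \<phi> s) = 0" if "s \<le> t" for s v
    using \<phi>(3)[OF that] by (simp add: L2_inner_def)
  have cong: "(LINT s:{0..t}|lebesgue. f s (\<phi> s)) = (\<integral>s. f s ?\<psi> \<partial>?N)" for f :: "real \<Rightarrow> field \<Rightarrow> real"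
  proof -
    have "(LINT s:{0..t}|lebesgue. f s (\<phi> s)) = (LINT s:{0..t}|lebesgue. f s ?\<psi>)"
      by (rule set_lebesgue_integral_cong) (use \<phi>(2) in auto)
    then show ?thesis by (simp add: set_lebesgue_integral_restrict)
  qed
  have cong0: "(LINT s:{0..t}|lebesgue. L2_inner (f s) (time_deriv \<phi> s)) = 0" for f
  proof -
    have "(LINT s:{0..t}|lebesgue. L2_inner (f s) (time_deriv \<phi> s)) = (LINT s:{0..t}|lebesgue. 0)"
      by (rule set_lebesgue_integral_cong) (use td in auto)
    then show ?thesis by simp
  qed
  define f1 where "f1 s = L2_inner (\<lambda>x. convection (u s) (w s) x + grad_transpose (u s) (w s) x) ?\<psi>" for s
  define f2 where "f2 s = grad_inner (w s) ?\<psi>" for s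
  define f3 where "f3 s = L2_inner (convection (u s) (u s)) ?\<psi> + grad_inner (u s) ?\<psi>" for s
  have W: "L2_inner (w t) ?\<psi> + (\<integral>s. f1 s \<partial>?N) = L2_inner w0 ?\<psi> - (\<integral>s. f2 s \<partial>?N)"
  proof -
    have "L2_inner (w t) (\<phi> t)
          + (LINT s:{0..t}|lebesgue. L2_inner (\<lambda>x. convection (u s) (w s) x + grad_transpose (u s) (w s) x) (\<phi> s))
        = L2_inner w0 (\<phi> 0) + (LINT s:{0..t}|lebesgue. L2_inner (w s) (time_deriv \<phi> s))
          - (LINT s:{0..t}|lebesgue. grad_inner (w s) (\<phi> s))"
      using sol \<phi>(1) t unfolding Hhalf_solution_def by blast
    then show ?thesis
      unfolding cong[of "\<lambda>s. L2_inner (\<lambda>x. convection (u s) (w s) x + grad_transpose (u s) (w s) x)"]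
        cong[of "\<lambda>s. grad_inner (w s)"] cong0 using \<phi>(2) t by (simp add: f1_def f2_def)
  qed
  have U: "L2_inner (u t) ?\<psi> + (\<integral>s. f3 s \<partial>?N) = L2_inner u0 ?\<psi>"
  proof -
    have "L2_inner (u t) (\<phi> t)
          + (LINT s:{0..t}|lebesgue. L2_inner (convection (u s) (u s)) (\<phi> s) + grad_inner (u s) (\<phi> s))
        = L2_inner u0 (\<phi> 0) + (LINT s:{0..t}|lebesgue. L2_inner (u s) (time_deriv \<phi> s))"
      using ns \<phi>(4) t unfolding NS_weak_solution_def by blast
    then show ?thesis
      unfolding cong[of "\<lambda>s \<psi>. L2_inner (convection (u s) (u s)) \<psi> + grad_inner (u s) \<psi>"]
        cong0 using \<phi>(2) t by (simp add: f3_def)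
  qed
  have init: "L2_inner w0 ?\<psi> = L2_inner u0 ?\<psi>"
  proof -
    have L: "w0 \<in> L2" "u0 \<in> L2" using lr by (auto simp: leray_def L2_sigma_def)
    have "L2_inner (\<lambda>x. w0 x - u0 x) ?\<psi> = 0"
      using lr trig_field_L2_sigma[OF a] by (simp add: leray_def)
    then have "cpart \<theta> (cdot (fourier_coeff (\<lambda>x. w0 x - u0 x) k) (cvec a)) = 0"
      using L2_inner_trig_field_cpart[OF L2_nth_integrable[OF L2_diff[OF L]] \<theta>, of k a] by simp
    then show ?thesis
      unfolding L2_inner_trig_field_cpart[OF L2_nth_integrable[OF L(1)] \<theta>] L2_inner_trig_field_cpart[OF L2_nth_integrable[OF L(2)] \<theta>]
        fourier_coeff_diff[OF L] cdot_diff_left cpart_linear by simp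
  qed
  define c1 where "c1 s = cpart \<theta> (cdot (fourier_coeff (convection (u s) (w s)) k + fourier_coeff (grad_transpose (u s) (w s)) k) (cvec a))" for s
  define c3 where "c3 s = cpart \<theta> (cdot (fourier_coeff (convection (u s) (u s)) k) (cvec a))" for s
  define cW where "cW s = cpart \<theta> (cdot (fourier_coeff (w s) k) (cvec a))" for s
  define cU where "cU s = cpart \<theta> (cdot (fourier_coeff (u s) k) (cvec a))" for s
  have i: "integrable ?N c1" "integrable ?N c3" "integrable ?N cW" "integrable ?N cU"
    unfolding c1_def[abs_def] c3_def[abs_def] cW_def[abs_def] cU_def[abs_def]
    by (intro integrable_bounded_linear[OF bounded_linear_cpart] integrable_lebesgue_on_mono[OF _ tT]
        int_conv_gt int_conv int_cdot_u int_cdot_w)+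
  \<comment> \<open>Off a null set of times, pairing with the mode is \<open>vol\<close> times the
    real or imaginary part of a Fourier coefficient. The time integrals are rewritten in terms of
    these parts, whose integrability is known.\<close>
  have e1: "(\<integral>s. f1 s \<partial>?N) = (\<integral>s. vol * c1 s \<partial>?N)"
  proof (rule integrable_AE_eq(2))
    show "AE s in ?N. vol * c1 s = f1 s"
      using good_AE[OF tT]
    proof eventually_elim
      case (elim s)
      have ci: "integrable torus (\<lambda>x. convection (u s) (w s) x $ i)" "integrable torus (\<lambda>x. grad_transpose (u s) (w s) x $ i)" for i
        using elim by (auto simp: good_def intro!: convection_integrable grad_transpose_integrable H_L2)
      have "fourier_coeff (\<lambda>x. convection (u s) (w s) x + grad_transpose (u s) (w s) x) k
          = fourier_coeff (convection (u s) (w s)) k + fourier_coeff (grad_transpose (u s) (w s)) k"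
        using coef_add'[OF ci(1)[folded integrable_of_real_iff] ci(2)[folded integrable_of_real_iff]]
        by (simp add: vec_eq_iff fourier_coeff_component component_def[abs_def])
      then show ?case unfolding f1_def c1_def
        by (subst L2_inner_trig_field_cpart[OF _ \<theta>]) (use ci in auto)
    qed
  qed (use i in simp)
  have e2: "(\<integral>s. f2 s \<partial>?N) = (\<integral>s. \<kappa> * (vol * cW s) \<partial>?N)"
  proof (rule integrable_AE_eq(2))
    show "AE s in ?N. \<kappa> * (vol * cW s) = f2 s"
      using good_AE[OF tT]
    proof eventually_elim
      case (elim s)
      then have "w s \<in> H (3/2)" by (simp add: good_def)
      then show ?case
        unfolding f2_def cW_def \<kappa>_def by (simp only: grad_inner_trig_field L2_inner_trig_field_cpart[OF L2_nth_integrable[OF H_L2] \<theta>])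
    qed
  qed (use i in simp)
  have e3: "(\<integral>s. f3 s \<partial>?N) = (\<integral>s. vol * c3 s + \<kappa> * (vol * cU s) \<partial>?N)"
  proof (rule integrable_AE_eq(2))
    show "AE s in ?N. vol * c3 s + \<kappa> * (vol * cU s) = f3 s"
      using good_AE[OF tT]
    proof eventually_elim
      case (elim s)
      then have us: "u s \<in> H (3/2)" by (simp add: good_def)
      show ?case
        unfolding f3_def c3_def cU_def \<kappa>_def grad_inner_trig_field[OF us] L2_inner_trig_field_cpart[OF L2_nth_integrable[OF H_L2[OF us]] \<theta>]
          L2_inner_trig_field_cpart[OF convection_integrable[OF H_L2[OF us] us] \<theta>] ..
    qed
  qed (use i in simp)
  have eW: "L2_inner (w t) ?\<psi> = vol * cW t" and eU: "L2_inner (u t) ?\<psi> = vol * cU t"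
    unfolding cW_def cU_def by (rule L2_inner_trig_field_cpart[OF L2_nth_integrable \<theta>], use wL uL t in blast)+
  have "vol * cpart \<theta> (z k a t) = vol * cW t - vol * cU t"
    by (simp add: z_eq cpart_linear cW_def cU_def right_diff_distrib)
  also have "\<dots> = - ((\<integral>s. vol * c1 s \<partial>?N) + (\<integral>s. \<kappa> * (vol * cW s) \<partial>?N) - (\<integral>s. vol * c3 s + \<kappa> * (vol * cU s) \<partial>?N))"
    using W U init unfolding e1 e2 e3 eW eU by linarith
  also have "(\<integral>s. vol * c1 s \<partial>?N) + (\<integral>s. \<kappa> * (vol * cW s) \<partial>?N) - (\<integral>s. vol * c3 s + \<kappa> * (vol * cU s) \<partial>?N)
      = (\<integral>s. (vol * c1 s + \<kappa> * (vol * cW s)) - (vol * c3 s + \<kappa> * (vol * cU s)) \<partial>?N)"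
    using i by (simp only: Bochner_Integration.integral_add Bochner_Integration.integral_diff
        Bochner_Integration.integrable_add integrable_mult_right)
  also have "\<dots> = (\<integral>s. vol * cpart \<theta> (G k a s) \<partial>?N)"
    unfolding G_def N_eq z_eq \<kappa>_def[symmetric] cpart_linear c1_def c3_def cW_def cU_def
    by (simp add: algebra_simps)
  also have "\<dots> = vol * (\<integral>s. cpart \<theta> (G k a s) \<partial>?N)" by (rule integral_mult_right_zero)
  finally have "vol * cpart \<theta> (z k a t) = vol * (- (\<integral>s. cpart \<theta> (G k a s) \<partial>?N))" by simp
  then show ?thesis using vol_pos mult_left_cancel[of vol] by (metis less_irrefl)
qed

lemma mode_equation:
  assumes t: "t \<in> {0..<T}" and a: "a \<bullet> freq k = 0"
  shows "z k a t = - (\<integral>s. G k a s \<partial>lebesgue_on {0..t})"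
proof -
  have i: "integrable (lebesgue_on {0..t}) (G k a)"
    using t by (intro integrable_lebesgue_on_mono[OF int_G]) simp
  have "Re (z k a t) = - (\<integral>s. Re (G k a s) \<partial>lebesgue_on {0..t})"
    using mode_equation_part[OF t a, of 0] by (simp add: cpart_def)
  moreover have "Im (z k a t) = - (\<integral>s. Im (G k a s) \<partial>lebesgue_on {0..t})"
    using mode_equation_part[OF t a, of "pi / 2"] by (simp add: cpart_def)
  ultimately show ?thesis
    using integral_Re[OF i] integral_Im[OF i] by (simp add: complex_eq_iff)
qed

text \<open>Each component of the Leray part is a coefficient tested in a direction orthogonal to
  the frequency, so \<open>mode_equation\<close> applies to it.\<close>

lemma V_nth: "V t k $ i = z k (pvec k i) t"
  by (simp add: V_def z_def leray_part_nth)

lemma V_meas: "(\<lambda>t. V t k $ i) \<in> borel_measurable (lebesgue_on {0<..<T})"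
  unfolding V_nth using int_z by (rule borel_measurable_integrable)

lemma normV_meas: "(\<lambda>t. (norm (V t k))\<^sup>2) \<in> borel_measurable (lebesgue_on {0<..<T})"
  unfolding norm_vec3_sq
  by (intro borel_measurable_sum borel_measurable_power measurable_compose[OF V_meas borel_measurable_norm])

text \<open>Up to the factor \<open>vol\<close>, the squared norm of \<open>v\<close> and, for
  \<open>Z\<close>, that of its gradient. Where a series does not converge the infinite sum has the
  value 0, so both are nonnegative at every time.\<close>

definition Y :: "real \<Rightarrow> real" where "Y t = (\<Sum>\<^sub>\<infinity>k. (norm (V t k))\<^sup>2)"
definition Z :: "real \<Rightarrow> real" where "Z t = (\<Sum>\<^sub>\<infinity>k. (norm (freq k))\<^sup>2 * (norm (V t k))\<^sup>2)"
text \<open>The Gronwall coefficient. It is integrable in time because the \<open>H^(1/2)\<close>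
  norm of \<open>u\<close> enters only through its bound \<open>C\<close>.\<close>

definition h :: "real \<Rightarrow> real" where "h t = 1 + energy_const * C\<^sup>2 * (H_norm (3/2) (u t))\<^sup>2"

lemma Y_nonneg: "0 \<le> Y t" unfolding Y_def by (intro infsum_nonneg) simp
lemma Z_nonneg: "0 \<le> Z t" unfolding Z_def by (intro infsum_nonneg) simp
lemma h_nonneg: "0 \<le> h t" by (simp add: h_def energy_const_def)

text \<open>Convergence is wanted at every time, not just at good ones, because the energy
  inequality is evaluated pointwise in \<open>t\<close>; membership in \<open>L2\<close> provides
  it.\<close>

lemma summable_Y:
  assumes "t \<in> {0..<T}"
  shows "(\<lambda>k. (norm (V t k))\<^sup>2) summable_on UNIV"
proof (rule bounded_summable)
  fix S :: "(int^3) set" assume "finite S"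
  then show "(\<Sum>k\<in>S. (norm (V t k))\<^sup>2) \<le> 8 * ((\<Sum>i\<in>UNIV. cL2_sqnorm (component (w t) i) / vol) + (\<Sum>i\<in>UNIV. cL2_sqnorm (component (u t) i) / vol))"
    using sum_leray_part_le[of "\<lambda>_. 1" "fourier_coeff (w t)" _ "fourier_coeff (u t)"] fourier_L2_sum_le wL uL assms
    by (simp add: V_def D_def)
qed simp

text \<open>The factor 16 is \<open>8 * (1 + 1)\<close> from \<open>sum_leray_part_le\<close>.
  Boundedness of \<open>Y\<close> is what makes \<open>h * Y\<close> integrable in time.\<close>

lemma good_Y:
  assumes "good C t"
  shows "((\<lambda>k. (norm (V t k))\<^sup>2) has_sum Y t) UNIV" "Y t \<le> 16 * C\<^sup>2"
proof -
  have H0: "0 \<le> H_norm (1/2) f" for f by (simp add: H_norm_def infsum_nonneg H_weight_nonneg)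
  have b: "(\<Sum>k\<in>S. (norm (V t k))\<^sup>2) \<le> 16 * C\<^sup>2" if "finite S" for S
  proof -
    have "(\<Sum>k\<in>S. (norm (V t k))\<^sup>2) \<le> 8 * ((H_norm (1/2) (w t))\<^sup>2 + (H_norm (1/2) (u t))\<^sup>2)"
      using sum_leray_part_le[of "\<lambda>_. 1" "fourier_coeff (w t)" _ "fourier_coeff (u t)"] H12_sum0 that assms
      by (simp add: V_def D_def good_def)
    also have "\<dots> \<le> 8 * (C\<^sup>2 + C\<^sup>2)"
      using assms H0 by (intro mult_left_mono add_mono power_mono) (auto simp: good_def)
    finally show ?thesis by simp
  qed
  have s: "(\<lambda>k. (norm (V t k))\<^sup>2) summable_on UNIV" by (rule bounded_summable[OF b]) simp_all
  then show "((\<lambda>k. (norm (V t k))\<^sup>2) has_sum Y t) UNIV" unfolding Y_def by (rule has_sum_infsum)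
  show "Y t \<le> 16 * C\<^sup>2" unfolding Y_def by (rule infsum_le_finite_sums[OF s]) (use b in simp)
qed

lemma good_Z:
  assumes "good C t"
  shows "((\<lambda>k. (norm (freq k))\<^sup>2 * (norm (V t k))\<^sup>2) has_sum Z t) UNIV"
    "Z t \<le> 8 * ((H_norm (3/2) (w t))\<^sup>2 + (H_norm (3/2) (u t))\<^sup>2)"
proof -
  have b: "(\<Sum>k\<in>S. (norm (freq k))\<^sup>2 * (norm (V t k))\<^sup>2) \<le> 8 * ((H_norm (3/2) (w t))\<^sup>2 + (H_norm (3/2) (u t))\<^sup>2)" if "finite S" for S
    using sum_leray_part_le[of "\<lambda>k. (norm (freq k))\<^sup>2" "fourier_coeff (w t)" _ "fourier_coeff (u t)"] H32_sum1 that assms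
    by (simp add: V_def D_def good_def)
  have s: "(\<lambda>k. (norm (freq k))\<^sup>2 * (norm (V t k))\<^sup>2) summable_on UNIV" by (rule bounded_summable[OF b]) simp_all
  then show "((\<lambda>k. (norm (freq k))\<^sup>2 * (norm (V t k))\<^sup>2) has_sum Z t) UNIV" unfolding Z_def by (rule has_sum_infsum)
  show "Z t \<le> 8 * ((H_norm (3/2) (w t))\<^sup>2 + (H_norm (3/2) (u t))\<^sup>2)"
    unfolding Z_def by (rule infsum_le_finite_sums[OF s]) (use b in simp)
qed

lemma int_h: "integrable (lebesgue_on {0<..<T}) h"
proof -
  interpret M: finite_measure "lebesgue_on {0<..<T}"
    by (rule finite_measure_lebesgue_on) (simp add: bounded_set_imp_lmeasurable)
  show ?thesis unfolding h_def[abs_def]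
    by (intro Bochner_Integration.integrable_add integrable_mult_right Hhalf_class_facts(4)[OF uC]) simp
qed

lemma int_Z: "integrable (lebesgue_on {0<..<T}) Z"
proof (rule Bochner_Integration.integrable_bound)
  let ?M = "lebesgue_on {0<..<T}"
  show "integrable ?M (\<lambda>t. 8 * ((H_norm (3/2) (w t))\<^sup>2 + (H_norm (3/2) (u t))\<^sup>2))"
    by (intro integrable_mult_right Bochner_Integration.integrable_add Hhalf_class_facts(4) uC wC)
  show "AE t in ?M. norm (Z t) \<le> norm (8 * ((H_norm (3/2) (w t))\<^sup>2 + (H_norm (3/2) (u t))\<^sup>2))"
    using Cg by eventually_elim (use good_Z(2) Z_nonneg in fastforce)
  show "Z \<in> borel_measurable ?M"
  proof (rule measurable_AE_lim)
    show "AE t in ?M. (\<lambda>n. \<Sum>k | freq_sup k \<le> n. (norm (freq k))\<^sup>2 * (norm (V t k))\<^sup>2) \<longlonglongrightarrow> Z t"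
      using Cg by eventually_elim (intro has_sum_freq_sup_lim good_Z(1))
    show "(\<lambda>t. \<Sum>k | freq_sup k \<le> n. (norm (freq k))\<^sup>2 * (norm (V t k))\<^sup>2) \<in> borel_measurable ?M" for n
      by (intro borel_measurable_sum borel_measurable_times borel_measurable_const normV_meas)
  qed simp
qed

lemma int_hY: "integrable (lebesgue_on {0<..<T}) (\<lambda>t. h t * Y t)"
proof (rule Bochner_Integration.integrable_bound)
  let ?M = "lebesgue_on {0<..<T}"
  show "integrable ?M (\<lambda>t. h t * (16 * C\<^sup>2))" by (intro integrable_mult_left int_h)
  show "AE t in ?M. norm (h t * Y t) \<le> norm (h t * (16 * C\<^sup>2))"
    using Cg
  proof eventually_elim
    case (elim t)
    have "h t * Y t \<le> h t * (16 * C\<^sup>2)" by (intro mult_left_mono good_Y(2) elim h_nonneg)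
    then show ?case using h_nonneg[of t] Y_nonneg[of t] by (simp add: abs_mult)
  qed
  have "Y \<in> borel_measurable ?M"
  proof (rule measurable_AE_lim)
    show "AE t in ?M. (\<lambda>n. \<Sum>k | freq_sup k \<le> n. (norm (V t k))\<^sup>2) \<longlonglongrightarrow> Y t"
      using Cg by eventually_elim (intro has_sum_freq_sup_lim good_Y(1))
    show "(\<lambda>t. \<Sum>k | freq_sup k \<le> n. (norm (V t k))\<^sup>2) \<in> borel_measurable ?M" for n
      by (intro borel_measurable_sum normV_meas)
  qed simp
  then show "(\<lambda>t. h t * Y t) \<in> borel_measurable ?M"
    by (intro borel_measurable_times borel_measurable_integrable[OF int_h])
qed

lemma int_ZF: "integrable (lebesgue_on {0<..<T}) (\<lambda>s. \<Sum>k\<in>F. (norm (freq k))\<^sup>2 * (norm (V s k))\<^sup>2)" if "finite F"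
proof (rule Bochner_Integration.integrable_bound[OF int_Z])
  show "(\<lambda>s. \<Sum>k\<in>F. (norm (freq k))\<^sup>2 * (norm (V s k))\<^sup>2) \<in> borel_measurable (lebesgue_on {0<..<T})"
    by (intro borel_measurable_sum borel_measurable_times borel_measurable_const normV_meas)
  show "AE s in lebesgue_on {0<..<T}. norm (\<Sum>k\<in>F. (norm (freq k))\<^sup>2 * (norm (V s k))\<^sup>2) \<le> norm (Z s)"
    using Cg
  proof eventually_elim
    case (elim s)
    have "(\<Sum>k\<in>F. (norm (freq k))\<^sup>2 * (norm (V s k))\<^sup>2) \<le> Z s"
      unfolding Z_def using that by (intro finite_sum_le_infsum has_sum_imp_summable[OF good_Z(1)[OF elim]]) auto
    moreover have "0 \<le> (\<Sum>k\<in>F. (norm (freq k))\<^sup>2 * (norm (V s k))\<^sup>2)" by (intro sum_nonneg) simp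
    ultimately show ?case by simp
  qed
qed

text \<open>Sum of the square identities for the modes over \<open>F\<close> and the three
  components. The linear part of \<open>G\<close> yields twice the truncated dissipation; the
  nonlinear part is bounded in terms of the full sums \<open>Z\<close> and \<open>Y\<close>.\<close>

lemma energy_finite:
  assumes t: "t \<in> {0..<T}" and F: "finite F"
  shows "(\<Sum>k\<in>F. (norm (V t k))\<^sup>2)
    \<le> (\<integral>s. Z s + h s * Y s - 2 * (\<Sum>k\<in>F. (norm (freq k))\<^sup>2 * (norm (V s k))\<^sup>2) \<partial>lebesgue_on {0..t})"
proof -
  let ?N = "lebesgue_on {0..t}"
  have tT: "t < T" "0 \<le> t" using t by auto
  define e where "e k i s = Re (cnj (z k (pvec k i) s) * G k (pvec k i) s)" for k i s
  have id: "integrable ?N (e k i)" "(norm (z k (pvec k i) t))\<^sup>2 = - 2 * (\<integral>s. e k i s \<partial>?N)" for k i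
  proof -
    have Gi: "integrable ?N (G k (pvec k i))" by (rule integrable_lebesgue_on_mono[OF int_G tT(1)])
    have zm: "z k (pvec k i) \<in> borel_measurable ?N"
      by (rule borel_measurable_integrable[OF integrable_lebesgue_on_mono[OF int_z tT(1)]])
    have ze: "z k (pvec k i) s = - (\<integral>r. G k (pvec k i) r \<partial>lebesgue_on {0..s})" if "s \<in> {0..t}" for s
      using that t by (intro mode_equation pvec_orth) auto
    \<comment> \<open>\<open>4 * C\<close> is the bound \<open>2 * C\<close> for the difference of
      the coefficients times the bound 2 for \<open>pvec\<close>.\<close>
    have zb: "AE s in ?N. norm (z k (pvec k i) s) \<le> 4 * C"
      using good_AE[OF tT(1)]
    proof eventually_elim
      case (elim s)
      have "norm (fourier_coeff (w s) k) \<le> C" "norm (fourier_coeff (u s) k) \<le> C"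
        using elim fourier_coeff_le_H_norm[of "w s" "1/2" k] fourier_coeff_le_H_norm[of "u s" "1/2" k]
        unfolding good_def by linarith+
      then have D: "norm (D s k) \<le> 2 * C"
        unfolding D_def using norm_triangle_ineq4[of "fourier_coeff (w s) k" "fourier_coeff (u s) k"] by linarith
      have "norm (z k (pvec k i) s) \<le> norm (D s k) * norm (pvec k i)"
        unfolding z_def using norm_cdot_le[of "D s k" "cvec (pvec k i)"] by simp
      also have "\<dots> \<le> (2 * C) * 2" using C0 by (intro mult_mono D norm_pvec_le) auto
      finally show ?case by simp
    qed
    show "integrable ?N (e k i)"
      unfolding e_def[abs_def] by (rule integral_square_identity_complex(1)[OF tT(2) Gi ze zm zb])
    show "(norm (z k (pvec k i) t))\<^sup>2 = - 2 * (\<integral>s. e k i s \<partial>?N)"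
      unfolding e_def by (rule integral_square_identity_complex(2)[OF tT(2) Gi ze zm zb])
  qed
  have "(\<Sum>k\<in>F. (norm (V t k))\<^sup>2) = (\<Sum>k\<in>F. \<Sum>i\<in>UNIV. - 2 * (\<integral>s. e k i s \<partial>?N))"
    unfolding norm_vec3_sq V_nth id(2) ..
  also have "\<dots> = (\<integral>s. (\<Sum>k\<in>F. \<Sum>i\<in>UNIV. - 2 * e k i s) \<partial>?N)"
    using id(1) by (simp only: Bochner_Integration.integral_sum Bochner_Integration.integrable_sum
        integrable_mult_right integral_mult_right_zero)
  also have "\<dots> \<le> (\<integral>s. Z s + h s * Y s - 2 * (\<Sum>k\<in>F. (norm (freq k))\<^sup>2 * (norm (V s k))\<^sup>2) \<partial>?N)"
  proof (rule integral_mono_AE)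
    show "integrable ?N (\<lambda>s. \<Sum>k\<in>F. \<Sum>i\<in>UNIV. - 2 * e k i s)"
      by (intro Bochner_Integration.integrable_sum integrable_mult_right id)
    show "integrable ?N (\<lambda>s. Z s + h s * Y s - 2 * (\<Sum>k\<in>F. (norm (freq k))\<^sup>2 * (norm (V s k))\<^sup>2))"
      by (intro Bochner_Integration.integrable_diff Bochner_Integration.integrable_add integrable_mult_right
          integrable_lebesgue_on_mono[OF _ tT(1)] int_Z int_hY int_ZF F)
    show "AE s in ?N. (\<Sum>k\<in>F. \<Sum>i\<in>UNIV. - 2 * e k i s)
        \<le> Z s + h s * Y s - 2 * (\<Sum>k\<in>F. (norm (freq k))\<^sup>2 * (norm (V s k))\<^sup>2)"
      using good_AE[OF tT(1)]
    proof eventually_elim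
      case (elim s)
      \<comment> \<open>The real part of \<open>cnj z * G\<close> splits into the nonlinear
        contribution and \<open>(norm (freq k))^2 * |z|^2\<close>; only the former is estimated in
        absolute value.\<close>
      have pt: "- 2 * e k i s \<le> 2 * (norm (V s k $ i) * norm (N k (pvec k i) s)) - 2 * ((norm (freq k))\<^sup>2 * (norm (V s k $ i))\<^sup>2)" for k i
      proof -
        let ?z = "z k (pvec k i) s" and ?n = "N k (pvec k i) s"
        have "e k i s = Re (cnj ?z * ?n) + (norm (freq k))\<^sup>2 * (norm ?z)\<^sup>2"
          unfolding e_def G_def by (simp only: cmod_power2) (simp add: power2_eq_square algebra_simps)
        moreover have "\<bar>Re (cnj ?z * ?n)\<bar> \<le> norm ?z * norm ?n"
          using abs_Re_le_cmod[of "cnj ?z * ?n"] by (simp add: norm_mult)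
        ultimately show ?thesis unfolding V_nth by linarith
      qed
      have "(\<Sum>k\<in>F. \<Sum>i\<in>UNIV. - 2 * e k i s)
          \<le> (\<Sum>k\<in>F. \<Sum>i\<in>UNIV. 2 * (norm (V s k $ i) * norm (N k (pvec k i) s)) - 2 * ((norm (freq k))\<^sup>2 * (norm (V s k $ i))\<^sup>2))"
        by (intro sum_mono pt)
      also have "\<dots> = (\<Sum>k\<in>F. \<Sum>i\<in>UNIV. 2 * (norm (V s k $ i) * norm (N k (pvec k i) s)))
          - 2 * (\<Sum>k\<in>F. (norm (freq k))\<^sup>2 * (norm (V s k))\<^sup>2)"
        by (simp add: sum_subtractf norm_vec3_sq sum_distrib_left)
      also have "(\<Sum>k\<in>F. \<Sum>i\<in>UNIV. 2 * (norm (V s k $ i) * norm (N k (pvec k i) s))) \<le> Z s + h s * Y s"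
        using nonlinear_energy_bound[of "u s" "w s" F C] elim F
        unfolding N_def V_def D_def Z_def Y_def h_def good_def by blast
      finally show ?case by simp
    qed
  qed
  finally show ?thesis .
qed

text \<open>As the frequency cubes exhaust the lattice, the difference of \<open>Z\<close> and twice
  its truncation tends to \<open>- Z\<close>, which is discarded. The limit is taken inside the time
  integral with the integrable majorant \<open>3 * Z + h * Y\<close>.\<close>

lemma energy:
  assumes t: "t \<in> {0..<T}"
  shows "Y t \<le> (\<integral>s. h s * Y s \<partial>lebesgue_on {0..t})"
proof -
  let ?N = "lebesgue_on {0..t}"
  have tT: "t < T" using t by simp
  let ?Z = "\<lambda>n s. \<Sum>k | freq_sup k \<le> n. (norm (freq k))\<^sup>2 * (norm (V s k))\<^sup>2"
  have iN: "integrable ?N Z" "integrable ?N (\<lambda>s. h s * Y s)" "integrable ?N (?Z n)" for n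
    by (intro integrable_lebesgue_on_mono[OF _ tT] int_Z int_hY int_ZF freq_sup_ball)+
  have "(\<lambda>n. \<integral>s. Z s + h s * Y s - 2 * ?Z n s \<partial>?N) \<longlonglongrightarrow> (\<integral>s. Z s + h s * Y s - 2 * Z s \<partial>?N)"
  proof (rule integral_dominated_convergence[where w="\<lambda>s. 3 * Z s + h s * Y s"])
    show "(\<lambda>s. Z s + h s * Y s - 2 * Z s) \<in> borel_measurable ?N"
      by (intro borel_measurable_integrable Bochner_Integration.integrable_diff Bochner_Integration.integrable_add integrable_mult_right iN)
    show "(\<lambda>s. Z s + h s * Y s - 2 * ?Z n s) \<in> borel_measurable ?N" for n
      by (intro borel_measurable_integrable Bochner_Integration.integrable_diff Bochner_Integration.integrable_add integrable_mult_right iN)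
    show "integrable ?N (\<lambda>s. 3 * Z s + h s * Y s)"
      by (intro Bochner_Integration.integrable_add integrable_mult_right iN)
    show "AE s in ?N. (\<lambda>n. Z s + h s * Y s - 2 * ?Z n s) \<longlonglongrightarrow> Z s + h s * Y s - 2 * Z s"
      using good_AE[OF tT] by eventually_elim (intro tendsto_intros has_sum_freq_sup_lim good_Z(1))
    show "AE s in ?N. norm (Z s + h s * Y s - 2 * ?Z n s) \<le> 3 * Z s + h s * Y s" for n
      using good_AE[OF tT]
    proof eventually_elim
      case (elim s)
      have "?Z n s \<le> Z s"
        unfolding Z_def by (intro finite_sum_le_infsum has_sum_imp_summable[OF good_Z(1)[OF elim]] freq_sup_ball) auto
      moreover have "0 \<le> ?Z n s" by (intro sum_nonneg) simp
      moreover have "0 \<le> h s * Y s" by (intro mult_nonneg_nonneg h_nonneg Y_nonneg)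
      ultimately show ?case unfolding real_norm_def using Z_nonneg[of s] by linarith
    qed
  qed
  moreover have "(\<lambda>n. \<Sum>k | freq_sup k \<le> n. (norm (V t k))\<^sup>2) \<longlonglongrightarrow> Y t"
    unfolding Y_def by (intro has_sum_freq_sup_lim has_sum_infsum summable_Y t)
  ultimately have "Y t \<le> (\<integral>s. Z s + h s * Y s - 2 * Z s \<partial>?N)"
    using energy_finite[OF t freq_sup_ball(1)] by (intro LIMSEQ_le) auto
  also have "\<dots> \<le> (\<integral>s. h s * Y s \<partial>?N)"
  proof (rule integral_mono)
    show "integrable ?N (\<lambda>s. Z s + h s * Y s - 2 * Z s)"
      by (intro Bochner_Integration.integrable_diff Bochner_Integration.integrable_add integrable_mult_right iN)
    show "Z s + h s * Y s - 2 * Z s \<le> h s * Y s" for s using Z_nonneg[of s] by linarith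
  qed (rule iN)
  finally show ?thesis .
qed

lemma Y_zero:
  assumes t: "t \<in> {0..<T}"
  shows "Y t = 0"
proof (rule gronwall_zero[where h=h and Y=Y and ?t0.0=t])
  have tT: "t < T" using t by simp
  have i: "integrable (lebesgue_on {0..s}) h" "integrable (lebesgue_on {0..s}) (\<lambda>r. h r * Y r)" if "s \<le> t" for s
    using that tT by (simp_all add: integrable_lebesgue_on_mono[OF int_h] integrable_lebesgue_on_mono[OF int_hY])
  \<comment> \<open>The Gronwall lemma is phrased with the gauge integral, which agrees with the
    Lebesgue integral for these functions.\<close>
  show "h absolutely_integrable_on {0..t}" "(\<lambda>r. h r * Y r) absolutely_integrable_on {0..t}"
    using i[OF order_refl] unfolding set_integrable_def by (simp_all add: integrable_restrict_space)
  show "Y s \<le> integral {0..s} (\<lambda>r. h r * Y r)" if "s \<in> {0..t}" for s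
    using energy[of s] that t i(2)[of s] by (simp add: lebesgue_integral_eq_integral)
qed (use t h_nonneg Y_nonneg in auto)

lemma V_zero:
  assumes t: "t \<in> {0..<T}"
  shows "V t k = 0"
proof -
  have "(\<Sum>k\<in>{k}. (norm (V t k))\<^sup>2) \<le> Y t"
    unfolding Y_def by (rule finite_sum_le_infsum[OF summable_Y[OF t]]) auto
  then show ?thesis using Y_zero[OF t] by simp
qed

end

text \<open>The bound \<open>C\<close> is discharged here: all Leray coefficients of
  \<open>w t - u t\<close> vanish at every time, and \<open>L2_inner_zero\<close> converts this into
  orthogonality.\<close>

lemma leray_solution:
  assumes t: "t \<in> {0..<T}"
  shows "leray (w t) (u t)"
  unfolding leray_def
proof (intro conjI ballI wL[OF t] uS[OF t])
  fix f assume f: "f \<in> L2_sigma"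
  obtain C where C: "0 \<le> C" "AE t in lebesgue_on {0<..<T}. good C t" by (rule good_exists)
  show "L2_inner (\<lambda>x. w t x - u t x) f = 0"
  proof (rule L2_inner_zero[OF L2_diff[OF wL[OF t] uL[OF t]] f])
    show "leray_part (fourier_coeff (\<lambda>x. w t x - u t x) k) k = 0" for k
      using V_zero[OF C t, of k] unfolding V_def D_def fourier_coeff_diff[OF wL[OF t] uL[OF t]] .
  qed
qed

end

theorem proposition7:
  fixes T :: real and u w :: "real \<Rightarrow> field" and u0 w0 :: field
  assumes "T > 0"
    and "u \<in> Hhalf_class T"
    and "NS_weak_solution T u0 u"
    and "w0 \<in> H (1/2)"
    and "leray w0 u0"
    and "Hhalf_solution T u w0 w"
  shows "\<forall>t\<in>{0..<T}. leray (w t) (u t)"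
proof -
  interpret linearised_solution T u w u0 w0
    using assms by unfold_locales
  show ?thesis using leray_solution by blast
qed

end
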